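(* For every positive integer $r$ and every one of the six models (Independent set, MAX-CUT, anti-ferromagnetic Ising, $q$-Coloring, K-SAT, NAE-K-SAT), there exists a (model dependent) $H(r)$ such that $$\lim_{N\to\infty,\ N\in r^{-1}K\mathbb{Z}_+}N^{-1}H\big(\mathbb{G}(N,r)\big)=H(r)$$ with high probability (in probability).
   Context: Let $K\ge2$, $\chi=\{0,\dots,q-1\}$, $[N]=\{1,\dots,N\}$, and assume $Nr/K$ is an integer. The random $r$-regular hypergraph $\mathbb{G}(N,r)$ is built by the configuration model: each node $i\in[N]$ is given $r$ copies (points), giving $Nr$ points; a uniformly random partition of these $Nr$ points into $Nr/K$ blocks of size $K$ is chosen, and each block is projected to the (directed) hyperedge formed by the nodes owning its $K$ points. For a hypergraph $G=([N],E)$ with node potentials $H_i$ and edge potentials $H_e:\chi^K\to\mathbb{R}\cup\{-\infty\}$, $H(x)=\sum_iH_i(x_i)+\sum_{e\in E}H_e(x_e)$ and $H(G)=\max_{x\in\chi^N}H(x)$. Models: Independent set ($K=2,q=2$, $H_i(1)=1,H_i(0)=0$, $H_e(1,1)=-\infty$, else $0$); MAX-CUT ($K=2,q=2$, $H_i\equiv0$, $H_e(x,y)=\mathbf 1[x\ne y]$); anti-ferromagnetic Ising ($K=2,q=2$, fixed $\beta>0,B\in\mathbb{R}$, $H_i(0)=-B,H_i(1)=B$, $H_e(x,y)=-\beta$ if $x=y$, $\beta$ otherwise); $q$-Coloring ($K=2$, $H_i\equiv0$, $H_e(x,y)=\mathbf 1[x\ne y]$); K-SAT ($q=2$, $H_i\equiv0$,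 independent uniform $a_e\in\{0,1\}^K$ per hyperedge, $H_e(a_e)=0$, $1$ otherwise); NAE-K-SAT (same with $H_e(a_e)=H_e(\mathbf1-a_e)=0$, $1$ otherwise). *)

theory Defs
  imports "HOL-Probability.Probability"
begin

text \<open>A (spin) model: arity K of hyperedges, alphabet size q (spins 0..q-1),
 node potential, and edge potential. The edge potential additionally receives
 the per-hyperedge random sign vector a_e (a list of K booleans); models
 other than K-SAT / NAE-K-SAT ignore it.\<close>

record model =
  mK :: nat
  mq :: nat
  node_pot :: "nat \<Rightarrow> ereal"
  edge_pot :: "bool list \<Rightarrow> nat list \<Rightarrow> ereal"

definition bit :: "bool \<Rightarrow> nat" where "bit b = (if b then 1 else 0)"

definition indep_set_model :: model where
  "indep_set_model = \<lparr> mK = 2, mq = 2,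
     node_pot = (\<lambda>x. if x = 1 then 1 else 0),
     edge_pot = (\<lambda>a xs. if xs ! 0 = 1 \<and> xs ! 1 = 1 then -\<infinity> else 0) \<rparr>"

definition maxcut_model :: model where
  "maxcut_model = \<lparr> mK = 2, mq = 2,
     node_pot = (\<lambda>x. 0),
     edge_pot = (\<lambda>a xs. if xs ! 0 \<noteq> xs ! 1 then 1 else 0) \<rparr>"

definition ising_model :: "real \<Rightarrow> real \<Rightarrow> model" where
  "ising_model \<beta> B = \<lparr> mK = 2, mq = 2,
     node_pot = (\<lambda>x. if x = 0 then ereal (- B) else ereal B),
     edge_pot = (\<lambda>a xs. if xs ! 0 = xs ! 1 then ereal (- \<beta>) else ereal \<beta>) \<rparr>"

definition coloring_model :: "nat \<Rightarrow> model" where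
  "coloring_model q = \<lparr> mK = 2, mq = q,
     node_pot = (\<lambda>x. 0),
     edge_pot = (\<lambda>a xs. if xs ! 0 \<noteq> xs ! 1 then 1 else 0) \<rparr>"

definition ksat_model :: "nat \<Rightarrow> model" where
  "ksat_model K = \<lparr> mK = K, mq = 2,
     node_pot = (\<lambda>x. 0),
     edge_pot = (\<lambda>a xs. if xs = map bit a then 0 else 1) \<rparr>"

definition naeksat_model :: "nat \<Rightarrow> model" where
  "naeksat_model K = \<lparr> mK = K, mq = 2,
     node_pot = (\<lambda>x. 0),
     edge_pot = (\<lambda>a xs. if xs = map bit a \<or> xs = map (\<lambda>b. 1 - bit b) a then 0 else 1) \<rparr>"

definition paper_model :: "model \<Rightarrow> bool" where
  "paper_model M \<longleftrightarrow>
     M = indep_set_model \<or> M = maxcut_model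
   \<or> (\<exists>\<beta> B. \<beta> > 0 \<and> M = ising_model \<beta> B)
   \<or> (\<exists>q\<ge>2. M = coloring_model q)
   \<or> (\<exists>K\<ge>2. M = ksat_model K)
   \<or> (\<exists>K\<ge>2. M = naeksat_model K)"

text \<open>Configuration model: node i \<in> {0..<N} owns the points {i*r..<(i+1)*r};
 the points {0..<N*r} are partitioned into blocks of size K.\<close>
definition config_partitions :: "nat \<Rightarrow> nat \<Rightarrow> nat \<Rightarrow> nat set set set" where
  "config_partitions N r K =
     {P. (\<forall>B\<in>P. B \<subseteq> {..<N*r} \<and> card B = K) \<and> (\<forall>p<N*r. \<exists>!B. B \<in> P \<and> p \<in> B)}"

definition edge_nodes :: "nat \<Rightarrow> nat set \<Rightarrow> nat list" where
  "edge_nodes r B = map (\<lambda>p. p div r) (sorted_list_of_set B)"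

definition random_hypergraph :: "nat \<Rightarrow> nat \<Rightarrow> nat \<Rightarrow> (nat set set \<times> (nat set \<Rightarrow> bool list)) pmf" where
  "random_hypergraph K N r =
     do { P \<leftarrow> pmf_of_set (config_partitions N r K);
          a \<leftarrow> pmf_of_set (PiE P (\<lambda>_. {a. length a = K}));
          return_pmf (P, a) }"

definition H_config :: "model \<Rightarrow> nat \<Rightarrow> nat \<Rightarrow> nat set set \<Rightarrow> (nat set \<Rightarrow> bool list)
     \<Rightarrow> (nat \<Rightarrow> nat) \<Rightarrow> ereal" where
  "H_config M N r P a x =
     (\<Sum>i<N. node_pot M (x i)) + (\<Sum>B\<in>P. edge_pot M (a B) (map x (edge_nodes r B)))"

definition H_graph :: "model \<Rightarrow> nat \<Rightarrow> nat \<Rightarrow> nat set set \<times> (nat set \<Rightarrow> bool list) \<Rightarrow> ereal" where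
  "H_graph M N r G =
     Max (H_config M N r (fst G) (snd G) ` PiE {..<N} (\<lambda>_. {..<mq M}))"

end

theory Submission
  imports Defs "HOL-Real_Asymp.Real_Asymp"
begin

text \<open>
  After rescaling, adding a hyperedge to a graph raises the optimum by an amount in [0,1] (for independent sets the
  hard constraint is first replaced by a penalty of 1 per violated edge, which does not change the optimum). Hence the
  optimum is a Lipschitz function of the random partition, its variance is O(N), and only the convergence of the mean
  has to be shown.

  Split the points into two sides of sizes proportional to p and q. A global step adds a block each of whose points
  chooses its side independently with probabilities p and q; a split step chooses one side with these
  probabilities and takes the whole block there. In both cases the points are uniform among the free points of their
  sides. All these steps commute, so that one step can be exchanged for the other one as if it came last. At that moment
  the block raises the optimum by less than 1 - t exactly if it is bad for all assignments within t of the optimum, and for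
  each of the six models this means, up to a factor depending on the signs, that all its nodes lie in one class of a
  partial equivalence relation. By convexity of the K-th power a split step is more likely to do so than a global one, up
  to an error of order 1/m when at least m points are free on each side. A Chernoff bound excludes the case of fewer
  free points. Exchanging all steps compares the graph on N1 + N2 nodes with the disjoint union of graphs on N1
  and N2 nodes: the mean is superadditive up to an error of order N^(3/4), so it converges after division by N.
\<close>

section \<open>Averages over marked partitions\<close>

text \<open>The process has to stop before a side runs short: with m free points convexity may fail
  by up to K^2 / m, and a step that lacks points loses mass. Hence d blocks are left over. For sizes
  of order n, taking m about n^(3/4) exceeds the fluctuations, of order n^(1/2), by enough to make a
  shortage exponentially rare in n^(1/4). The leftover blocks cost O(n^(3/4)) and the convexity
  errors add up to O(n / m) = O(n^(1/4)), so the leftover dictates the exponent 3/4.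

  The thresholds t are there because real node potentials, as for Ising, make the increments of the
  optimum fractional.

  The constants in superadditivity depend on the ratio of the two sizes, which rules out a plain
  Fekete argument. Only ratios k : 1 with k below a fixed bound and repeated doublings are used,
  whose errors sum like a geometric series. Sizes are multiples of K, where divisibility is
  automatic; the Lipschitz bound for the mean reaches the other N with K dividing N r.\<close>

definition avg :: "'a set \<Rightarrow> ('a \<Rightarrow> real) \<Rightarrow> real" where
  "avg X f = (\<Sum>x\<in>X. f x) / real (card X)"

lemma avg_mono: "(\<And>x. x \<in> X \<Longrightarrow> f x \<le> g x) \<Longrightarrow> avg X f \<le> avg X g"
  unfolding avg_def by (intro divide_right_mono sum_mono) auto

lemma avg_cong: "(\<And>x. x \<in> X \<Longrightarrow> f x = g x) \<Longrightarrow> avg X f = avg X g"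
  unfolding avg_def by (simp cong: sum.cong)

lemma avg_add: "avg X (\<lambda>x. f x + g x) = avg X f + avg X g"
  by (simp add: avg_def sum.distrib add_divide_distrib)

lemma avg_diff: "avg X (\<lambda>x. f x - g x) = avg X f - avg X g"
  by (simp add: avg_def sum_subtractf diff_divide_distrib)

lemma avg_cmult: "avg X (\<lambda>x. c * f x) = c * avg X f"
  by (simp add: avg_def sum_distrib_left)

lemma avg_const: "finite X \<Longrightarrow> X \<noteq> {} \<Longrightarrow> avg X (\<lambda>_. c) = c"
  by (simp add: avg_def)

lemma avg_le: "finite X \<Longrightarrow> X \<noteq> {} \<Longrightarrow> (\<And>x. x \<in> X \<Longrightarrow> f x \<le> c) \<Longrightarrow> avg X f \<le> c"
  using avg_mono[of X f "\<lambda>_. c"] by (simp add: avg_const)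

lemma avg_ge: "finite X \<Longrightarrow> X \<noteq> {} \<Longrightarrow> (\<And>x. x \<in> X \<Longrightarrow> c \<le> f x) \<Longrightarrow> c \<le> avg X f"
  using avg_mono[of X "\<lambda>_. c" f] by (simp add: avg_const)

lemma avg_nonneg: "(\<And>x. x \<in> X \<Longrightarrow> 0 \<le> f x) \<Longrightarrow> 0 \<le> avg X f"
  unfolding avg_def by (intro divide_nonneg_nonneg sum_nonneg) auto

lemma avg_exists_le:
  assumes "finite X" "X \<noteq> {}"
  shows "\<exists>x\<in>X. f x \<le> avg X f"
proof (rule ccontr)
  assume "\<not> ?thesis"
  then have "(\<Sum>x\<in>X. avg X f) < (\<Sum>x\<in>X. f x)" using assms by (intro sum_strict_mono) auto
  then show False using assms by (simp add: avg_def)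
qed

lemma avg_abs_diff_le:
  assumes "finite X" "X \<noteq> {}" "\<And>x. x \<in> X \<Longrightarrow> \<bar>f x - g x\<bar> \<le> c"
  shows "\<bar>avg X f - avg X g\<bar> \<le> c"
proof -
  have "f x - g x \<le> c" "- c \<le> f x - g x" if "x \<in> X" for x using assms(3)[OF that] by simp_all
  then have "avg X (\<lambda>x. f x - g x) \<le> c" "- c \<le> avg X (\<lambda>x. f x - g x)"
    using avg_le[OF assms(1,2), of "\<lambda>x. f x - g x"] avg_ge[OF assms(1,2), of _ "\<lambda>x. f x - g x"] by blast+
  then show ?thesis by (simp add: avg_diff abs_le_iff)
qed

section \<open>Marked partitions and the recursion for uniform averages\<close>

definition cov :: "('p set \<times> 'm) set \<Rightarrow> 'p set" where
  "cov Q = \<Union>(fst ` Q)"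

lemma cov_simps [simp]: "cov {} = {}" "cov (insert b Q) = fst b \<union> cov Q" "cov (P \<union> Q) = cov P \<union> cov Q"
  by (auto simp: cov_def)

text \<open>A block carries a mark, which plays the role of the sign vector of a clause. Thus a hypergraph together with its
  signs is a set of pairs.\<close>

locale marked_blocks =
  fixes K :: nat and A :: "'m set"
  assumes K_pos: "1 \<le> K" and finite_A: "finite A" and A_nonempty: "A \<noteq> {}"
begin

definition Bl :: "'p set \<Rightarrow> ('p set \<times> 'm) set" where
  "Bl F = {e. e \<subseteq> F \<and> card e = K} \<times> A"

text \<open>Uniqueness is demanded of the pair, so the same block cannot occur with two marks: an
  element is a partition together with one mark per block.\<close>

definition MPart :: "'p set \<Rightarrow> ('p set \<times> 'm) set set" where
  "MPart F = {Q. Q \<subseteq> Bl F \<and> (\<forall>p\<in>F. \<exists>!b. b \<in> Q \<and> p \<in> fst b)}"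

text \<open>For finite \<open>F\<close> whose size is not a multiple of K there is no partition and
  the value is 0, the average over the empty set.\<close>

definition EP :: "'p set \<Rightarrow> (('p set \<times> 'm) set \<Rightarrow> real) \<Rightarrow> real" where
  "EP F \<phi> = avg (MPart F) \<phi>"

lemma finite_Bl [simp]: "finite F \<Longrightarrow> finite (Bl F)"
  by (simp add: Bl_def finite_A)

lemma card_Bl: "finite F \<Longrightarrow> card (Bl F) = (card F choose K) * card A"
  by (simp add: Bl_def card_cartesian_product n_subsets)

lemma Bl_nonempty: "finite F \<Longrightarrow> K \<le> card F \<Longrightarrow> Bl F \<noteq> {}"
proof -
  assume "finite F" "K \<le> card F"
  then obtain e where "e \<subseteq> F" "card e = K" using obtain_subset_with_card_n by metis
  moreover obtain a where "a \<in> A" using A_nonempty by blast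
  ultimately have "(e, a) \<in> Bl F" by (simp add: Bl_def)
  then show "Bl F \<noteq> {}" by blast
qed

lemma Bl_mono: "F \<subseteq> G \<Longrightarrow> Bl F \<subseteq> Bl G"
  by (auto simp: Bl_def)

lemma BlD: "b \<in> Bl F \<Longrightarrow> fst b \<subseteq> F" "b \<in> Bl F \<Longrightarrow> card (fst b) = K" "b \<in> Bl F \<Longrightarrow> snd b \<in> A"
  by (auto simp: Bl_def)

lemma card_Diff_Bl: "b \<in> Bl F \<Longrightarrow> finite F \<Longrightarrow> card F = K * Suc n \<Longrightarrow> card (F - fst b) = K * n"
  using BlD[of b F] finite_subset[of "fst b" F] card_Diff_subset[of "fst b" F] by simp

lemma Bl_fst_nonempty: "b \<in> Bl F \<Longrightarrow> fst b \<noteq> {}"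
  using K_pos by (auto simp: Bl_def)

lemma finite_MPart [simp]: "finite F \<Longrightarrow> finite (MPart F)"
  by (rule finite_subset[of _ "Pow (Bl F)"]) (auto simp: MPart_def)

lemma MPart_subset: "Q \<in> MPart F \<Longrightarrow> Q \<subseteq> Bl F"
  by (simp add: MPart_def)

lemma MPart_finite: "Q \<in> MPart F \<Longrightarrow> finite F \<Longrightarrow> finite Q"
  by (rule finite_subset[OF MPart_subset finite_Bl])

lemma MPart_ex1: "Q \<in> MPart F \<Longrightarrow> p \<in> F \<Longrightarrow> \<exists>!b. b \<in> Q \<and> p \<in> fst b"
  by (simp add: MPart_def)

lemma MPart_cov: assumes "Q \<in> MPart F" shows "cov Q = F"
proof
  show "cov Q \<subseteq> F" using MPart_subset[OF assms] BlD(1) unfolding cov_def by blast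
  show "F \<subseteq> cov Q" using MPart_ex1[OF assms] unfolding cov_def by blast
qed

lemma MPart_disjoint:
  assumes "Q \<in> MPart F" "b \<in> Q" "b' \<in> Q" "b \<noteq> b'"
  shows "fst b \<inter> fst b' = {}"
proof (rule ccontr)
  assume "fst b \<inter> fst b' \<noteq> {}"
  then obtain p where p: "p \<in> fst b" "p \<in> fst b'" by blast
  then have "p \<in> F" using MPart_subset[OF assms(1)] assms(2) BlD(1) by blast
  then show False using MPart_ex1[OF assms(1), of p] p assms(2-4) by blast
qed

lemma card_MPart_element:
  assumes "Q \<in> MPart F" "finite F"
  shows "card F = K * card Q"
proof -
  have "card (cov Q) = (\<Sum>b\<in>Q. card (fst b))"
    unfolding cov_def
  proof (rule card_UN_disjoint)
    show "finite Q" using MPart_finite[OF assms] .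
    show "\<forall>b\<in>Q. finite (fst b)" using MPart_subset[OF assms(1)] assms(2) by (meson BlD(1) finite_subset subsetD)
    show "\<forall>b\<in>Q. \<forall>b'\<in>Q. b \<noteq> b' \<longrightarrow> fst b \<inter> fst b' = {}" using MPart_disjoint[OF assms(1)] by blast
  qed
  also have "\<dots> = (\<Sum>b\<in>Q. K)"
    using MPart_subset[OF assms(1)] by (intro sum.cong) (auto simp: Bl_def)
  finally show ?thesis using MPart_cov[OF assms(1)] by simp
qed

lemma MPart_empty: "MPart ({} :: 'p set) = {{}}"
proof -
  have "Bl ({} :: 'p set) = {}" using Bl_fst_nonempty BlD(1) by blast
  then show ?thesis by (simp add: MPart_def)
qed

lemma EP_empty [simp]: "EP {} \<phi> = \<phi> {}"
  by (simp add: EP_def MPart_empty avg_def)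

lemma MPart_insert:
  assumes b: "b \<in> Bl F" and Q: "Q \<in> MPart (F - fst b)"
  shows "insert b Q \<in> MPart F" "b \<notin> Q"
proof -
  have bQ: "fst b' \<subseteq> F - fst b" if "b' \<in> Q" for b'
    using that MPart_subset[OF Q] BlD(1) by blast
  show "b \<notin> Q" using bQ Bl_fst_nonempty[OF b] by blast
  have "\<exists>!b'. b' \<in> insert b Q \<and> p \<in> fst b'" if "p \<in> F" for p
  proof (cases "p \<in> fst b")
    case True
    then show ?thesis using bQ by blast
  next
    case False
    then have "\<exists>!b'. b' \<in> Q \<and> p \<in> fst b'" using that Q by (auto simp: MPart_def)
    then show ?thesis using False by blast
  qed
  then show "insert b Q \<in> MPart F"
    using b MPart_subset[OF Q] Bl_mono[of "F - fst b" F] by (auto simp: MPart_def)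
qed

lemma MPart_remove:
  assumes P: "P \<in> MPart F" and b: "b \<in> P"
  shows "P - {b} \<in> MPart (F - fst b)" "b \<in> Bl F"
proof -
  show bB: "b \<in> Bl F" using assms MPart_subset by blast
  have "b' \<in> Bl (F - fst b)" if "b' \<in> P - {b}" for b'
    using that MPart_disjoint[OF P b, of b'] subsetD[OF MPart_subset[OF P], of b'] by (auto simp: Bl_def mem_Times_iff)
  moreover have "\<exists>!b'. b' \<in> P - {b} \<and> p \<in> fst b'" if "p \<in> F - fst b" for p
  proof -
    have "\<exists>!b'. b' \<in> P \<and> p \<in> fst b'" using that P by (auto simp: MPart_def)
    then show ?thesis using that by blast
  qed
  ultimately show "P - {b} \<in> MPart (F - fst b)" by (auto simp: MPart_def)
qed

text \<open>Double counting: a block followed by a partition of the rest is the same as a partition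
  with a distinguished block.\<close>

lemma MPart_pairs_bij:
  "bij_betw (\<lambda>(b, Q). (insert b Q, b)) (SIGMA b:Bl F. MPart (F - fst b)) (SIGMA P:MPart F. P)"
proof (rule bij_betw_byWitness[where f' = "\<lambda>(P, b). (b, P - {b})"])
  show "\<forall>x\<in>SIGMA b:Bl F. MPart (F - fst b).
       (case case x of (b, Q) \<Rightarrow> (insert b Q, b) of (P, b) \<Rightarrow> (b, P - {b})) = x"
    using MPart_insert(2) by fastforce
  show "\<forall>x\<in>SIGMA P:MPart F. P. (case case x of (P, b) \<Rightarrow> (b, P - {b}) of (b, Q) \<Rightarrow> (insert b Q, b)) = x"
    by auto
  show "(\<lambda>(b, Q). (insert b Q, b)) ` (SIGMA b:Bl F. MPart (F - fst b)) \<subseteq> (SIGMA P:MPart F. P)"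
    using MPart_insert by auto
  show "(\<lambda>(P, b). (b, P - {b})) ` (SIGMA P:MPart F. P) \<subseteq> (SIGMA b:Bl F. MPart (F - fst b))"
    using MPart_remove by auto
qed

lemma MPart_double_sum:
  fixes \<phi> :: "('p set \<times> 'm) set \<Rightarrow> real"
  assumes "finite F" "card F = K * n"
  shows "(\<Sum>b\<in>Bl F. \<Sum>Q\<in>MPart (F - fst b). \<phi> (insert b Q)) = real n * (\<Sum>P\<in>MPart F. \<phi> P)"
proof -
  have "(\<Sum>b\<in>Bl F. \<Sum>Q\<in>MPart (F - fst b). \<phi> (insert b Q))
      = (\<Sum>(b, Q)\<in>(SIGMA b:Bl F. MPart (F - fst b)). \<phi> (insert b Q))"
    using assms by (intro sum.Sigma) auto
  also have "\<dots> = (\<Sum>(P, b)\<in>(SIGMA P:MPart F. P). \<phi> P)"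
    using sum.reindex_bij_betw[OF MPart_pairs_bij, of "\<lambda>(P, b). \<phi> P" F] by (simp add: case_prod_unfold)
  also have "\<dots> = (\<Sum>P\<in>MPart F. \<Sum>b\<in>P. \<phi> P)"
    using assms MPart_finite by (intro sum.Sigma[symmetric]) auto
  also have "\<dots> = (\<Sum>P\<in>MPart F. real n * \<phi> P)"
  proof (intro sum.cong refl)
    fix P :: "('p set \<times> 'm) set" assume "P \<in> MPart F"
    then have "card P = n" using card_MPart_element[of P F] assms K_pos by auto
    then show "(\<Sum>b\<in>P. \<phi> P) = real n * \<phi> P" by simp
  qed
  finally show ?thesis by (simp add: sum_distrib_left)
qed

text \<open>Double counting determines the number of partitions recursively from the size of the set
  alone. Only this independence and positivity matter; the value itself never occurs.\<close>

lemma card_MPart_const: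
  "\<exists>z>0. \<forall>F :: 'p set. finite F \<longrightarrow> card F = K * n \<longrightarrow> card (MPart F) = z"
proof (induction n)
  case 0
  have "card (MPart F) = 1" if "finite F" "card F = K * 0" for F :: "'p set"
  proof -
    have "F = {}" using that by simp
    then show ?thesis by (simp only: MPart_empty) simp
  qed
  then show ?case by (intro exI[of _ 1] conjI allI impI) auto
next
  case (Suc n)
  then obtain z where z0: "z > 0" "\<forall>F :: 'p set. finite F \<longrightarrow> card F = K * n \<longrightarrow> card (MPart F) = z"
    by (elim exE conjE)
  note z = z0(1) z0(2)[rule_format]
  define Z where "Z = ((K * Suc n) choose K) * card A * z"
  have key: "Suc n * card (MPart F) = Z" if F: "finite F" "card F = K * Suc n" for F :: "'p set"
  proof -
    have "real (Suc n) * (\<Sum>P\<in>MPart F. 1) = (\<Sum>b\<in>Bl F. \<Sum>Q\<in>MPart (F - fst b). 1)"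
      by (rule MPart_double_sum[OF F, symmetric])
    also have "\<dots> = (\<Sum>b\<in>Bl F. real z)"
    proof (intro sum.cong refl)
      fix b :: "'p set \<times> 'm" assume "b \<in> Bl F"
      then have "card (F - fst b) = K * n" using F by (intro card_Diff_Bl)
      then show "(\<Sum>Q\<in>MPart (F - fst b). 1) = real z" using z(2)[of "F - fst b"] F by simp
    qed
    finally have "real (Suc n * card (MPart F)) = real Z"
      using F by (simp add: card_Bl Z_def algebra_simps)
    then show ?thesis by (simp only: of_nat_eq_iff)
  qed
  have "Z > 0"
  proof -
    have "0 < (K * Suc n) choose K" by (rule zero_less_binomial) simp
    then show ?thesis using z(1) A_nonempty finite_A unfolding Z_def by (simp add: card_gt_0_iff del: mult_Suc_right)
  qed
  have *: "card (MPart F) = Z div Suc n \<and> card (MPart F) > 0"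
    if "finite F" "card F = K * Suc n" for F :: "'p set"
  proof -
    have 1: "Suc n * card (MPart F) = Z" by (rule key[OF that])
    then have "card (MPart F) > 0" using \<open>Z > 0\<close> by (intro gr0I) simp
    moreover have "Z div Suc n = card (MPart F)" unfolding 1[symmetric] by (rule nonzero_mult_div_cancel_left) simp
    ultimately show ?thesis by simp
  qed
  show ?case
  proof (cases "\<exists>F :: 'p set. finite F \<and> card F = K * Suc n")
    case True
    then have "Z div Suc n > 0" using * by fastforce
    then show ?thesis using * by (intro exI[of _ "Z div Suc n"]) simp
  next
    case False
    \<comment> \<open>The point type may be too small to contain such a set; then any positive
      number serves.\<close>
    then show ?thesis by (intro exI[of _ 1]) auto
  qed
qed

lemma MPart_nonempty:
  fixes F :: "'p set"
  assumes "finite F" "card F = K * n"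
  shows "MPart F \<noteq> {}"
proof -
  obtain z where "z > 0" "\<forall>F :: 'p set. finite F \<longrightarrow> card F = K * n \<longrightarrow> card (MPart F) = z"
    using card_MPart_const[of n, where 'p='p] by (elim exE conjE)
  then have "card (MPart F) > 0" using assms by simp
  then show ?thesis by (intro notI) simp
qed

text \<open>A uniform partition can be revealed block by block: every first block has equally many
  completions, so the first block is uniform and the rest is a uniform partition of the remaining
  points.\<close>

lemma EP_rec:
  fixes F :: "'p set"
  assumes F: "finite F" "card F = K * Suc n"
  shows "EP F \<phi> = avg (Bl F) (\<lambda>b. EP (F - fst b) (\<lambda>Q. \<phi> (insert b Q)))"
proof -
  obtain z where z0: "z > 0" "\<forall>F :: 'p set. finite F \<longrightarrow> card F = K * n \<longrightarrow> card (MPart F) = z"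
    using card_MPart_const[of n, where 'p='p] by (elim exE conjE)
  note z = z0(1) z0(2)[rule_format]
  have cz: "card (MPart (F - fst b)) = z" if "b \<in> Bl F" for b
  proof -
    have "card (F - fst b) = K * n" using F that by (intro card_Diff_Bl)
    then show ?thesis using z(2)[of "F - fst b"] F by simp
  qed
  have s1: "(\<Sum>b\<in>Bl F. EP (F - fst b) (\<lambda>Q. \<phi> (insert b Q))) = real (Suc n) * (\<Sum>P\<in>MPart F. \<phi> P) / z"
    unfolding MPart_double_sum[OF F, symmetric] EP_def avg_def sum_divide_distrib by (intro sum.cong refl) (simp add: cz)
  have "real (Suc n) * (\<Sum>P\<in>MPart F. 1) = (\<Sum>b\<in>Bl F. \<Sum>Q\<in>MPart (F - fst b). 1)"
    by (rule MPart_double_sum[OF F, symmetric])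
  then have s2: "real (Suc n) * card (MPart F) = card (Bl F) * z" using cz by simp
  have nz: "card (MPart F) \<noteq> 0" using MPart_nonempty[OF F] F by simp
  have bl: "real (card (Bl F)) \<noteq> 0" using s2 nz by (intro notI) simp
  define X where "X = (\<Sum>P\<in>MPart F. \<phi> P)"
  have "avg (Bl F) (\<lambda>b. EP (F - fst b) (\<lambda>Q. \<phi> (insert b Q))) = real (Suc n) * X / (card (Bl F) * z)"
    unfolding avg_def s1 X_def by (simp add: field_simps)
  also have "\<dots> = real (Suc n) * X / (real (Suc n) * card (MPart F))" using s2 by simp
  also have "\<dots> = X / card (MPart F)" by (rule mult_divide_mult_cancel_left) simp
  finally show ?thesis by (simp add: X_def EP_def avg_def)
qed

lemma EP_mono: "(\<And>Q. Q \<in> MPart F \<Longrightarrow> \<phi> Q \<le> \<psi> Q) \<Longrightarrow> EP F \<phi> \<le> EP F \<psi>"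
  unfolding EP_def by (rule avg_mono)

lemma EP_const: "finite F \<Longrightarrow> card F = K * n \<Longrightarrow> EP F (\<lambda>_. c) = c"
  unfolding EP_def by (rule avg_const[OF finite_MPart MPart_nonempty])

end

section \<open>Lipschitz functions of partitions\<close>

text \<open>\<open>Q\<close> runs over arbitrary finite sets of blocks, overlapping ones included,
  so that partitions of different point sets can be compared through their intersection.\<close>

definition lip :: "real \<Rightarrow> 'b set \<Rightarrow> ('b set \<Rightarrow> real) \<Rightarrow> bool" where
  "lip c X \<phi> \<longleftrightarrow> (\<forall>Q b. finite Q \<longrightarrow> Q \<subseteq> X \<longrightarrow> b \<in> X \<longrightarrow> \<bar>\<phi> (insert b Q) - \<phi> Q\<bar> \<le> c)"

lemma lipD: "lip c X \<phi> \<Longrightarrow> finite Q \<Longrightarrow> Q \<subseteq> X \<Longrightarrow> b \<in> X \<Longrightarrow> \<bar>\<phi> (insert b Q) - \<phi> Q\<bar> \<le> c"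
  by (simp add: lip_def)

lemma lip_subset: "lip c X \<phi> \<Longrightarrow> Y \<subseteq> X \<Longrightarrow> lip c Y \<phi>"
  unfolding lip_def by (meson subset_iff subset_trans)

lemma lip_uminus: "lip c X \<phi> \<Longrightarrow> lip c X (\<lambda>Q. - \<phi> Q)"
  unfolding lip_def by (simp add: abs_minus_commute)

lemma lip_union:
  assumes "lip c X \<phi>" "R \<subseteq> X" "finite R"
  shows "lip c X (\<lambda>Q. \<phi> (R \<union> Q))"
  using assms unfolding lip_def by simp

lemma lip_insert: "lip c X \<phi> \<Longrightarrow> b \<in> X \<Longrightarrow> lip c X (\<lambda>Q. \<phi> (insert b Q))"
  using lip_union[of c X \<phi> "{b}"] by simp

lemma lip_add_set:
  fixes c :: real
  assumes l: "lip c X \<phi>" and Q: "finite Q" "Q \<subseteq> X" and D: "finite D" "D \<subseteq> X"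
  shows "\<bar>\<phi> (D \<union> Q) - \<phi> Q\<bar> \<le> c * card D"
  using D
proof (induction D rule: finite_induct)
  case empty
  then show ?case by simp
next
  case (insert b D)
  have "\<bar>\<phi> (insert b (D \<union> Q)) - \<phi> (D \<union> Q)\<bar> \<le> c"
    using insert Q by (intro lipD[OF l]) auto
  then show ?case using insert by (simp add: algebra_simps)
qed

lemma lip_diff:
  fixes c :: real
  assumes l: "lip c X \<phi>" and Q: "finite Q" "Q \<subseteq> X" and R: "finite R" "R \<subseteq> X"
  shows "\<bar>\<phi> Q - \<phi> R\<bar> \<le> c * card (Q - R) + c * card (R - Q)"
proof -
  have "\<bar>\<phi> ((Q - R) \<union> (Q \<inter> R)) - \<phi> (Q \<inter> R)\<bar> \<le> c * card (Q - R)"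
    using Q R by (intro lip_add_set[OF l]) auto
  moreover have "\<bar>\<phi> ((R - Q) \<union> (Q \<inter> R)) - \<phi> (Q \<inter> R)\<bar> \<le> c * card (R - Q)"
    using Q R by (intro lip_add_set[OF l]) auto
  moreover have "(Q - R) \<union> (Q \<inter> R) = Q" "(R - Q) \<union> (Q \<inter> R) = R" by auto
  ultimately show ?thesis by simp
qed

section \<open>Relabelling and exchanging points; variance\<close>

definition relabel :: "('p \<Rightarrow> 'p) \<Rightarrow> ('p set \<times> 'm) set \<Rightarrow> ('p set \<times> 'm) set" where
  "relabel \<pi> Q = (\<lambda>b. (\<pi> ` fst b, snd b)) ` Q"

lemma relabelI: "b \<in> Q \<Longrightarrow> (\<pi> ` fst b, snd b) \<in> relabel \<pi> Q"
  by (simp add: relabel_def)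

context marked_blocks
begin

lemma relabel_MPart:
  assumes inj: "inj_on \<pi> F" and Q: "Q \<in> MPart F"
  shows "relabel \<pi> Q \<in> MPart (\<pi> ` F)"
proof -
  have sub: "fst b \<subseteq> F" if "b \<in> Q" for b using that MPart_subset[OF Q] BlD(1) by blast
  have "(\<pi> ` fst b, snd b) \<in> Bl (\<pi> ` F)" if "b \<in> Q" for b
    using BlD[OF subsetD[OF MPart_subset[OF Q] that]] inj
    by (auto simp: Bl_def card_image inj_on_subset)
  moreover have "\<exists>!b. b \<in> relabel \<pi> Q \<and> y \<in> fst b" if "y \<in> \<pi> ` F" for y
  proof -
    obtain p where p: "p \<in> F" "y = \<pi> p" using \<open>y \<in> \<pi> ` F\<close> by auto
    have mem: "y \<in> \<pi> ` fst b \<longleftrightarrow> p \<in> fst b" if "b \<in> Q" for b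
      using sub[OF that] p inj by (simp add: inj_on_image_mem_iff)
    obtain b where b: "b \<in> Q" "p \<in> fst b" using MPart_ex1[OF Q p(1)] by blast
    have u: "b' = b" if "b' \<in> Q" "p \<in> fst b'" for b' using MPart_ex1[OF Q p(1)] b that by blast
    show ?thesis
    proof (rule ex1I[of _ "(\<pi> ` fst b, snd b)"])
      show "(\<pi> ` fst b, snd b) \<in> relabel \<pi> Q \<and> y \<in> fst (\<pi> ` fst b, snd b)"
        using b mem by (simp add: relabel_def)
      fix c assume "c \<in> relabel \<pi> Q \<and> y \<in> fst c"
      then obtain b' where "b' \<in> Q" "c = (\<pi> ` fst b', snd b')" "y \<in> \<pi> ` fst b'"
        by (auto simp: relabel_def)
      then show "c = (\<pi> ` fst b, snd b)" using mem u by simp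
    qed
  qed
  ultimately show ?thesis unfolding MPart_def by (auto simp: relabel_def)
qed

lemma EP_relabel:
  fixes F :: "'p set"
  assumes F: "finite F" "card F = K * n" and inj: "inj_on \<pi> F"
  shows "EP (\<pi> ` F) \<phi> = EP F (\<lambda>Q. \<phi> (relabel \<pi> Q))"
proof -
  have "inj_on (\<lambda>b :: 'p set \<times> 'm. (\<pi> ` fst b, snd b)) (Bl F)"
  proof (rule inj_onI)
    fix b b' :: "'p set \<times> 'm" assume b: "b \<in> Bl F" "b' \<in> Bl F" "(\<pi> ` fst b, snd b) = (\<pi> ` fst b', snd b')"
    then have "fst b = fst b'" using inj_on_image_eq_iff[OF inj BlD(1)[OF b(1)] BlD(1)[OF b(2)]] by simp
    then show "b = b'" using b(3) by (simp add: prod_eq_iff)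
  qed
  then have "inj_on (image (\<lambda>b :: 'p set \<times> 'm. (\<pi> ` fst b, snd b))) (Pow (Bl F))"
    by (rule inj_on_image_Pow)
  then have i: "inj_on (relabel \<pi>) (MPart F)"
    unfolding relabel_def[abs_def] by (rule inj_on_subset) (auto simp: MPart_def)
  obtain z where z: "z > 0" "\<forall>F :: 'p set. finite F \<longrightarrow> card F = K * n \<longrightarrow> card (MPart F) = z"
    using card_MPart_const[of n, where 'p='p] by (elim exE conjE)
  have cF: "card (MPart F) = z" "card (MPart (\<pi> ` F)) = z"
    using z(2)[rule_format, of F] z(2)[rule_format, of "\<pi> ` F"] F inj by (simp_all add: card_image)
  have "relabel \<pi> ` MPart F = MPart (\<pi> ` F)"
  proof (rule card_subset_eq)
    show "finite (MPart (\<pi> ` F))" using F by simp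
    show "relabel \<pi> ` MPart F \<subseteq> MPart (\<pi> ` F)" using relabel_MPart[OF inj] by blast
    show "card (relabel \<pi> ` MPart F) = card (MPart (\<pi> ` F))" using i cF by (simp add: card_image)
  qed
  then have "(\<Sum>Q\<in>MPart (\<pi> ` F). \<phi> Q) = (\<Sum>Q\<in>MPart F. \<phi> (relabel \<pi> Q))"
    using sum.reindex[OF i, of \<phi>] by (simp add: o_def)
  then show ?thesis using cF by (simp add: EP_def avg_def)
qed

lemma card_touching_le:
  assumes P: "P \<in> MPart F" and F: "finite F" and D: "D \<subseteq> F"
  shows "card {b \<in> P. fst b \<inter> D \<noteq> {}} \<le> card D"
proof -
  have "{b \<in> P. fst b \<inter> D \<noteq> {}} \<subseteq> (\<lambda>p. THE b. b \<in> P \<and> p \<in> fst b) ` D"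
  proof
    fix b assume "b \<in> {b \<in> P. fst b \<inter> D \<noteq> {}}"
    then obtain p where p: "b \<in> P" "p \<in> fst b" "p \<in> D" by blast
    then have "(THE b. b \<in> P \<and> p \<in> fst b) = b"
      using the1_equality[OF MPart_ex1[OF P, of p]] D by blast
    then show "b \<in> (\<lambda>p. THE b. b \<in> P \<and> p \<in> fst b) ` D" using p(3) by (intro image_eqI[of _ _ p]) simp_all
  qed
  then show ?thesis using finite_subset[OF D F] by (meson surj_card_le)
qed

text \<open>Moving the points of \<open>U - U'\<close> onto \<open>U' - U\<close> turns uniform
  partitions into uniform partitions and leaves every block alone that misses \<open>U - U'\<close>.
  At most \<open>card (U - U')\<close> blocks change, and each change is a deletion and an
  insertion.\<close>

lemma EP_exchange:
  fixes U U' :: "'p set" and c :: real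
  assumes S: "finite S" "U \<subseteq> S" "U' \<subseteq> S" and c: "card U = K * n" "card U' = K * n"
    and l: "lip c (Bl S) \<phi>"
  shows "\<bar>EP U \<phi> - EP U' \<phi>\<bar> \<le> 2 * c * card (U - U')"
proof -
  have fin: "finite U" "finite U'" using S finite_subset by auto
  have "card (U - U') = card (U' - U)" using fin c
    by (metis Int_commute card_Diff_subset_Int finite_Int)
  then obtain f where f: "bij_betw f (U - U') (U' - U)"
    using fin by (meson finite_Diff finite_same_card_bij)
  define \<pi> where "\<pi> x = (if x \<in> U - U' then f x else x)" for x
  have inj: "inj_on \<pi> U"
  proof (rule inj_onI)
    fix x y assume xy: "x \<in> U" "y \<in> U" "\<pi> x = \<pi> y"
    have fU: "f z \<in> U' - U" if "z \<in> U - U'" for z using f that by (auto simp: bij_betw_def)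
    show "x = y"
      using xy fU[of x] fU[of y] inj_onD[OF bij_betw_imp_inj_on[OF f], of x y] unfolding \<pi>_def
      by (auto split: if_splits)
  qed
  have "\<pi> ` U = \<pi> ` (U - U') \<union> \<pi> ` (U \<inter> U')" by blast
  also have "\<pi> ` (U - U') = U' - U" using f by (simp add: \<pi>_def bij_betw_def)
  also have "\<pi> ` (U \<inter> U') = U \<inter> U'" by (auto simp: \<pi>_def)
  finally have img: "\<pi> ` U = U'" by blast
  \<comment> \<open>\<open>lip\<close> forces \<open>c\<close> to be nonnegative only if there is a
    block at all, which is why the empty partition is treated separately below.\<close>
  have c0: "0 \<le> c" if "b \<in> Bl S" for b
    using lipD[OF l, of "{}" b] that by simp
  have "\<bar>\<phi> P - \<phi> (relabel \<pi> P)\<bar> \<le> 2 * c * card (U - U')" if P: "P \<in> MPart U" for P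
  proof (cases "P = {}")
    case True
    then have "U = {}" using MPart_cov[OF P] by simp
    then show ?thesis using True by (simp add: relabel_def)
  next
    case False
    then obtain b where b: "b \<in> P" by blast
    let ?T = "{b \<in> P. fst b \<inter> (U - U') \<noteq> {}}"
    have finP: "finite P" using MPart_finite[OF P fin(1)] .
    have PB: "P \<subseteq> Bl S" using MPart_subset[OF P] Bl_mono[OF S(2)] by blast
    have RB: "relabel \<pi> P \<subseteq> Bl S"
      using MPart_subset[OF relabel_MPart[OF inj P]] Bl_mono[OF S(3)] img by simp
    have cnn: "0 \<le> c" using c0 b PB by blast
    have fix_b: "(\<pi> ` fst b, snd b) = b" if "b \<in> P" "b \<notin> ?T" for b
    proof -
      have "\<pi> x = x" if "x \<in> fst b" for x using that \<open>b \<in> P\<close> \<open>b \<notin> ?T\<close> by (auto simp: \<pi>_def)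
      then have "\<pi> ` fst b = fst b" by simp
      then show ?thesis by simp
    qed
    have s1: "P - relabel \<pi> P \<subseteq> ?T"
    proof
      fix b assume b: "b \<in> P - relabel \<pi> P"
      show "b \<in> ?T"
      proof (rule ccontr)
        assume "b \<notin> ?T"
        then have "(\<pi> ` fst b, snd b) = b" using b by (intro fix_b) simp_all
        then show False using relabelI[of b P \<pi>] b by simp
      qed
    qed
    have s2: "relabel \<pi> P - P \<subseteq> (\<lambda>b. (\<pi> ` fst b, snd b)) ` ?T"
    proof
      fix b' assume b': "b' \<in> relabel \<pi> P - P"
      then obtain b where b: "b \<in> P" "b' = (\<pi> ` fst b, snd b)" by (auto simp: relabel_def)
      have "b \<in> ?T"
      proof (rule ccontr)
        assume "b \<notin> ?T"
        then have "b' = b" using fix_b[OF b(1)] b(2) by simp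
        then show False using b(1) b' by simp
      qed
      then show "b' \<in> (\<lambda>b. (\<pi> ` fst b, snd b)) ` ?T" unfolding b(2) by (rule imageI)
    qed
    have T: "card ?T \<le> card (U - U')" by (rule card_touching_le[OF P fin(1)]) blast
    have "card (P - relabel \<pi> P) \<le> card (U - U')"
      using card_mono[OF _ s1] finP T by simp
    moreover have "card (relabel \<pi> P - P) \<le> card (U - U')"
    proof -
      have "card (relabel \<pi> P - P) \<le> card ((\<lambda>b. (\<pi> ` fst b, snd b)) ` ?T)"
        using finP by (intro card_mono[OF _ s2]) simp
      also have "\<dots> \<le> card ?T" using finP by (intro card_image_le) simp
      finally show ?thesis using T by simp
    qed
    moreover have "\<bar>\<phi> P - \<phi> (relabel \<pi> P)\<bar> \<le> c * card (P - relabel \<pi> P) + c * card (relabel \<pi> P - P)"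
      using finP PB RB by (intro lip_diff[OF l]) (auto simp: relabel_def)
    ultimately show ?thesis
      using cnn mult_left_mono[of "real (card (P - relabel \<pi> P))" "card (U - U')" c]
        mult_left_mono[of "real (card (relabel \<pi> P - P))" "card (U - U')" c] by simp
  qed
  then have "\<bar>EP U \<phi> - EP U (\<lambda>Q. \<phi> (relabel \<pi> Q))\<bar> \<le> 2 * c * card (U - U')"
    unfolding EP_def using fin MPart_nonempty[OF fin(1) c(1)] by (intro avg_abs_diff_le) auto
  then show ?thesis using EP_relabel[OF fin(1) c(1) inj, of \<phi>] img by simp
qed

text \<open>Some first block has a conditional mean no larger than the overall mean; dropping it
  costs at most \<open>c\<close>. This yields one suitable \<open>U\<close>, not a prescribed
  one.\<close>

lemma EP_remove_blocks:
  fixes F :: "'p set" and c :: real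
  assumes "finite S" "lip c (Bl S) \<phi>" "F \<subseteq> S" "card F = K * (n + d)"
  shows "\<exists>U\<subseteq>F. card U = K * n \<and> EP U \<phi> \<le> EP F \<phi> + c * d"
  using assms
proof (induction d arbitrary: F)
  case 0
  then show ?case by (intro exI[of _ F]) auto
next
  case (Suc d)
  have F: "finite F" "card F = K * Suc (n + d)" using Suc.prems finite_subset by auto
  have "Bl F \<noteq> {}" using F by (intro Bl_nonempty) simp_all
  then obtain b where b: "b \<in> Bl F" "EP (F - fst b) (\<lambda>Q. \<phi> (insert b Q)) \<le> EP F \<phi>"
    using avg_exists_le[of "Bl F" "\<lambda>b. EP (F - fst b) (\<lambda>Q. \<phi> (insert b Q))"] F EP_rec[OF F, of \<phi>] by auto
  have cd: "card (F - fst b) = K * (n + d)" using F b by (intro card_Diff_Bl)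
  have bS: "b \<in> Bl S" using b(1) Bl_mono[OF Suc.prems(3)] by blast
  have "\<phi> Q \<le> \<phi> (insert b Q) + c" if "Q \<in> MPart (F - fst b)" for Q
  proof -
    have "Q \<subseteq> Bl S" using MPart_subset[OF that] Bl_mono[of "F - fst b" S] Suc.prems(3) by blast
    then have "\<bar>\<phi> (insert b Q) - \<phi> Q\<bar> \<le> c"
      using F MPart_finite[OF that] bS by (intro lipD[OF Suc.prems(2)]) auto
    then show ?thesis by linarith
  qed
  then have "EP (F - fst b) \<phi> \<le> EP (F - fst b) (\<lambda>Q. \<phi> (insert b Q) + c)" by (rule EP_mono)
  also have "\<dots> = EP (F - fst b) (\<lambda>Q. \<phi> (insert b Q)) + c"
    using F cd EP_const[of "F - fst b" "n + d" c] by (simp add: EP_def avg_add)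
  finally have 1: "EP (F - fst b) \<phi> \<le> EP F \<phi> + c" using b(2) by linarith
  obtain U where U: "U \<subseteq> F - fst b" "card U = K * n" "EP U \<phi> \<le> EP (F - fst b) \<phi> + c * d"
    using Suc.IH[of "F - fst b"] Suc.prems cd by blast
  then show ?case using 1 by (intro exI[of _ U]) (auto simp: algebra_simps)
qed

text \<open>Deleting blocks reaches some \<open>U'\<close> at cost \<open>c * d\<close>; exchanging
  the at most \<open>K * d\<close> points in which \<open>U\<close> differs from it costs
  \<open>2 * c * K * d\<close>. Since K is at least 1, the total is within the factor 3.\<close>

lemma EP_subset_le:
  fixes S :: "'p set" and c :: real
  assumes S: "finite S" "U \<subseteq> S" "card U = K * n" "card S = K * (n + d)" and l: "lip c (Bl S) \<phi>" and c: "0 \<le> c"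
  shows "EP U \<phi> \<le> EP S \<phi> + 3 * c * K * d"
proof -
  obtain U' where U': "U' \<subseteq> S" "card U' = K * n" "EP U' \<phi> \<le> EP S \<phi> + c * d"
    using EP_remove_blocks[OF S(1) l subset_refl S(4)] by blast
  have "card (U - U') \<le> card (S - U')" using S by (intro card_mono) auto
  also have "\<dots> = K * d"
    using U' S finite_subset[OF U'(1) S(1)] by (simp add: card_Diff_subset algebra_simps)
  finally have "real (card (U - U')) \<le> real (K * d)" by (rule of_nat_mono)
  then have "2 * c * card (U - U') \<le> 2 * c * real (K * d)" using c by (intro mult_left_mono) auto
  moreover have "\<bar>EP U \<phi> - EP U' \<phi>\<bar> \<le> 2 * c * card (U - U')"
    using S U' by (intro EP_exchange[OF S(1) _ _ _ _ l]) auto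
  moreover have "d \<le> K * d" using K_pos by simp
  then have "real d \<le> real (K * d)" by (rule of_nat_mono)
  then have "c * d \<le> c * real (K * d)" using c by (intro mult_left_mono) auto
  ultimately show ?thesis using U'(3) by (simp add: algebra_simps)
qed

lemma EP_subset:
  fixes S :: "'p set" and c :: real
  assumes S: "finite S" "U \<subseteq> S" "card U = K * n" "card S = K * (n + d)" and l: "lip c (Bl S) \<phi>" and c: "0 \<le> c"
  shows "\<bar>EP U \<phi> - EP S \<phi>\<bar> \<le> 3 * c * K * d"
proof -
  have "EP F (\<lambda>Q. - \<phi> Q) = - EP F \<phi>" for F :: "'p set"
    using avg_cmult[of "MPart F" "-1" \<phi>] by (simp add: EP_def)
  then show ?thesis
    using EP_subset_le[OF assms] EP_subset_le[OF S lip_uminus[OF l] c] by (simp add: abs_le_iff)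
qed

text \<open>A martingale bound by revealing blocks in turn. Changing the revealed block alters the
  conditional mean by at most \<open>2 * c\<close> for the block itself and \<open>2 * c * K\<close>
  for exchanging the remaining points, so each block adds at most the square of the sum to the
  variance.\<close>

lemma EP_variance:
  fixes F :: "'p set" and c :: real
  assumes "finite F" "card F = K * n" "lip c (Bl F) \<phi>" "0 \<le> c"
  shows "EP F (\<lambda>Q. (\<phi> Q - EP F \<phi>)\<^sup>2) \<le> n * (2 * c * (K + 1))\<^sup>2"
  using assms
proof (induction n arbitrary: F \<phi>)
  case 0
  then show ?case by simp
next
  case (Suc n)
  note F = Suc.prems(1,2) and l = Suc.prems(3) and c = Suc.prems(4)
  define \<mu> where "\<mu> = EP F \<phi>"
  define M where "M b = EP (F - fst b) (\<lambda>Q. \<phi> (insert b Q))" for b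
  define D where "D = 2 * c * (K + 1)"
  have \<mu>: "\<mu> = avg (Bl F) M" unfolding \<mu>_def M_def by (rule EP_rec[OF F])
  have ne: "Bl F \<noteq> {}" using F by (intro Bl_nonempty) simp_all
  have fb: "finite (F - fst b)" "card (F - fst b) = K * n" if "b \<in> Bl F" for b
    using F card_Diff_Bl[OF that F] by auto
  have MM: "\<bar>M b - M b'\<bar> \<le> D" if b: "b \<in> Bl F" "b' \<in> Bl F" for b b'
  proof -
    have "\<bar>\<phi> (insert b Q) - \<phi> (insert b' Q)\<bar> \<le> 2 * c" if Q: "Q \<in> MPart (F - fst b)" for Q
    proof -
      have "finite Q" "Q \<subseteq> Bl F" using Q MPart_finite[OF Q] F MPart_subset[OF Q] Bl_mono[of "F - fst b" F] by auto
      then show ?thesis using lipD[OF l, of Q b] lipD[OF l, of Q b'] b by linarith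
    qed
    then have 1: "\<bar>EP (F - fst b) (\<lambda>Q. \<phi> (insert b Q)) - EP (F - fst b) (\<lambda>Q. \<phi> (insert b' Q))\<bar> \<le> 2 * c"
      unfolding EP_def using fb[OF b(1)] MPart_nonempty[OF fb[OF b(1)]] by (intro avg_abs_diff_le) auto
    have 2: "\<bar>EP (F - fst b) (\<lambda>Q. \<phi> (insert b' Q)) - EP (F - fst b') (\<lambda>Q. \<phi> (insert b' Q))\<bar>
        \<le> 2 * c * card ((F - fst b) - (F - fst b'))"
      using fb b F by (intro EP_exchange[of F _ _ n] lip_insert[OF l]) auto
    have "card ((F - fst b) - (F - fst b')) \<le> card (fst b')"
      using BlD(1)[OF b(2)] F finite_subset by (intro card_mono) auto
    then have "real (card ((F - fst b) - (F - fst b'))) \<le> K" using BlD(2)[OF b(2)] by simp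
    then have "2 * c * card ((F - fst b) - (F - fst b')) \<le> 2 * c * K" using c by (intro mult_left_mono) auto
    then show ?thesis using 1 2 unfolding M_def D_def by (simp add: algebra_simps)
  qed
  have M\<mu>: "(M b - \<mu>)\<^sup>2 \<le> D\<^sup>2" if b: "b \<in> Bl F" for b
  proof -
    have "\<bar>avg (Bl F) (\<lambda>_. M b) - avg (Bl F) M\<bar> \<le> D"
      using F ne MM b by (intro avg_abs_diff_le) auto
    then have "\<bar>M b - \<mu>\<bar> \<le> D" using F ne by (simp add: avg_const \<mu>)
    then show ?thesis by (metis abs_le_square_iff abs_of_nonneg abs_ge_zero order_trans)
  qed
  have step: "EP (F - fst b) (\<lambda>Q. (\<phi> (insert b Q) - \<mu>)\<^sup>2) \<le> n * D\<^sup>2 + D\<^sup>2" if b: "b \<in> Bl F" for b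
  proof -
    let ?E = "EP (F - fst b)"
    have lb: "lip c (Bl (F - fst b)) (\<lambda>Q. \<phi> (insert b Q))"
      using lip_subset[OF lip_insert[OF l b]] Bl_mono[of "F - fst b" F] by blast
    have IH: "?E (\<lambda>Q. (\<phi> (insert b Q) - M b)\<^sup>2) \<le> n * D\<^sup>2"
      using Suc.IH[OF fb[OF b] lb c] unfolding M_def D_def .
    \<comment> \<open>The square is expanded around \<open>M b\<close>. As \<open>M b\<close> is the
      mean of \<open>\<phi> (insert b Q)\<close>, the linear terms cancel after averaging.\<close>
    have "?E (\<lambda>Q. (\<phi> (insert b Q) - \<mu>)\<^sup>2)
       = ?E (\<lambda>Q. (\<phi> (insert b Q) - M b)\<^sup>2 + (2 * (M b - \<mu>) * \<phi> (insert b Q) + ((M b - \<mu>)\<^sup>2 - 2 * (M b - \<mu>) * M b)))"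
      unfolding EP_def by (rule avg_cong) (simp add: power2_eq_square algebra_simps)
    also have "\<dots> = ?E (\<lambda>Q. (\<phi> (insert b Q) - M b)\<^sup>2) + (2 * (M b - \<mu>) * M b + ((M b - \<mu>)\<^sup>2 - 2 * (M b - \<mu>) * M b))"
      using EP_const[OF fb[OF b]] unfolding EP_def avg_add avg_cmult by (simp add: M_def EP_def)
    also have "\<dots> \<le> n * D\<^sup>2 + D\<^sup>2" using IH M\<mu>[OF b] by simp
    finally show ?thesis .
  qed
  have "EP F (\<lambda>Q. (\<phi> Q - \<mu>)\<^sup>2) = avg (Bl F) (\<lambda>b. EP (F - fst b) (\<lambda>Q. (\<phi> (insert b Q) - \<mu>)\<^sup>2))"
    by (rule EP_rec[OF F])
  also have "\<dots> \<le> n * D\<^sup>2 + D\<^sup>2" using F ne step by (intro avg_le) auto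
  finally show ?case unfolding \<mu>_def D_def by (simp add: algebra_simps)
qed

end

section \<open>Global and split steps\<close>

lemma binomial_Suc_step: "real (Suc j) * real (c choose Suc j) = real (c - j) * real (c choose j)"
proof -
  have "Suc j * (c choose Suc j) = (c - j) * (c choose j)"
    by (simp only: binomial_absorption binomial_absorb_comp)
  then show ?thesis by (simp only: of_nat_mult[symmetric])
qed

text \<open>The probability that j points drawn without replacement from n all hit a given subset of
  size c. For j > n it is 0 by division by zero, which matches the mass lost by a step that lacks
  points.\<close>

definition bratio :: "nat \<Rightarrow> nat \<Rightarrow> nat \<Rightarrow> real" where
  "bratio c n j = real (c choose j) / real (n choose j)"

lemma bratio_0 [simp]: "bratio c n 0 = 1"
  by (simp add: bratio_def)

lemma bratio_nonneg: "0 \<le> bratio c n j"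
  by (simp add: bratio_def)

lemma bratio_Suc: "bratio c n (Suc j) = bratio c n j * (real (c - j) / real (n - j))"
proof -
  have "bratio c n (Suc j) = (real (Suc j) * real (c choose Suc j)) / (real (Suc j) * real (n choose Suc j))"
    unfolding bratio_def by (rule mult_divide_mult_cancel_left[symmetric]) simp
  then show ?thesis unfolding binomial_Suc_step by (simp add: bratio_def mult.commute)
qed

lemma bratio_le_power:
  assumes "c \<le> n"
  shows "bratio c n j \<le> (real c / real n) ^ j"
proof (induction j)
  case (Suc j)
  have "real (c - j) / real (n - j) \<le> real c / real n"
  proof (cases "j < c")
    case True
    have "real j * real c \<le> real j * real n" using assms by (intro mult_left_mono) auto
    then have "(real c - real j) * real n \<le> real c * (real n - real j)"
      by (simp add: algebra_simps)
    then show ?thesis using True assms by (simp add: divide_simps of_nat_diff)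
  qed simp
  then show ?case unfolding bratio_Suc power_Suc2 using Suc
    by (intro mult_mono) auto
qed simp

text \<open>The error carries the factor c / n. Summed over disjoint classes these factors total at
  most 1, so the error stays O(1 / n) however many classes there are.\<close>

lemma bratio_ge_power:
  assumes cn: "c \<le> n" and j: "1 \<le> j" "j \<le> n"
  shows "(real c / real n) ^ j - real j ^ 2 * (real c / real n) / real n \<le> bratio c n j"
  using j
proof (induction j rule: nat_induct_at_least)
  case base
  then show ?case by (simp add: bratio_Suc[of c n 0, simplified])
next
  case (Suc j)
  define x where "x = real c / real n"
  have n: "0 < n" using Suc.prems by simp
  have x: "0 \<le> x" "x \<le> 1" using cn n by (auto simp: x_def)
  have jx: "x * x ^ j \<le> x * x" using power_decreasing[of 1 j x] x Suc.hyps by (intro mult_left_mono) auto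
  show ?case
  proof (cases "c < j")
    case True
    \<comment> \<open>The binomial coefficient vanishes here, and \<open>x\<close> is at most j / n,
      so the subtracted error already covers the power.\<close>
    then have "bratio c n (Suc j) = 0" by (simp add: bratio_def)
    moreover have "x \<le> real j / real n" using True by (simp add: x_def divide_right_mono)
    then have "x * x \<le> x * (real j / real n)" using x by (intro mult_left_mono) auto
    moreover have "real j \<le> real (Suc j) ^ 2" by (simp add: power2_eq_square algebra_simps)
    then have "x * (real j / real n) \<le> real (Suc j) ^ 2 * x / real n"
      using x by (simp add: mult.commute divide_right_mono mult_left_mono)
    ultimately show ?thesis using jx unfolding x_def[symmetric] by simp
  next
    case False
    have r: "bratio c n j \<le> x"
      using bratio_le_power[OF cn, of j] power_decreasing[of 1 j x] x Suc.hyps unfolding x_def[symmetric] by simp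
    have "x - real j / real n = (real c - real j) / real n" by (simp add: x_def diff_divide_distrib)
    also have "\<dots> \<le> (real c - real j) / (real n - real j)"
      using False Suc.prems by (intro divide_left_mono) (auto intro!: mult_pos_pos)
    also have "\<dots> = real (c - j) / real (n - j)" using False Suc.prems by (simp add: of_nat_diff)
    finally have s: "x - real j / real n \<le> real (c - j) / real (n - j)" .
    have IH: "x ^ j - real j ^ 2 * x / real n \<le> bratio c n j" using Suc unfolding x_def by simp
    have "x ^ Suc j - real (Suc j) ^ 2 * x / real n \<le> (x ^ j - real j ^ 2 * x / real n) * x - x * (real j / real n)"
    proof -
      have "real j ^ 2 * x * x \<le> real j ^ 2 * x * 1" using x by (intro mult_left_mono) auto
      then have "real j ^ 2 * x * x + x * real j \<le> real (Suc j) ^ 2 * x"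
      proof -
        have "real (Suc j) ^ 2 * x = real j ^ 2 * x + 2 * (x * real j) + x" by (simp add: power2_eq_square algebra_simps)
        moreover have "0 \<le> x * real j" using x by simp
        ultimately show ?thesis using \<open>real j ^ 2 * x * x \<le> real j ^ 2 * x * 1\<close> x(1) by linarith
      qed
      then have "(real j ^ 2 * x * x + x * real j) / real n \<le> real (Suc j) ^ 2 * x / real n"
        by (intro divide_right_mono) auto
      then show ?thesis by (simp add: algebra_simps add_divide_distrib)
    qed
    also have "\<dots> \<le> bratio c n j * x - bratio c n j * (real j / real n)"
      using IH r x by (intro diff_mono mult_right_mono) auto
    also have "\<dots> = bratio c n j * (x - real j / real n)" by (simp add: algebra_simps)
    also have "\<dots> \<le> bratio c n (Suc j)" unfolding bratio_Suc using s bratio_nonneg by (intro mult_left_mono)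
    finally show ?thesis unfolding x_def .
  qed
qed

lemma bratio_le_1: "c \<le> n \<Longrightarrow> bratio c n j \<le> 1"
  using bratio_le_power[of c n j] power_le_one[of "real c / real n" j] by (cases "n = 0") (auto simp: divide_le_eq)

text \<open>Induction on the exponent: the two sides of the step differ by \<open>p * q\<close>
  times \<open>(x - y) * (x ^ k - y ^ k)\<close>, whose factors have the same sign.\<close>

lemma power_convex_2:
  fixes p q x y :: real
  assumes "0 \<le> p" "0 \<le> q" "p + q = 1" "0 \<le> x" "0 \<le> y"
  shows "(p * x + q * y) ^ k \<le> p * x ^ k + q * y ^ k"
proof (induction k)
  case 0
  then show ?case using assms by simp
next
  case (Suc k)
  have "0 \<le> (x - y) * (x ^ k - y ^ k)"
    using assms power_mono[of x y k] power_mono[of y x k]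
    by (cases "x \<le> y") (auto intro: mult_nonneg_nonneg mult_nonpos_nonpos)
  then have 1: "0 \<le> p * q * ((x - y) * (x ^ k - y ^ k))" using assms by simp
  have q: "q = 1 - p" using assms by simp
  have "(p * x + q * y) ^ Suc k \<le> (p * x + q * y) * (p * x ^ k + q * y ^ k)"
    using Suc assms by (simp add: mult_left_mono)
  also have "\<dots> = p * x ^ Suc k + q * y ^ Suc k - p * q * ((x - y) * (x ^ k - y ^ k))"
    by (simp add: q algebra_simps)
  finally show ?case using 1 by linarith
qed

lemma card_split_subsets:
  assumes "finite C" "S1 \<inter> S2 = {}" "C \<subseteq> S1 \<union> S2" "j \<le> k"
  shows "card {e. e \<subseteq> C \<and> card e = k \<and> card (e \<inter> S1) = j} = (card (C \<inter> S1) choose j) * (card (C \<inter> S2) choose (k - j))"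
proof -
  let ?X = "{x. x \<subseteq> C \<inter> S1 \<and> card x = j} \<times> {y. y \<subseteq> C \<inter> S2 \<and> card y = k - j}"
  have "bij_betw (\<lambda>(x, y). x \<union> y) ?X {e. e \<subseteq> C \<and> card e = k \<and> card (e \<inter> S1) = j}"
  proof (rule bij_betw_byWitness[where f' = "\<lambda>e. (e \<inter> S1, e \<inter> S2)"])
    show "\<forall>a\<in>?X. ((case a of (x, y) \<Rightarrow> x \<union> y) \<inter> S1, (case a of (x, y) \<Rightarrow> x \<union> y) \<inter> S2) = a"
      using assms(2) by auto
    show "\<forall>e\<in>{e. e \<subseteq> C \<and> card e = k \<and> card (e \<inter> S1) = j}. (case (e \<inter> S1, e \<inter> S2) of (x, y) \<Rightarrow> x \<union> y) = e"
      using assms(3) by auto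
    show "(\<lambda>(x, y). x \<union> y) ` ?X \<subseteq> {e. e \<subseteq> C \<and> card e = k \<and> card (e \<inter> S1) = j}"
    proof (rule image_subsetI)
      fix xy assume xy: "xy \<in> ?X"
      obtain x y where e: "xy = (x, y)" by (cases xy)
      then have x: "x \<subseteq> C \<inter> S1" "card x = j" and y: "y \<subseteq> C \<inter> S2" "card y = k - j" using xy by auto
      have "finite x" "finite y" "x \<inter> y = {}" using x(1) y(1) assms(1,2) finite_subset[of _ C] by auto
      then have "card (x \<union> y) = k" using x y assms(4) by (simp add: card_Un_disjoint)
      moreover have "(x \<union> y) \<inter> S1 = x" using x(1) y(1) assms(2) by blast
      ultimately show "(case xy of (x, y) \<Rightarrow> x \<union> y) \<in> {e. e \<subseteq> C \<and> card e = k \<and> card (e \<inter> S1) = j}"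
        using x y e by auto
    qed
    show "(\<lambda>e. (e \<inter> S1, e \<inter> S2)) ` {e. e \<subseteq> C \<and> card e = k \<and> card (e \<inter> S1) = j} \<subseteq> ?X"
    proof (rule image_subsetI)
      fix e assume "e \<in> {e. e \<subseteq> C \<and> card e = k \<and> card (e \<inter> S1) = j}"
      then have e: "e \<subseteq> C" "card e = k" "card (e \<inter> S1) = j" by auto
      have "e = (e \<inter> S1) \<union> (e \<inter> S2)" "(e \<inter> S1) \<inter> (e \<inter> S2) = {}" using e assms(2,3) by auto
      moreover have "finite e" using e(1) assms(1) finite_subset by auto
      ultimately have "card e = card (e \<inter> S1) + card (e \<inter> S2)" by (metis card_Un_disjoint finite_Int)
      then show "(e \<inter> S1, e \<inter> S2) \<in> ?X" using e by auto
    qed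
  qed
  then have "card {e. e \<subseteq> C \<and> card e = k \<and> card (e \<inter> S1) = j} = card ?X" by (simp add: bij_betw_same_card)
  also have "\<dots> = (card (C \<inter> S1) choose j) * (card (C \<inter> S2) choose (k - j))"
    unfolding card_cartesian_product using assms(1) n_subsets[of "C \<inter> S1" j] n_subsets[of "C \<inter> S2" "k - j"] by (simp del: Int_subset_iff)
  finally show ?thesis .
qed

lemma sum_split_subsets:
  fixes g :: "nat \<Rightarrow> real"
  assumes "finite C" "S1 \<inter> S2 = {}" "C \<subseteq> S1 \<union> S2"
  shows "(\<Sum>e\<in>{e. e \<subseteq> C \<and> card e = k}. g (card (e \<inter> S1)))
       = (\<Sum>j\<le>k. real (card (C \<inter> S1) choose j) * real (card (C \<inter> S2) choose (k - j)) * g j)"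
proof -
  let ?E = "{e. e \<subseteq> C \<and> card e = k}"
  have fin: "finite ?E" using assms(1) by simp
  have "(\<lambda>e. card (e \<inter> S1)) ` ?E \<subseteq> {..k}"
  proof (rule image_subsetI)
    fix e assume "e \<in> ?E"
    then show "card (e \<inter> S1) \<in> {..k}" using assms(1) finite_subset[of e C] card_mono[of e "e \<inter> S1"] by auto
  qed
  then have "(\<Sum>e\<in>?E. g (card (e \<inter> S1))) = (\<Sum>j\<le>k. \<Sum>e\<in>{e \<in> ?E. card (e \<inter> S1) = j}. g (card (e \<inter> S1)))"
    using fin by (intro sum.group[symmetric]) auto
  also have "\<dots> = (\<Sum>j\<le>k. real (card {e. e \<subseteq> C \<and> card e = k \<and> card (e \<inter> S1) = j}) * g j)"
    by (intro sum.cong refl) (simp add: conj_assoc)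
  also have "\<dots> = (\<Sum>j\<le>k. real (card (C \<inter> S1) choose j) * real (card (C \<inter> S2) choose (k - j)) * g j)"
    by (intro sum.cong refl) (simp add: card_split_subsets[OF assms])
  finally show ?thesis .
qed

section \<open>Random steps as commuting operators\<close>

locale two_sides = marked_blocks K A for K :: nat and A :: "'m set" +
  fixes S1 S2 :: "'p set" and p q :: real
  assumes finite_S: "finite S1" "finite S2" and disjoint_S: "S1 \<inter> S2 = {}"
    and p_pos: "0 < p" and q_pos: "0 < q" and pq: "p + q = 1"
begin

text \<open>With these weights, a step that picks a block e among the free points F with weight cf F e takes each of the K
  points from S1 with probability p and from S2 with probability q, independently (as long as enough
  points are free; otherwise mass is lost). The quotients in cf telescope, which is why the steps commute.\<close>

definition wt :: "'p set \<Rightarrow> real" where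
  "wt F = fact (card (F \<inter> S1)) * fact (card (F \<inter> S2)) / (p ^ card (F \<inter> S1) * q ^ card (F \<inter> S2))"

definition fr :: "('p set \<times> 'm) set \<Rightarrow> 'p set" where
  "fr Q = (S1 \<union> S2) - cov Q"

definition cf :: "'p set \<Rightarrow> 'p set \<Rightarrow> real" where
  "cf F e = fact K * wt (F - e) / wt F"

text \<open>A step is encoded by its action on functions: \<open>opr v f Q\<close> is the mean of
  \<open>f\<close> after one more block with a uniform mark is added to \<open>Q\<close>. Successive
  steps are compositions, so exchanging steps is commutation of operators.\<close>

definition opr :: "('p set \<Rightarrow> real) \<Rightarrow> (('p set \<times> 'm) set \<Rightarrow> real) \<Rightarrow> ('p set \<times> 'm) set \<Rightarrow> real" where
  "opr v f Q = (\<Sum>b\<in>Bl (fr Q). cf (fr Q) (fst b) * v (fst b) * f (insert b Q)) / real (card A)"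

text \<open>This reweighting yields the split step: the whole block lies in S1 with probability p and in S2 with
  probability q.\<close>

definition vS :: "'p set \<Rightarrow> real" where
  "vS e = (if e \<subseteq> S1 then 1 / p ^ (K - 1) else 0) + (if e \<subseteq> S2 then 1 / q ^ (K - 1) else 0)"

abbreviation "Gl \<equiv> opr (\<lambda>_. 1)"
abbreviation "Sp \<equiv> opr vS"

lemma wt_pos: "0 < wt F"
  unfolding wt_def using p_pos q_pos by simp

lemma cf_nonneg: "0 \<le> cf F e"
  unfolding cf_def using wt_pos[of F] wt_pos[of "F - e"] by simp

lemma vS_nonneg: "0 \<le> vS e"
  unfolding vS_def using p_pos q_pos by simp

lemma finite_fr [simp]: "finite (fr Q)"
  using finite_S by (simp add: fr_def)

lemma fr_subset: "fr Q \<subseteq> S1 \<union> S2"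
  by (auto simp: fr_def)

lemma fr_insert: "fr (insert b Q) = fr Q - fst b"
  by (auto simp: fr_def)

lemma cardA_pos: "0 < real (card A)"
  using finite_A A_nonempty by (simp add: card_gt_0_iff)

lemma opr_commute: "opr u (opr v f) Q = opr v (opr u f) Q"
proof -
  let ?F = "fr Q"
  let ?D = "\<lambda>b b'. fst b \<inter> fst b' = {}"
  \<comment> \<open>The inner sum is extended to all blocks in the free points, with disjointness as
    an indicator; then the double sum is symmetric in the two blocks apart from \<open>u\<close> and
    \<open>v\<close>.\<close>
  have *: "opr u (opr v f) Q = (\<Sum>b\<in>Bl ?F. \<Sum>b'\<in>Bl ?F. if ?D b b' then
       (fact K)\<^sup>2 * wt (?F - (fst b \<union> fst b')) / wt ?F * (u (fst b) * v (fst b') * f (insert b (insert b' Q))) else 0) / (real (card A))\<^sup>2"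
    for u v
  proof -
    have in1: "cf ?F (fst b) * u (fst b) * opr v f (insert b Q)
      = (\<Sum>b'\<in>Bl ?F. if ?D b b' then
       (fact K)\<^sup>2 * wt (?F - (fst b \<union> fst b')) / wt ?F * (u (fst b) * v (fst b') * f (insert b (insert b' Q))) else 0) / real (card A)"
      if b: "b \<in> Bl ?F" for b
    proof -
      have "Bl (?F - fst b) = {b' \<in> Bl ?F. ?D b b'}" by (auto simp: Bl_def)
      then have "(\<Sum>b'\<in>Bl (?F - fst b). cf ?F (fst b) * u (fst b) * (cf (?F - fst b) (fst b') * v (fst b') * f (insert b' (insert b Q))))
        = (\<Sum>b'\<in>Bl ?F. if ?D b b' then cf ?F (fst b) * u (fst b) * (cf (?F - fst b) (fst b') * v (fst b') * f (insert b' (insert b Q))) else 0)"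
        by (simp add: sum.inter_filter)
      also have "\<dots> = (\<Sum>b'\<in>Bl ?F. if ?D b b' then
       (fact K)\<^sup>2 * wt (?F - (fst b \<union> fst b')) / wt ?F * (u (fst b) * v (fst b') * f (insert b (insert b' Q))) else 0)"
      proof (intro sum.cong refl if_cong)
        fix b' :: "'p set \<times> 'm"
        have "cf ?F (fst b) * cf (?F - fst b) (fst b') = (fact K)\<^sup>2 * wt (?F - (fst b \<union> fst b')) / wt ?F"
          unfolding cf_def using wt_pos[of "?F - fst b"]
          by (simp add: Diff_Un set_diff_eq power2_eq_square Un_def conj_ac)
        then show "cf ?F (fst b) * u (fst b) * (cf (?F - fst b) (fst b') * v (fst b') * f (insert b' (insert b Q)))
          = (fact K)\<^sup>2 * wt (?F - (fst b \<union> fst b')) / wt ?F * (u (fst b) * v (fst b') * f (insert b (insert b' Q)))"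
          by (simp add: insert_commute[of b b'] mult_ac)
      qed
      finally show ?thesis
        unfolding opr_def[of v f "insert b Q"] fr_insert by (simp add: sum_distrib_left)
    qed
    have "opr u (opr v f) Q = (\<Sum>b\<in>Bl ?F. cf ?F (fst b) * u (fst b) * opr v f (insert b Q)) / real (card A)"
      by (simp add: opr_def)
    also have "\<dots> = (\<Sum>b\<in>Bl ?F. (\<Sum>b'\<in>Bl ?F. if ?D b b' then
       (fact K)\<^sup>2 * wt (?F - (fst b \<union> fst b')) / wt ?F * (u (fst b) * v (fst b') * f (insert b (insert b' Q))) else 0) / real (card A)) / real (card A)"
      using in1 by (simp cong: sum.cong)
    finally show ?thesis by (simp add: sum_divide_distrib[symmetric] power2_eq_square)
  qed
  show ?thesis
    unfolding * by (subst sum.swap) (intro arg_cong2[where f="(/)"] sum.cong refl if_cong, auto simp: Int_commute Un_commute insert_commute mult_ac)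
qed

text \<open>Cancelling factorials exhibits the global step: a binomial number j of points falls to
  the first side, then j points there and K - j on the other side are uniform.\<close>

lemma cf_split:
  assumes F: "F \<subseteq> S1 \<union> S2" and e: "e \<subseteq> F" "card e = K"
  defines "j \<equiv> card (e \<inter> S1)"
  shows "cf F e = real (K choose j) * p ^ j * q ^ (K - j)
    / (real (card (F \<inter> S1) choose j) * real (card (F \<inter> S2) choose (K - j)))" and "card (e \<inter> S2) = K - j" and "j \<le> K"
proof -
  define n1 n2 k where "n1 = card (F \<inter> S1)" and "n2 = card (F \<inter> S2)" and "k = card (e \<inter> S2)"
  have fin: "finite F" "finite e" using F e finite_S finite_subset[of F "S1 \<union> S2"] finite_subset[of e F] by auto
  have "e = (e \<inter> S1) \<union> (e \<inter> S2)" "(e \<inter> S1) \<inter> (e \<inter> S2) = {}" using e F disjoint_S by auto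
  then have K: "K = j + k" unfolding j_def k_def using e(2) fin by (metis card_Un_disjoint finite_Int)
  then show "card (e \<inter> S2) = K - j" "j \<le> K" by (simp_all add: k_def)
  have le: "j \<le> n1" "k \<le> n2" unfolding j_def k_def n1_def n2_def using e fin by (auto intro!: card_mono)
  have "(F - e) \<inter> S1 = (F \<inter> S1) - (e \<inter> S1)" "(F - e) \<inter> S2 = (F \<inter> S2) - (e \<inter> S2)" by auto
  then have c: "card ((F - e) \<inter> S1) = n1 - j" "card ((F - e) \<inter> S2) = n2 - k"
    unfolding n1_def n2_def j_def k_def using e fin by (auto intro!: card_Diff_subset)
  have pw: "p ^ n1 = p ^ j * p ^ (n1 - j)" "q ^ n2 = q ^ k * q ^ (n2 - k)"
    using le by (simp_all add: power_add[symmetric])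
  have Kj: "K - j = k" "j \<le> K" using K by auto
  show "cf F e = real (K choose j) * p ^ j * q ^ (K - j) / (real (n1 choose j) * real (n2 choose (K - j)))"
    unfolding cf_def wt_def c n1_def[symmetric] n2_def[symmetric] pw Kj(1)
      binomial_fact[OF Kj(2)] binomial_fact[OF le(1)] binomial_fact[OF le(2)]
    using p_pos q_pos by (simp add: field_simps)
qed

text \<open>With \<open>g\<close> constantly 1 this is the probability that a global step lands
  inside \<open>C\<close>: for \<open>C = F\<close> the total mass, for a class \<open>C\<close> the
  probability that the block lies in this class.\<close>

lemma cf_sum:
  assumes F: "F \<subseteq> S1 \<union> S2" and C: "C \<subseteq> F"
  shows "(\<Sum>e\<in>{e. e \<subseteq> C \<and> card e = K}. cf F e * g (card (e \<inter> S1)))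
    = (\<Sum>j\<le>K. real (K choose j) * p ^ j * q ^ (K - j) * bratio (card (C \<inter> S1)) (card (F \<inter> S1)) j
         * bratio (card (C \<inter> S2)) (card (F \<inter> S2)) (K - j) * g j)"
proof -
  have fin: "finite C" using F C finite_S finite_subset[of C "S1 \<union> S2"] by auto
  have "(\<Sum>e\<in>{e. e \<subseteq> C \<and> card e = K}. cf F e * g (card (e \<inter> S1)))
    = (\<Sum>e\<in>{e. e \<subseteq> C \<and> card e = K}. (\<lambda>j. real (K choose j) * p ^ j * q ^ (K - j)
    / (real (card (F \<inter> S1) choose j) * real (card (F \<inter> S2) choose (K - j))) * g j) (card (e \<inter> S1)))"
  proof (intro sum.cong refl)
    fix e assume "e \<in> {e. e \<subseteq> C \<and> card e = K}"
    then have "e \<subseteq> F" "card e = K" using C by auto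
    from cf_split(1)[OF F this] show "cf F e * g (card (e \<inter> S1)) = (\<lambda>j. real (K choose j) * p ^ j * q ^ (K - j)
    / (real (card (F \<inter> S1) choose j) * real (card (F \<inter> S2) choose (K - j))) * g j) (card (e \<inter> S1))" by simp
  qed
  also have "\<dots> = (\<Sum>j\<le>K. real (K choose j) * p ^ j * q ^ (K - j) * bratio (card (C \<inter> S1)) (card (F \<inter> S1)) j
         * bratio (card (C \<inter> S2)) (card (F \<inter> S2)) (K - j) * g j)"
    using F C by (subst sum_split_subsets[OF fin disjoint_S]) (auto simp: bratio_def intro!: sum.cong)
  finally show ?thesis .
qed

lemma card_Int_le: "F \<subseteq> S1 \<union> S2 \<Longrightarrow> C \<subseteq> F \<Longrightarrow> card (C \<inter> S1) \<le> card (F \<inter> S1) \<and> card (C \<inter> S2) \<le> card (F \<inter> S2)"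
  using finite_S finite_subset[of F "S1 \<union> S2"] by (auto intro!: card_mono)

text \<open>Drawing with replacement only makes it likelier to hit \<open>C\<close> throughout; the
  binomial theorem then sums over the number of points on the first side.\<close>

lemma Gl_clique_le:
  assumes F: "F \<subseteq> S1 \<union> S2" and C: "C \<subseteq> F"
  shows "(\<Sum>e\<in>{e. e \<subseteq> C \<and> card e = K}. cf F e)
    \<le> (p * (real (card (C \<inter> S1)) / real (card (F \<inter> S1))) + q * (real (card (C \<inter> S2)) / real (card (F \<inter> S2)))) ^ K"
    (is "_ \<le> (p * ?x + q * ?y) ^ K")
proof -
  have "(\<Sum>e\<in>{e. e \<subseteq> C \<and> card e = K}. cf F e) = (\<Sum>j\<le>K. real (K choose j) * p ^ j * q ^ (K - j) * bratio (card (C \<inter> S1)) (card (F \<inter> S1)) j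
         * bratio (card (C \<inter> S2)) (card (F \<inter> S2)) (K - j))"
    using cf_sum[OF assms, of "\<lambda>_. 1"] by simp
  also have "\<dots> \<le> (\<Sum>j\<le>K. real (K choose j) * p ^ j * q ^ (K - j) * ?x ^ j * ?y ^ (K - j))"
    using card_Int_le[OF assms] p_pos q_pos
    by (intro sum_mono mult_mono bratio_le_power mult_nonneg_nonneg) (auto simp: bratio_nonneg)
  also have "\<dots> = (p * ?x + q * ?y) ^ K"
    unfolding binomial_ring by (intro sum.cong refl) (simp only: power_mult_distrib mult_ac)
  finally show ?thesis .
qed

lemma vS_card:
  assumes "e \<subseteq> S1 \<union> S2" "card e = K"
  shows "vS e = (if card (e \<inter> S1) = K then 1 / p ^ (K - 1) else 0) + (if card (e \<inter> S1) = 0 then 1 / q ^ (K - 1) else 0)"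
proof -
  have fin: "finite e" using assms(2) K_pos by (metis card.infinite not_one_le_zero)
  have "e \<subseteq> S1 \<longleftrightarrow> card (e \<inter> S1) = K"
    using fin assms(2) by (metis Int_absorb2 Int_lower1 card_subset_eq inf.orderI)
  moreover have "e \<subseteq> S2 \<longleftrightarrow> card (e \<inter> S1) = 0" using fin assms(1) disjoint_S by auto
  ultimately show ?thesis by (simp add: vS_def)
qed

lemma Sp_sum:
  assumes F: "F \<subseteq> S1 \<union> S2" and C: "C \<subseteq> F"
  shows "(\<Sum>e\<in>{e. e \<subseteq> C \<and> card e = K}. cf F e * vS e * g (card (e \<inter> S1)))
    = p * bratio (card (C \<inter> S1)) (card (F \<inter> S1)) K * g K + q * bratio (card (C \<inter> S2)) (card (F \<inter> S2)) K * g 0"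
proof -
  let ?c = "\<lambda>j. real (K choose j) * p ^ j * q ^ (K - j) * bratio (card (C \<inter> S1)) (card (F \<inter> S1)) j
         * bratio (card (C \<inter> S2)) (card (F \<inter> S2)) (K - j)"
  let ?v = "\<lambda>j. (if j = K then 1 / p ^ (K - 1) else 0) + (if j = 0 then 1 / q ^ (K - 1) else (0::real))"
  have pK: "p ^ K = p * p ^ (K - 1)" "q ^ K = q * q ^ (K - 1)"
    using K_pos by (simp_all add: power_eq_if)
  have "(\<Sum>e\<in>{e. e \<subseteq> C \<and> card e = K}. cf F e * vS e * g (card (e \<inter> S1)))
    = (\<Sum>e\<in>{e. e \<subseteq> C \<and> card e = K}. cf F e * (\<lambda>j. ?v j * g j) (card (e \<inter> S1)))"
  proof (intro sum.cong refl)
    fix e assume "e \<in> {e. e \<subseteq> C \<and> card e = K}"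
    then have "e \<subseteq> S1 \<union> S2" "card e = K" using F C by auto
    then show "cf F e * vS e * g (card (e \<inter> S1)) = cf F e * (?v (card (e \<inter> S1)) * g (card (e \<inter> S1)))"
      by (simp only: vS_card mult.assoc)
  qed
  also have "\<dots> = (\<Sum>j\<le>K. ?c j * (?v j * g j))" by (rule cf_sum[OF assms])
  also have "\<dots> = (\<Sum>j\<le>K. (if j = K then ?c j * g j / p ^ (K - 1) else 0) + (if j = 0 then ?c j * g j / q ^ (K - 1) else 0))"
    by (intro sum.cong refl) (auto simp: algebra_simps)
  also have "\<dots> = ?c K * g K / p ^ (K - 1) + ?c 0 * g 0 / q ^ (K - 1)"
    by (simp add: sum.distrib)
  also have "\<dots> = p * bratio (card (C \<inter> S1)) (card (F \<inter> S1)) K * g K + q * bratio (card (C \<inter> S2)) (card (F \<inter> S2)) K * g 0"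
    using p_pos q_pos by (simp add: pK)
  finally show ?thesis .
qed

section \<open>Convexity: the two steps compared on cliques\<close>

definition clique :: "('p \<Rightarrow> 'p \<Rightarrow> bool) \<Rightarrow> 'p set \<Rightarrow> bool" where
  "clique R e \<longleftrightarrow> (\<forall>x\<in>e. \<forall>y\<in>e. R x y)"

text \<open>The cliques are the subsets of the classes of R, which are disjoint; points unrelated to
  themselves lie in none. If a class has densities x and y on the two sides, convexity bounds (p x +
  q y)^K by p x^K + q y^K, and returning to draws without replacement costs K^2 / m times p x + q y.
  The densities of all classes sum to at most 1 on each side.\<close>

lemma Gl_Sp_clique:
  assumes F: "F \<subseteq> S1 \<union> S2" and m: "m \<le> card (F \<inter> S1)" "m \<le> card (F \<inter> S2)" "K \<le> m"
    and R: "symp R" "transp R"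
  shows "(\<Sum>e\<in>{e. e \<subseteq> F \<and> card e = K}. (cf F e - cf F e * vS e) * of_bool (clique R e)) \<le> K ^ 2 / m"
proof -
  define CC where "CC = (\<lambda>x. {y \<in> F. R x y}) ` {x \<in> F. R x x}"
  have fin: "finite F" using F finite_S finite_subset[of F "S1 \<union> S2"] by auto
  have finCC: "finite CC" using fin by (simp add: CC_def)
  have sub: "C \<subseteq> F" if "C \<in> CC" for C using that by (auto simp: CC_def)
  have disj: "C \<inter> C' = {}" if inCC: "C \<in> CC" "C' \<in> CC" "C \<noteq> C'" for C C'
  proof (rule ccontr)
    assume "C \<inter> C' \<noteq> {}"
    then obtain z where z: "z \<in> C" "z \<in> C'" by blast
    obtain x where x1: "C = {y \<in> F. R x y}" using inCC(1) unfolding CC_def by blast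
    obtain x' where x2: "C' = {y \<in> F. R x' y}" using inCC(2) unfolding CC_def by blast
    note x = x1 x2
    have "R x z" "R x' z" using z x by auto
    then have "R x x'" "R x' x" using R unfolding symp_def transp_def by blast+
    then have "C = C'" using R unfolding x transp_def by blast
    then show False using inCC by simp
  qed
  let ?K = "\<lambda>C. {e. e \<subseteq> C \<and> card e = K}"
  have un: "{e \<in> ?K F. clique R e} = (\<Union>C\<in>CC. ?K C)"
  proof (intro set_eqI iffI)
    fix e assume e: "e \<in> {e \<in> ?K F. clique R e}"
    then have "e \<noteq> {}" using K_pos by auto
    then obtain x where x: "x \<in> e" by blast
    then have "x \<in> F" "R x x" "e \<subseteq> {y \<in> F. R x y}" using e by (auto simp: clique_def)
    then show "e \<in> (\<Union>C\<in>CC. ?K C)" using e by (auto simp: CC_def)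
  next
    fix e assume "e \<in> (\<Union>C\<in>CC. ?K C)"
    then obtain x where x: "x \<in> F" "R x x" "e \<subseteq> {y \<in> F. R x y}" "card e = K" by (auto simp: CC_def)
    then have "clique R e" using R unfolding clique_def symp_def transp_def by blast
    then show "e \<in> {e \<in> ?K F. clique R e}" using x by auto
  qed
  have sumC: "(\<Sum>e\<in>?K F. f e * of_bool (clique R e)) = (\<Sum>C\<in>CC. \<Sum>e\<in>?K C. f e)" for f :: "'p set \<Rightarrow> real"
  proof -
    have "(\<Sum>e\<in>?K F. f e * of_bool (clique R e)) = (\<Sum>e\<in>?K F. if clique R e then f e else 0)"
      by (intro sum.cong refl) simp
    also have "\<dots> = (\<Sum>e\<in>{e \<in> ?K F. clique R e}. f e)"
      using fin by (intro sum.inter_filter[symmetric]) simp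
    also have "\<dots> = (\<Sum>C\<in>CC. \<Sum>e\<in>?K C. f e)"
      unfolding un
    proof (rule sum.UNION_disjoint)
      show "\<forall>C\<in>CC. finite (?K C)" using finite_subset[OF sub fin] by simp
      show "\<forall>C\<in>CC. \<forall>C'\<in>CC. C \<noteq> C' \<longrightarrow> ?K C \<inter> ?K C' = {}"
      proof (intro ballI impI equals0I)
        fix C C' e assume "C \<in> CC" "C' \<in> CC" "C \<noteq> C'" "e \<in> ?K C \<inter> ?K C'"
        then have "e \<subseteq> {}" "card e = K" using disj[of C C'] by auto
        then show False using K_pos by auto
      qed
    qed (rule finCC)
    finally show ?thesis .
  qed
  define n1 n2 where "n1 = card (F \<inter> S1)" and "n2 = card (F \<inter> S2)"
  define x y where "x C = real (card (C \<inter> S1)) / real n1" and "y C = real (card (C \<inter> S2)) / real n2" for C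
  have npos: "0 < n1" "0 < n2" "0 < m" using m K_pos by (auto simp: n1_def n2_def)
  have xy: "0 \<le> x C" "0 \<le> y C" for C by (simp_all add: x_def y_def)
  have total: "(\<Sum>C\<in>CC. real (card (C \<inter> X))) \<le> real (card (F \<inter> X))" for X
  proof -
    have "(\<Sum>C\<in>CC. card (C \<inter> X)) = card (\<Union>C\<in>CC. C \<inter> X)"
      using finCC fin finite_subset[OF sub fin] disj by (intro card_UN_disjoint[symmetric]) blast+
    also have "\<dots> \<le> card (F \<inter> X)" using sub fin by (intro card_mono) auto
    finally show ?thesis by (simp only: of_nat_sum[symmetric] of_nat_le_iff)
  qed
  have sx: "(\<Sum>C\<in>CC. x C) \<le> 1" and sy: "(\<Sum>C\<in>CC. y C) \<le> 1"
    using total[of S1] total[of S2] npos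
    by (simp_all add: x_def y_def sum_divide_distrib[symmetric] n1_def n2_def)
  have one: "(\<Sum>e\<in>?K C. cf F e) - (\<Sum>e\<in>?K C. cf F e * vS e) \<le> (real K)\<^sup>2 / m * (p * x C + q * y C)" if C: "C \<in> CC" for C
  proof -
    note cl = card_Int_le[OF F sub[OF C]]
    have b1: "x C ^ K - (real K)\<^sup>2 * x C / n1 \<le> bratio (card (C \<inter> S1)) n1 K"
      unfolding x_def n1_def using cl m K_pos by (intro bratio_ge_power) auto
    have b2: "y C ^ K - (real K)\<^sup>2 * y C / n2 \<le> bratio (card (C \<inter> S2)) n2 K"
      unfolding y_def n2_def using cl m K_pos by (intro bratio_ge_power) auto
    have d1: "(real K)\<^sup>2 * x C / n1 \<le> (real K)\<^sup>2 * x C / m" and d2: "(real K)\<^sup>2 * y C / n2 \<le> (real K)\<^sup>2 * y C / m"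
      using xy m npos by (auto intro!: divide_left_mono simp: n1_def n2_def)
    have "(\<Sum>e\<in>?K C. cf F e) \<le> (p * x C + q * y C) ^ K"
      using Gl_clique_le[OF F sub[OF C]] unfolding x_def y_def n1_def n2_def .
    also have "\<dots> \<le> p * x C ^ K + q * y C ^ K"
      using p_pos q_pos pq xy by (intro power_convex_2) auto
    also have "\<dots> \<le> p * (bratio (card (C \<inter> S1)) n1 K + (real K)\<^sup>2 * x C / m) + q * (bratio (card (C \<inter> S2)) n2 K + (real K)\<^sup>2 * y C / m)"
      using b1 b2 d1 d2 p_pos q_pos by (intro add_mono mult_left_mono) auto
    also have "\<dots> = (\<Sum>e\<in>?K C. cf F e * vS e) + (real K)\<^sup>2 / m * (p * x C + q * y C)"
      using Sp_sum[OF F sub[OF C], of "\<lambda>_. 1"] by (simp add: n1_def n2_def algebra_simps add_divide_distrib)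
    finally show ?thesis by simp
  qed
  have "(\<Sum>e\<in>?K F. (cf F e - cf F e * vS e) * of_bool (clique R e))
     = (\<Sum>C\<in>CC. (\<Sum>e\<in>?K C. cf F e) - (\<Sum>e\<in>?K C. cf F e * vS e))"
    by (simp add: sumC sum_subtractf)
  also have "\<dots> \<le> (\<Sum>C\<in>CC. (real K)\<^sup>2 / m * (p * x C + q * y C))" using one by (intro sum_mono)
  also have "\<dots> = (real K)\<^sup>2 / m * (p * (\<Sum>C\<in>CC. x C) + q * (\<Sum>C\<in>CC. y C))"
    by (simp only: sum_distrib_left[symmetric] sum.distrib)
  also have "\<dots> \<le> (real K)\<^sup>2 / m * (p * 1 + q * 1)"
    using sx sy p_pos q_pos by (intro mult_left_mono add_mono) auto
  finally show ?thesis using pq by simp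
qed

lemma opr_linear: "opr v (\<lambda>Q. a * f Q + c * g Q) Q = a * opr v f Q + c * opr v g Q"
proof -
  have "(\<Sum>b\<in>Bl (fr Q). cf (fr Q) (fst b) * v (fst b) * (a * f (insert b Q) + c * g (insert b Q)))
    = a * (\<Sum>b\<in>Bl (fr Q). cf (fr Q) (fst b) * v (fst b) * f (insert b Q))
      + c * (\<Sum>b\<in>Bl (fr Q). cf (fr Q) (fst b) * v (fst b) * g (insert b Q))"
    by (simp add: sum_distrib_left sum.distrib[symmetric] algebra_simps)
  then show ?thesis by (simp add: opr_def add_divide_distrib)
qed

text \<open>The count of free points encodes disjointness: n blocks of size K cover K n points only
  if they are pairwise disjoint.\<close>

definition valid :: "nat \<Rightarrow> ('p set \<times> 'm) set \<Rightarrow> bool" where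
  "valid n Q \<longleftrightarrow> finite Q \<and> card Q = n \<and> Q \<subseteq> Bl (S1 \<union> S2) \<and> card (fr Q) + K * n = card (S1 \<union> S2)"

lemma valid_empty: "valid 0 {}"
  by (simp add: valid_def fr_def)

lemma valid_insert:
  assumes Q: "valid n Q" and b: "b \<in> Bl (fr Q)"
  shows "valid (Suc n) (insert b Q)" "b \<notin> Q"
proof -
  have sub: "fst b \<subseteq> fr Q" "card (fst b) = K" using BlD[OF b] by auto
  show bQ: "b \<notin> Q"
  proof
    assume "b \<in> Q"
    then have "fst b \<subseteq> cov Q" by (auto simp: cov_def)
    then have "fst b = {}" using sub by (auto simp: fr_def)
    then show False using Bl_fst_nonempty[OF b] by simp
  qed
  have "card (fr Q - fst b) + K = card (fr Q)"
    using sub card_Diff_subset[of "fst b" "fr Q"] card_mono[OF finite_fr sub(1)] finite_subset[OF sub(1)] by simp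
  then show "valid (Suc n) (insert b Q)"
    using Q bQ subsetD[OF Bl_mono[OF fr_subset] b] by (auto simp: valid_def fr_insert)
qed

lemma opr_mono:
  assumes v: "\<And>e. 0 \<le> v e" and Q: "valid n Q" and fg: "\<And>Q'. valid (Suc n) Q' \<Longrightarrow> f Q' \<le> g Q'"
  shows "opr v f Q \<le> opr v g Q"
  unfolding opr_def using v cf_nonneg fg valid_insert[OF Q]
  by (intro divide_right_mono sum_mono mult_left_mono mult_nonneg_nonneg) auto

lemma opr_pow_mono:
  assumes v: "\<And>e. 0 \<le> v e"
  shows "valid n Q \<Longrightarrow> (\<And>Q'. valid (n + j) Q' \<Longrightarrow> f Q' \<le> g Q') \<Longrightarrow> (opr v ^^ j) f Q \<le> (opr v ^^ j) g Q"
proof (induction j arbitrary: n Q)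
  case (Suc j)
  show ?case unfolding funpow.simps o_apply
  proof (rule opr_mono[OF v Suc.prems(1)])
    fix Q' assume "valid (Suc n) Q'"
    then show "(opr v ^^ j) f Q' \<le> (opr v ^^ j) g Q'" using Suc.prems(2) by (intro Suc.IH) auto
  qed
qed simp

lemma opr_pow_linear: "(opr v ^^ j) (\<lambda>Q. a * f Q + c * g Q) Q = a * (opr v ^^ j) f Q + c * (opr v ^^ j) g Q"
proof (induction j arbitrary: Q)
  case (Suc j)
  have "(opr v ^^ j) (\<lambda>Q. a * f Q + c * g Q) = (\<lambda>Q. a * (opr v ^^ j) f Q + c * (opr v ^^ j) g Q)"
    using Suc by blast
  then show ?case by (simp add: opr_linear)
qed simp

lemma opr_pow_commute: "(opr u ^^ j) (opr v f) = opr v ((opr u ^^ j) f)"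
proof (induction j)
  case (Suc j)
  have "opr u (opr v ((opr u ^^ j) f)) = opr v (opr u ((opr u ^^ j) f))" by (rule ext) (rule opr_commute)
  then show ?case using Suc by simp
qed simp

section \<open>Chernoff bound for the numbers of free points\<close>

definition ZZ :: "real \<Rightarrow> real \<Rightarrow> ('p set \<times> 'm) set \<Rightarrow> real" where
  "ZZ x y Q = 1 / (x ^ card (fr Q \<inter> S1) * y ^ card (fr Q \<inter> S2))"

text \<open>Up to a constant factor, \<open>ZZ\<close> is the generating function of the numbers of
  used points on the two sides, and \<open>bb\<close> bounds its growth under a split step. A global
  step would give (p x + q y)^K, which is no larger by convexity, so one bound serves both kinds of
  step.\<close>

definition bb :: "real \<Rightarrow> real \<Rightarrow> real" where
  "bb x y = p * x ^ K + q * y ^ K"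

lemma bb_ge_1: "1 \<le> x \<Longrightarrow> 1 \<le> y \<Longrightarrow> 1 \<le> bb x y"
proof -
  assume "1 \<le> x" "1 \<le> y"
  then have "p * 1 + q * 1 \<le> p * x ^ K + q * y ^ K"
    using p_pos q_pos by (intro add_mono mult_left_mono one_le_power) auto
  then show ?thesis using pq by (simp add: bb_def)
qed

lemma ZZ_nonneg: "1 \<le> x \<Longrightarrow> 1 \<le> y \<Longrightarrow> 0 \<le> ZZ x y Q"
  by (simp add: ZZ_def)

lemma opr_sum_A:
  assumes "\<And>b. b \<in> Bl (fr Q) \<Longrightarrow> f (insert b Q) = h (fst b)"
  shows "opr v f Q = (\<Sum>e\<in>{e. e \<subseteq> fr Q \<and> card e = K}. cf (fr Q) e * v e * h e)"
proof -
  have "(\<Sum>b\<in>Bl (fr Q). cf (fr Q) (fst b) * v (fst b) * f (insert b Q))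
    = (\<Sum>b\<in>Bl (fr Q). cf (fr Q) (fst b) * v (fst b) * h (fst b))"
    using assms by (intro sum.cong) auto
  also have "\<dots> = (\<Sum>e\<in>{e. e \<subseteq> fr Q \<and> card e = K}. \<Sum>a\<in>A. cf (fr Q) e * v e * h e)"
    unfolding Bl_def by (simp only: sum.cartesian_product case_prod_unfold)
  also have "\<dots> = real (card A) * (\<Sum>e\<in>{e. e \<subseteq> fr Q \<and> card e = K}. cf (fr Q) e * v e * h e)"
    by (simp add: sum_distrib_left)
  finally show ?thesis using cardA_pos by (simp add: opr_def)
qed

lemma ZZ_insert:
  assumes x: "1 \<le> x" "1 \<le> y" and b: "b \<in> Bl (fr Q)"
  shows "ZZ x y (insert b Q) = ZZ x y Q * (x ^ card (fst b \<inter> S1) * y ^ (K - card (fst b \<inter> S1)))"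
proof -
  have e: "fst b \<subseteq> fr Q" "card (fst b) = K" using BlD[OF b] by auto
  have fe: "finite (fst b)" using e(1) finite_subset finite_fr by blast
  have s: "(fr Q - fst b) \<inter> S1 = fr Q \<inter> S1 - fst b \<inter> S1" "(fr Q - fst b) \<inter> S2 = fr Q \<inter> S2 - fst b \<inter> S2" by auto
  have c1: "card ((fr Q - fst b) \<inter> S1) + card (fst b \<inter> S1) = card (fr Q \<inter> S1)"
    unfolding s using e fe by (subst card_Diff_subset) (auto intro!: le_add_diff_inverse2 card_mono)
  have c2: "card ((fr Q - fst b) \<inter> S2) + card (fst b \<inter> S2) = card (fr Q \<inter> S2)"
    unfolding s using e fe by (subst card_Diff_subset) (auto intro!: le_add_diff_inverse2 card_mono)
  have "card (fst b \<inter> S2) = K - card (fst b \<inter> S1)" by (rule cf_split(2)[OF fr_subset e])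
  then show ?thesis unfolding ZZ_def fr_insert c1[symmetric] c2[symmetric] using x by (simp add: power_add)
qed

lemma Gl_ZZ:
  assumes x: "1 \<le> x" "1 \<le> y"
  shows "Gl (ZZ x y) Q \<le> bb x y * ZZ x y Q"
proof -
  let ?F = "fr Q"
  have "Gl (ZZ x y) Q = (\<Sum>e\<in>{e. e \<subseteq> ?F \<and> card e = K}. cf ?F e * (ZZ x y Q * (x ^ card (e \<inter> S1) * y ^ (K - card (e \<inter> S1)))))"
    using opr_sum_A[of Q "ZZ x y" "\<lambda>e. ZZ x y Q * (x ^ card (e \<inter> S1) * y ^ (K - card (e \<inter> S1)))" "\<lambda>_. 1"] ZZ_insert[OF x] by simp
  also have "\<dots> = (\<Sum>j\<le>K. real (K choose j) * p ^ j * q ^ (K - j) * bratio (card (?F \<inter> S1)) (card (?F \<inter> S1)) j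
         * bratio (card (?F \<inter> S2)) (card (?F \<inter> S2)) (K - j) * (ZZ x y Q * (x ^ j * y ^ (K - j))))"
    by (rule cf_sum[OF fr_subset subset_refl, of Q "\<lambda>j. ZZ x y Q * (x ^ j * y ^ (K - j))"])
  also have "\<dots> \<le> (\<Sum>j\<le>K. real (K choose j) * p ^ j * q ^ (K - j) * 1 * 1 * (ZZ x y Q * (x ^ j * y ^ (K - j))))"
    using p_pos q_pos x ZZ_nonneg[OF x]
    by (intro sum_mono mult_mono bratio_le_1 order_refl mult_nonneg_nonneg bratio_nonneg) auto
  also have "\<dots> = (p * x + q * y) ^ K * ZZ x y Q"
    unfolding binomial_ring sum_distrib_right by (intro sum.cong refl) (simp add: power_mult_distrib)
  also have "\<dots> \<le> bb x y * ZZ x y Q"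
    unfolding bb_def using p_pos q_pos pq x ZZ_nonneg[OF x] by (intro mult_right_mono power_convex_2) auto
  finally show ?thesis .
qed

lemma Sp_ZZ:
  assumes x: "1 \<le> x" "1 \<le> y"
  shows "Sp (ZZ x y) Q \<le> bb x y * ZZ x y Q"
proof -
  let ?F = "fr Q"
  have "Sp (ZZ x y) Q = (\<Sum>e\<in>{e. e \<subseteq> ?F \<and> card e = K}. cf ?F e * vS e * (\<lambda>j. ZZ x y Q * (x ^ j * y ^ (K - j))) (card (e \<inter> S1)))"
    using opr_sum_A[of Q "ZZ x y" "\<lambda>e. ZZ x y Q * (x ^ card (e \<inter> S1) * y ^ (K - card (e \<inter> S1)))" vS] ZZ_insert[OF x] by simp
  also have "\<dots> = p * bratio (card (?F \<inter> S1)) (card (?F \<inter> S1)) K * (ZZ x y Q * (x ^ K * y ^ (K - K)))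
     + q * bratio (card (?F \<inter> S2)) (card (?F \<inter> S2)) K * (ZZ x y Q * (x ^ 0 * y ^ (K - 0)))"
    by (rule Sp_sum[OF fr_subset subset_refl])
  also have "\<dots> \<le> p * 1 * (ZZ x y Q * (x ^ K * y ^ (K - K))) + q * 1 * (ZZ x y Q * (x ^ 0 * y ^ (K - 0)))"
    using p_pos q_pos x ZZ_nonneg[OF x] by (intro add_mono mult_right_mono mult_left_mono bratio_le_1 order_refl) auto
  also have "\<dots> = bb x y * ZZ x y Q" by (simp add: bb_def algebra_simps)
  finally show ?thesis .
qed

lemma Gl_1: "Gl (\<lambda>_. 1) Q \<le> 1" and Sp_1: "Sp (\<lambda>_. 1) Q \<le> 1"
  using Gl_ZZ[of 1 1 Q] Sp_ZZ[of 1 1 Q] pq by (simp_all add: ZZ_def[abs_def] bb_def)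

lemma Sp_1_eq:
  assumes "K \<le> card (fr Q \<inter> S1)" "K \<le> card (fr Q \<inter> S2)"
  shows "Sp (\<lambda>_. 1) Q = 1"
proof -
  have "Sp (\<lambda>_. 1) Q = p * bratio (card (fr Q \<inter> S1)) (card (fr Q \<inter> S1)) K + q * bratio (card (fr Q \<inter> S2)) (card (fr Q \<inter> S2)) K"
    using opr_sum_A[of Q "\<lambda>_. 1" "\<lambda>_. 1" vS] Sp_sum[OF fr_subset subset_refl, of Q "\<lambda>_. 1"] by simp
  then show ?thesis using assms pq by (simp add: bratio_def)
qed

lemma Gl_1_eq:
  assumes "K \<le> card (fr Q \<inter> S1)" "K \<le> card (fr Q \<inter> S2)"
  shows "Gl (\<lambda>_. 1) Q = 1"
proof -
  have "Gl (\<lambda>_. 1) Q = (\<Sum>j\<le>K. real (K choose j) * p ^ j * q ^ (K - j) * bratio (card (fr Q \<inter> S1)) (card (fr Q \<inter> S1)) j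
         * bratio (card (fr Q \<inter> S2)) (card (fr Q \<inter> S2)) (K - j))"
    using opr_sum_A[of Q "\<lambda>_. 1" "\<lambda>_. 1" "\<lambda>_. 1"] cf_sum[OF fr_subset subset_refl, of Q "\<lambda>_. 1"] by simp
  also have "\<dots> = (\<Sum>j\<le>K. real (K choose j) * p ^ j * q ^ (K - j))"
    using assms by (intro sum.cong refl) (simp add: bratio_def)
  also have "\<dots> = (p + q) ^ K" by (simp add: binomial_ring)
  finally show ?thesis using pq by simp
qed

text \<open>A function that dominates the indicator of having fewer than m free points on one of the sides,
  and that grows at most by the factor bb under each step.\<close>

definition ovf :: "real \<Rightarrow> nat \<Rightarrow> nat \<Rightarrow> ('p set \<times> 'm) set \<Rightarrow> real" where
  "ovf z m T Q = z ^ m * bb z 1 ^ T * ZZ z 1 Q + z ^ m * bb 1 z ^ T * ZZ 1 z Q"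

lemma ovf_nonneg: "1 \<le> z \<Longrightarrow> 0 \<le> ovf z m T Q"
  unfolding ovf_def using ZZ_nonneg[of z 1 Q] ZZ_nonneg[of 1 z Q] bb_ge_1[of z 1] bb_ge_1[of 1 z]
  by (intro add_nonneg_nonneg mult_nonneg_nonneg) auto

text \<open>Markov's inequality in functional form: with fewer than m free points on a side, the
  factor \<open>z ^ m\<close> outweighs the power in the denominator of \<open>ZZ\<close>.\<close>

lemma ovf_ge_1:
  assumes z: "1 \<le> z" and m: "card (fr Q \<inter> S1) < m \<or> card (fr Q \<inter> S2) < m"
  shows "1 \<le> ovf z m T Q"
proof -
  have *: "1 \<le> z ^ m * b * (1 / z ^ c)" if "c < m" "1 \<le> b" for b c
  proof -
    have "z ^ m / z ^ c = z ^ (m - c)" using that z by (simp add: power_diff)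
    then have "z ^ m * b * (1 / z ^ c) = z ^ (m - c) * b" by (metis mult.commute mult.right_neutral times_divide_eq_left times_divide_eq_right)
    moreover have "1 * 1 \<le> z ^ (m - c) * b" using that z by (intro mult_mono) auto
    ultimately show ?thesis by simp
  qed
  have b: "1 \<le> bb z 1 ^ T" "1 \<le> bb 1 z ^ T" using bb_ge_1 z by (auto intro!: one_le_power)
  have nn: "0 \<le> z ^ m * bb z 1 ^ T * ZZ z 1 Q" "0 \<le> z ^ m * bb 1 z ^ T * ZZ 1 z Q"
    using b ZZ_nonneg[of z 1 Q] ZZ_nonneg[of 1 z Q] z by (auto intro!: mult_nonneg_nonneg)
  from m show ?thesis
  proof
    assume "card (fr Q \<inter> S1) < m"
    from *[OF this b(1)] show ?thesis using nn by (simp add: ovf_def ZZ_def)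
  next
    assume "card (fr Q \<inter> S2) < m"
    from *[OF this b(2)] show ?thesis using nn by (simp add: ovf_def ZZ_def)
  qed
qed

text \<open>\<open>T\<close> counts the steps still to come. Pulling the function back through a
  step raises this count by one, so a shortage at a later time is controlled by a value at the
  present state.\<close>

lemma opr_ovf:
  assumes z: "1 \<le> z" and s: "\<And>x y. 1 \<le> x \<Longrightarrow> 1 \<le> y \<Longrightarrow> opr v (ZZ x y) Q \<le> bb x y * ZZ x y Q"
  shows "opr v (ovf z m T) Q \<le> ovf z m (Suc T) Q"
proof -
  have "opr v (ovf z m T) Q = z ^ m * bb z 1 ^ T * opr v (ZZ z 1) Q + z ^ m * bb 1 z ^ T * opr v (ZZ 1 z) Q"
    unfolding ovf_def[abs_def] by (rule opr_linear)
  also have "\<dots> \<le> z ^ m * bb z 1 ^ T * (bb z 1 * ZZ z 1 Q) + z ^ m * bb 1 z ^ T * (bb 1 z * ZZ 1 z Q)"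
    using z s bb_ge_1[of z 1] bb_ge_1[of 1 z] by (intro add_mono mult_left_mono mult_nonneg_nonneg) auto
  also have "\<dots> = ovf z m (Suc T) Q" by (simp add: ovf_def algebra_simps)
  finally show ?thesis .
qed

lemma ovf_mono:
  assumes z: "1 \<le> z"
  shows "ovf z m T Q \<le> ovf z m (Suc T) Q"
proof -
  have "bb z 1 ^ T * 1 \<le> bb z 1 ^ T * bb z 1" "bb 1 z ^ T * 1 \<le> bb 1 z ^ T * bb 1 z"
    using bb_ge_1[of z 1] bb_ge_1[of 1 z] z by (auto intro!: mult_left_mono)
  then show ?thesis unfolding ovf_def using z ZZ_nonneg[of z 1 Q] ZZ_nonneg[of 1 z Q]
    by (intro add_mono mult_right_mono mult_left_mono) (auto simp: mult.commute)
qed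

text \<open>After T global steps, given the set U of used points, the blocks form a uniform partition of U.\<close>

lemma Gl_pow_expansion:
  "\<exists>\<gamma>\<ge>0. \<forall>f Q. (Gl ^^ T) f Q = (\<Sum>U\<in>{U. U \<subseteq> fr Q \<and> card U = K * T}. \<gamma> * wt (fr Q - U) / wt (fr Q) * EP U (\<lambda>P. f (P \<union> Q)))"
proof (induction T)
  case 0
  have "{U. U \<subseteq> fr Q \<and> card U = K * 0} = {{}}" for Q
    using finite_subset[OF _ finite_fr] by auto
  then show ?case using wt_pos by (intro exI[of _ 1]) (auto simp: less_imp_neq[THEN not_sym])
next
  case (Suc T)
  then obtain \<gamma> where \<gamma>: "\<gamma> \<ge> 0" and IH: "\<And>f Q. (Gl ^^ T) f Q = (\<Sum>U\<in>{U. U \<subseteq> fr Q \<and> card U = K * T}. \<gamma> * wt (fr Q - U) / wt (fr Q) * EP U (\<lambda>P. f (P \<union> Q)))"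
    by blast
  define \<gamma>' where "\<gamma>' = fact K * \<gamma> * real ((K * Suc T) choose K)"
  have "(Gl ^^ Suc T) f Q = (\<Sum>U\<in>{U. U \<subseteq> fr Q \<and> card U = K * Suc T}. \<gamma>' * wt (fr Q - U) / wt (fr Q) * EP U (\<lambda>P. f (P \<union> Q)))" for f Q
  proof -
    let ?F = "fr Q"
    let ?G = "\<lambda>b U'. fact K * \<gamma> / wt ?F * (wt (?F - (U' \<union> fst b)) * EP U' (\<lambda>P. f (insert b P \<union> Q)))"
    have "real (card A) * (Gl ^^ Suc T) f Q = (\<Sum>b\<in>Bl ?F. cf ?F (fst b) * (Gl ^^ T) f (insert b Q))"
      using cardA_pos by (simp add: opr_def)
    also have "\<dots> = (\<Sum>b\<in>Bl ?F. \<Sum>U'\<in>{U. U \<subseteq> ?F - fst b \<and> card U = K * T}. ?G b U')"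
    proof (intro sum.cong refl)
      fix b :: "'p set \<times> 'm"
      have "cf ?F (fst b) * (\<gamma> * wt (?F - fst b - U') / wt (?F - fst b) * EP U' (\<lambda>P. f (P \<union> insert b Q))) = ?G b U'" for U'
      proof -
        have "?F - fst b - U' = ?F - (U' \<union> fst b)" "\<And>P. P \<union> insert b Q = insert b P \<union> Q" by auto
        then show ?thesis using wt_pos[of "?F - fst b"] unfolding cf_def by simp
      qed
      then show "cf ?F (fst b) * (Gl ^^ T) f (insert b Q) = (\<Sum>U'\<in>{U. U \<subseteq> ?F - fst b \<and> card U = K * T}. ?G b U')"
        unfolding IH fr_insert sum_distrib_left by (intro sum.cong refl)
    qed
    also have "\<dots> = (\<Sum>(b, U')\<in>(SIGMA b:Bl ?F. {U. U \<subseteq> ?F - fst b \<and> card U = K * T}). ?G b U')"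
      by (intro sum.Sigma) auto
    \<comment> \<open>The pair of first block and later used points is regrouped as the total used
      set \<open>U\<close> and a block inside it; the inner sum then becomes \<open>EP U\<close> by
      \<open>EP_rec\<close>.\<close>
    also have "\<dots> = (\<Sum>(U, b)\<in>(SIGMA U:{U. U \<subseteq> ?F \<and> card U = K * Suc T}. Bl U). ?G b (U - fst b))"
    proof (rule sum.reindex_bij_witness[where i = "\<lambda>(U, b). (b, U - fst b)" and j = "\<lambda>(b, U'). (U' \<union> fst b, b)"])
      fix x assume "x \<in> (SIGMA b:Bl ?F. {U. U \<subseteq> ?F - fst b \<and> card U = K * T})"
      then obtain b U' where x: "x = (b, U')" and b: "b \<in> Bl ?F" and U': "U' \<subseteq> ?F - fst b" "card U' = K * T" by auto
      have fin: "finite U'" "finite (fst b)"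
        using U' BlD(1)[OF b] finite_subset[OF _ finite_fr] by blast+
      have d: "U' \<union> fst b - fst b = U'" using U' by auto
      show "(case case x of (b, U') \<Rightarrow> (U' \<union> fst b, b) of (U, b) \<Rightarrow> (b, U - fst b)) = x" using x d by simp
      have "card (U' \<union> fst b) = K * Suc T" using U' fin BlD(2)[OF b] by (subst card_Un_disjoint) auto
      then show "(case x of (b, U') \<Rightarrow> (U' \<union> fst b, b)) \<in> (SIGMA U:{U. U \<subseteq> ?F \<and> card U = K * Suc T}. Bl U)"
        using x U' BlD[OF b] by (auto simp: Bl_def mem_Times_iff)
      show "(case case x of (b, U') \<Rightarrow> (U' \<union> fst b, b) of (U, b) \<Rightarrow> ?G b (U - fst b)) = (case x of (b, U') \<Rightarrow> ?G b U')"
        using x d by simp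
    next
      fix y assume "y \<in> (SIGMA U:{U. U \<subseteq> ?F \<and> card U = K * Suc T}. Bl U)"
      then obtain U b where y: "y = (U, b)" and U: "U \<subseteq> ?F" "card U = K * Suc T" and b: "b \<in> Bl U" by auto
      have "U - fst b \<union> fst b = U" using BlD(1)[OF b] by auto
      then show "(case case y of (U, b) \<Rightarrow> (b, U - fst b) of (b, U') \<Rightarrow> (U' \<union> fst b, b)) = y" using y by simp
      have "card (U - fst b) = K * T" using U finite_subset[OF U(1)] b by (intro card_Diff_Bl) auto
      then show "(case y of (U, b) \<Rightarrow> (b, U - fst b)) \<in> (SIGMA b:Bl ?F. {U. U \<subseteq> ?F - fst b \<and> card U = K * T})"
        using y U subsetD[OF Bl_mono[OF U(1)] b] by auto
    qed
    also have "\<dots> = (\<Sum>U\<in>{U. U \<subseteq> ?F \<and> card U = K * Suc T}. \<Sum>b\<in>Bl U. ?G b (U - fst b))"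
      using finite_subset[OF _ finite_fr] by (intro sum.Sigma[symmetric]) auto
    also have "\<dots> = (\<Sum>U\<in>{U. U \<subseteq> ?F \<and> card U = K * Suc T}. real (card A) * (\<gamma>' * wt (?F - U) / wt ?F * EP U (\<lambda>P. f (P \<union> Q))))"
    proof (intro sum.cong refl)
      fix U assume "U \<in> {U. U \<subseteq> ?F \<and> card U = K * Suc T}"
      then have U: "finite U" "card U = K * Suc T" "U \<subseteq> ?F" using finite_subset[OF _ finite_fr] by auto
      have "(\<Sum>b\<in>Bl U. ?G b (U - fst b)) = (\<Sum>b\<in>Bl U. fact K * \<gamma> / wt ?F * (wt (?F - U) * EP (U - fst b) (\<lambda>P. f (insert b P \<union> Q))))"
      proof (intro sum.cong refl)
        fix b assume b: "b \<in> Bl U"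
        have "U - fst b \<union> fst b = U" using BlD(1)[OF b] by auto
        then show "?G b (U - fst b) = fact K * \<gamma> / wt ?F * (wt (?F - U) * EP (U - fst b) (\<lambda>P. f (insert b P \<union> Q)))" by simp
      qed
      also have "\<dots> = fact K * \<gamma> / wt ?F * (wt (?F - U) * (\<Sum>b\<in>Bl U. EP (U - fst b) (\<lambda>P. f (insert b P \<union> Q))))"
        by (simp only: sum_distrib_left)
      also have "(\<Sum>b\<in>Bl U. EP (U - fst b) (\<lambda>P. f (insert b P \<union> Q))) = real (card (Bl U)) * EP U (\<lambda>P. f (P \<union> Q))"
        unfolding EP_rec[OF U(1,2), of "\<lambda>P. f (P \<union> Q)"] avg_def
        using Bl_nonempty[OF U(1)] U(1,2) by simp
      also have "real (card (Bl U)) = real ((K * Suc T) choose K) * real (card A)" using U by (simp add: card_Bl)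
      finally show "(\<Sum>b\<in>Bl U. ?G b (U - fst b)) = real (card A) * (\<gamma>' * wt (?F - U) / wt ?F * EP U (\<lambda>P. f (P \<union> Q)))"
        by (simp only: \<gamma>'_def times_divide_eq_left times_divide_eq_right mult_ac)
    qed
    finally show ?thesis using cardA_pos by (simp only: sum_distrib_left[symmetric] mult_cancel_left) simp
  qed
  then show ?case using \<gamma> by (intro exI[of _ \<gamma>']) (auto simp: \<gamma>'_def)
qed

lemma opr_pow_1:
  assumes v: "\<And>e. 0 \<le> v e" and 1: "\<And>Q. opr v (\<lambda>_. 1) Q \<le> 1"
  shows "valid n Q \<Longrightarrow> (opr v ^^ T) (\<lambda>_. 1) Q \<le> 1"
proof (induction T arbitrary: n Q)
  case (Suc T)
  have "opr v ((opr v ^^ T) (\<lambda>_. 1)) Q \<le> opr v (\<lambda>_. 1) Q"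
    using Suc by (intro opr_mono[OF v]) auto
  then show ?case using 1[of Q] by simp
qed simp

text \<open>The weights of the possible used sets sum to at most 1, so the worst set bounds the mean
  and the law of the used set never has to be computed.\<close>

lemma Gl_pow_le:
  assumes Q: "valid n Q" and \<beta>: "0 \<le> \<beta>"
    and U: "\<And>U. U \<subseteq> fr Q \<Longrightarrow> card U = K * T \<Longrightarrow> EP U (\<lambda>P. f (P \<union> Q)) \<le> \<beta>"
  shows "(Gl ^^ T) f Q \<le> \<beta>"
proof -
  obtain \<gamma> where \<gamma>: "\<gamma> \<ge> 0" and G: "\<And>f Q. (Gl ^^ T) f Q = (\<Sum>U\<in>{U. U \<subseteq> fr Q \<and> card U = K * T}. \<gamma> * wt (fr Q - U) / wt (fr Q) * EP U (\<lambda>P. f (P \<union> Q)))"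
    using Gl_pow_expansion[of T] by blast
  have w: "0 \<le> \<gamma> * wt (fr Q - U) / wt (fr Q)" for U using \<gamma> wt_pos[of "fr Q"] wt_pos[of "fr Q - U"] by simp
  have "(Gl ^^ T) f Q \<le> (\<Sum>U\<in>{U. U \<subseteq> fr Q \<and> card U = K * T}. \<gamma> * wt (fr Q - U) / wt (fr Q) * \<beta>)"
    unfolding G using w U by (intro sum_mono mult_left_mono) auto
  also have "\<dots> = \<beta> * (Gl ^^ T) (\<lambda>_. 1) Q"
    unfolding G sum_distrib_left
  proof (intro sum.cong refl)
    fix U assume "U \<in> {U. U \<subseteq> fr Q \<and> card U = K * T}"
    then have "EP U (\<lambda>_. 1) = (1::real)" using finite_subset[OF _ finite_fr, of U Q] EP_const[of U T 1] by simp
    then show "\<gamma> * wt (fr Q - U) / wt (fr Q) * \<beta> = \<beta> * (\<gamma> * wt (fr Q - U) / wt (fr Q) * EP U (\<lambda>P. 1))" by simp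
  qed
  also have "\<dots> \<le> \<beta> * 1" using opr_pow_1[OF _ Gl_1 Q] \<beta> by (intro mult_left_mono) auto
  finally show ?thesis by simp
qed

text \<open>The split step in a form that matches \<open>EP_rec\<close> on each side. A side with
  fewer than K free points contributes an average over the empty set, that is 0.\<close>

lemma Sp_avg:
  "Sp f Q = p * avg (Bl (fr Q \<inter> S1)) (\<lambda>b. f (insert b Q)) + q * avg (Bl (fr Q \<inter> S2)) (\<lambda>b. f (insert b Q))"
proof -
  let ?F = "fr Q"
  have filt: "Bl (?F \<inter> S) = {b \<in> Bl ?F. fst b \<subseteq> S}" for S by (auto simp: Bl_def)
  have pK: "p ^ K = p * p ^ (K - 1)" "q ^ K = q * q ^ (K - 1)"
    using K_pos by (simp_all add: power_eq_if)
  have 1: "(\<Sum>b\<in>Bl ?F. cf ?F (fst b) * (if fst b \<subseteq> S1 then 1 / p ^ (K - 1) else 0) * f (insert b Q))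
    = real (card A) * (p * avg (Bl (?F \<inter> S1)) (\<lambda>b. f (insert b Q)))"
  proof -
    have "(\<Sum>b\<in>Bl ?F. cf ?F (fst b) * (if fst b \<subseteq> S1 then 1 / p ^ (K - 1) else 0) * f (insert b Q))
      = (\<Sum>b\<in>Bl ?F. if fst b \<subseteq> S1 then cf ?F (fst b) / p ^ (K - 1) * f (insert b Q) else 0)"
      by (intro sum.cong refl) simp
    also have "\<dots> = (\<Sum>b\<in>Bl (?F \<inter> S1). cf ?F (fst b) / p ^ (K - 1) * f (insert b Q))"
      unfolding filt by (intro sum.inter_filter[symmetric]) simp
    also have "\<dots> = (\<Sum>b\<in>Bl (?F \<inter> S1). p / real (card (?F \<inter> S1) choose K) * f (insert b Q))"
    proof (intro sum.cong refl)
      fix b :: "'p set \<times> 'm" assume "b \<in> Bl (?F \<inter> S1)"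
      then have b: "fst b \<subseteq> ?F" "card (fst b) = K" "fst b \<inter> S1 = fst b" by (auto simp: Bl_def)
      have "cf ?F (fst b) = p ^ K / real (card (?F \<inter> S1) choose K)"
        using cf_split(1)[OF fr_subset b(1,2)] b(2,3) by simp
      then show "cf ?F (fst b) / p ^ (K - 1) * f (insert b Q) = p / real (card (?F \<inter> S1) choose K) * f (insert b Q)"
        using p_pos by (simp add: pK)
    qed
    finally show ?thesis
      unfolding sum_distrib_left[symmetric] avg_def using cardA_pos by (simp add: card_Bl)
  qed
  have 2: "(\<Sum>b\<in>Bl ?F. cf ?F (fst b) * (if fst b \<subseteq> S2 then 1 / q ^ (K - 1) else 0) * f (insert b Q))
    = real (card A) * (q * avg (Bl (?F \<inter> S2)) (\<lambda>b. f (insert b Q)))"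
  proof -
    have "(\<Sum>b\<in>Bl ?F. cf ?F (fst b) * (if fst b \<subseteq> S2 then 1 / q ^ (K - 1) else 0) * f (insert b Q))
      = (\<Sum>b\<in>Bl ?F. if fst b \<subseteq> S2 then cf ?F (fst b) / q ^ (K - 1) * f (insert b Q) else 0)"
      by (intro sum.cong refl) simp
    also have "\<dots> = (\<Sum>b\<in>Bl (?F \<inter> S2). cf ?F (fst b) / q ^ (K - 1) * f (insert b Q))"
      unfolding filt by (intro sum.inter_filter[symmetric]) simp
    also have "\<dots> = (\<Sum>b\<in>Bl (?F \<inter> S2). q / real (card (?F \<inter> S2) choose K) * f (insert b Q))"
    proof (intro sum.cong refl)
      fix b :: "'p set \<times> 'm" assume "b \<in> Bl (?F \<inter> S2)"
      then have b: "fst b \<subseteq> ?F" "card (fst b) = K" "fst b \<inter> S1 = {}" using disjoint_S by (auto simp: Bl_def)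
      have "cf ?F (fst b) = q ^ K / real (card (?F \<inter> S2) choose K)"
        using cf_split(1)[OF fr_subset b(1,2)] b(3) by simp
      then show "cf ?F (fst b) / q ^ (K - 1) * f (insert b Q) = q / real (card (?F \<inter> S2) choose K) * f (insert b Q)"
        using q_pos by (simp add: pK)
    qed
    finally show ?thesis
      unfolding sum_distrib_left[symmetric] avg_def using cardA_pos by (simp add: card_Bl)
  qed
  have "(\<Sum>b\<in>Bl ?F. cf ?F (fst b) * vS (fst b) * f (insert b Q))
    = real (card A) * (p * avg (Bl (?F \<inter> S1)) (\<lambda>b. f (insert b Q)) + q * avg (Bl (?F \<inter> S2)) (\<lambda>b. f (insert b Q)))"
    unfolding vS_def distrib_left distrib_right sum.distrib 1 2 ..
  then show ?thesis using cardA_pos by (simp add: opr_def)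
qed

end

section \<open>The interpolation inequality\<close>

lemma avg_swap: "avg X (\<lambda>x. avg Y (\<lambda>y. f x y)) = avg Y (\<lambda>y. avg X (\<lambda>x. f x y))"
  unfolding avg_def sum_divide_distrib[symmetric] by (subst sum.swap) (simp add: field_simps)

locale interpolation = two_sides K A S1 S2 p q
  for K :: nat and A :: "'m set" and S1 S2 :: "'p set" and p q :: real +
  fixes \<Psi> :: "('p set \<times> 'm) set \<Rightarrow> real" and m :: nat
  assumes \<Psi>_nonneg: "finite Q \<Longrightarrow> 0 \<le> \<Psi> Q"
    and \<Psi>_le_card: "finite Q \<Longrightarrow> \<Psi> Q \<le> card Q"
    and \<Psi>_lip: "lip 1 (Bl (S1 \<union> S2)) \<Psi>"
    and K_le_m: "K \<le> m"
    and convex_step: "valid n Q \<Longrightarrow> m \<le> card (fr Q \<inter> S1) \<Longrightarrow> m \<le> card (fr Q \<inter> S2) \<Longrightarrow> Sp \<Psi> Q \<le> Gl \<Psi> Q + (real K)\<^sup>2 / m"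
begin

section \<open>Exchanging split steps for global steps\<close>

definition BB :: real where "BB = real (card (S1 \<union> S2)) / real K"

lemma Kr: "0 < real K" using K_pos by simp

lemma BB_nonneg: "0 \<le> BB" by (simp add: BB_def)

lemma valid_\<Psi>_le: assumes "valid n Q" shows "\<Psi> Q \<le> BB"
proof -
  have "real K * real n \<le> real (card (S1 \<union> S2))"
    using assms by (metis add_leD2 of_nat_le_iff of_nat_mult order_refl valid_def)
  then have "real n \<le> BB" using Kr by (simp add: BB_def field_simps)
  moreover have "\<Psi> Q \<le> real n" using \<Psi>_le_card[of Q] assms by (simp add: valid_def)
  ultimately show ?thesis by simp
qed

lemma opr_\<Psi>_nonneg:
  assumes v: "\<And>e. 0 \<le> v e" and Q: "valid n Q"
  shows "0 \<le> opr v \<Psi> Q"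
  unfolding opr_def using v cf_nonneg valid_insert[OF Q] \<Psi>_nonneg
  by (intro divide_nonneg_nonneg sum_nonneg mult_nonneg_nonneg) (auto simp: valid_def)

text \<open>Frees \<open>convex_step\<close> from its condition on free points: if a side is short,
  \<open>ovf\<close> is at least 1, and then \<open>BB\<close>, the number of blocks of a full
  partition, bounds whatever can go wrong.\<close>

lemma Sp_le_Gl_ovf:
  assumes Q: "valid n Q" and z: "1 \<le> z"
  shows "Sp \<Psi> Q \<le> Gl \<Psi> Q + (real K)\<^sup>2 / m + BB * ovf z m 0 Q"
proof (cases "m \<le> card (fr Q \<inter> S1) \<and> m \<le> card (fr Q \<inter> S2)")
  case True
  then have "Sp \<Psi> Q \<le> Gl \<Psi> Q + (real K)\<^sup>2 / m" using convex_step[OF Q] by blast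
  then show ?thesis using BB_nonneg ovf_nonneg[OF z, of m 0 Q] by (smt (verit) mult_nonneg_nonneg)
next
  case False
  then have o: "1 \<le> ovf z m 0 Q" by (intro ovf_ge_1[OF z]) auto
  have "Sp \<Psi> Q \<le> Sp (\<lambda>Q. BB * 1 + 0 * 0) Q"
    using valid_\<Psi>_le by (intro opr_mono[OF vS_nonneg Q]) simp
  also have "\<dots> = BB * Sp (\<lambda>_. 1) Q" by (subst opr_linear) simp
  also have "\<dots> \<le> BB * 1" using Sp_1 BB_nonneg by (intro mult_left_mono)
  also have "\<dots> \<le> BB * ovf z m 0 Q" using o BB_nonneg by (intro mult_left_mono)
  finally have "Sp \<Psi> Q \<le> BB * ovf z m 0 Q" .
  moreover have "0 \<le> Gl \<Psi> Q" by (rule opr_\<Psi>_nonneg[OF _ Q]) simp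
  ultimately show ?thesis by (smt (verit) divide_nonneg_nonneg of_nat_0_le_iff zero_le_power2)
qed

lemma Gl_pow_ovf:
  assumes z: "1 \<le> z"
  shows "valid n Q \<Longrightarrow> (Gl ^^ T) (ovf z m 0) Q \<le> ovf z m T Q"
proof (induction T arbitrary: n Q)
  case (Suc T)
  have "Gl ((Gl ^^ T) (ovf z m 0)) Q \<le> Gl (ovf z m T) Q"
    using Suc by (intro opr_mono) auto
  also have "\<dots> \<le> ovf z m (Suc T) Q" using opr_ovf[OF z Gl_ZZ] .
  finally show ?case by simp
qed simp

text \<open>A hybrid argument. By commutation the remaining split step acts directly on \<Psi>,
  where \<open>Sp_le_Gl_ovf\<close> applies; otherwise convexity would be required of averages of
  \<Psi> over later steps.\<close>

lemma Sp_pow_le_Gl_pow: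
  assumes z: "1 \<le> z"
  shows "valid n Q \<Longrightarrow> (Sp ^^ T) \<Psi> Q \<le> (Gl ^^ T) \<Psi> Q + T * ((real K)\<^sup>2 / m + BB * ovf z m T Q)"
proof (induction T arbitrary: n Q)
  case (Suc T)
  define err where "err = (real K)\<^sup>2 / m"
  have err: "0 \<le> err" by (simp add: err_def)
  have "(Sp ^^ Suc T) \<Psi> Q \<le> Sp (\<lambda>Q. 1 * (Gl ^^ T) \<Psi> Q + real T * (err * 1 + BB * ovf z m T Q)) Q"
    using Suc.IH by (auto simp: err_def intro!: opr_mono[OF vS_nonneg Suc.prems])
  also have "\<dots> = Sp ((Gl ^^ T) \<Psi>) Q + T * (err * Sp (\<lambda>_. 1) Q + BB * Sp (ovf z m T) Q)"
    unfolding opr_linear by simp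
  also have "\<dots> \<le> Sp ((Gl ^^ T) \<Psi>) Q + T * (err * 1 + BB * ovf z m (Suc T) Q)"
    using Sp_1 opr_ovf[OF z Sp_ZZ] err BB_nonneg by (intro add_left_mono mult_left_mono add_mono) auto
  also have "Sp ((Gl ^^ T) \<Psi>) Q = (Gl ^^ T) (Sp \<Psi>) Q" by (simp only: opr_pow_commute)
  also have "\<dots> \<le> (Gl ^^ T) (\<lambda>Q. 1 * Gl \<Psi> Q + 1 * (err * 1 + BB * ovf z m 0 Q)) Q"
    using Sp_le_Gl_ovf[OF _ z] by (intro opr_pow_mono[OF _ Suc.prems]) (auto simp: err_def add.assoc)
  also have "\<dots> = (Gl ^^ T) (Gl \<Psi>) Q + (err * (Gl ^^ T) (\<lambda>_. 1) Q + BB * (Gl ^^ T) (ovf z m 0) Q)"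
    unfolding opr_pow_linear by simp
  also have "\<dots> \<le> (Gl ^^ T) (Gl \<Psi>) Q + (err * 1 + BB * ovf z m (Suc T) Q)"
    using opr_pow_1[OF _ Gl_1 Suc.prems, of T] Gl_pow_ovf[OF z Suc.prems, of T] ovf_mono[OF z, of m T Q] err BB_nonneg
    by (intro add_left_mono add_mono mult_left_mono) auto
  finally show ?case by (simp add: funpow_swap1 algebra_simps flip: err_def)
qed simp

text \<open>The mean optimum after completing Q by uniform partitions of the free points of both sides. It is a martingale
  for the split steps as long as both sides have free points.\<close>

definition Full :: "('p set \<times> 'm) set \<Rightarrow> real" where
  "Full Q = EP (fr Q \<inter> S1) (\<lambda>P1. EP (fr Q \<inter> S2) (\<lambda>P2. \<Psi> (P1 \<union> P2 \<union> Q)))"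

lemma finite_frS [simp]: "finite (fr Q \<inter> S1)" "finite (fr Q \<inter> S2)"
  using finite_fr by auto

lemma card_fr_split: "card (fr Q \<inter> S1) + card (fr Q \<inter> S2) = card (fr Q)"
proof -
  have "fr Q = (fr Q \<inter> S1) \<union> (fr Q \<inter> S2)" "(fr Q \<inter> S1) \<inter> (fr Q \<inter> S2) = {}"
    using disjoint_S fr_subset[of Q] by auto
  then show ?thesis by (metis card_Un_disjoint finite_frS)
qed

lemma Full_nonneg: "finite Q \<Longrightarrow> 0 \<le> Full Q"
  unfolding Full_def EP_def by (intro avg_nonneg \<Psi>_nonneg) (auto intro: MPart_finite[OF _ finite_frS(1)] MPart_finite[OF _ finite_frS(2)])

text \<open>A completion adds \<open>card (fr Q) / K\<close> blocks, each worth at most 1. If there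
  is no completion, \<open>Full Q\<close> is 0 and both bounds hold because their right sides are
  nonnegative.\<close>

lemma Full_le:
  assumes Q: "valid n Q"
  shows "Full Q \<le> \<Psi> Q + card (fr Q) / K" "Full Q \<le> BB"
proof -
  have *: "\<Psi> (P1 \<union> P2 \<union> Q) \<le> \<Psi> Q + card (fr Q) / K \<and> \<Psi> (P1 \<union> P2 \<union> Q) \<le> BB"
    if P: "P1 \<in> MPart (fr Q \<inter> S1)" "P2 \<in> MPart (fr Q \<inter> S2)" for P1 P2
  proof -
    have fin: "finite P1" "finite P2" "finite Q" using MPart_finite[OF P(1)] MPart_finite[OF P(2)] Q by (auto simp: valid_def)
    have sub: "P1 \<union> P2 \<subseteq> Bl (S1 \<union> S2)"
      using MPart_subset[OF P(1)] MPart_subset[OF P(2)] Bl_mono[of "fr Q \<inter> S1" "S1 \<union> S2"] Bl_mono[of "fr Q \<inter> S2" "S1 \<union> S2"] by blast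
    have "K * card P1 + K * card P2 = card (fr Q)"
      using card_MPart_element[OF P(1)] card_MPart_element[OF P(2)] card_fr_split[of Q] by simp
    then have cP: "card P1 + card P2 = card (fr Q) / K" using Kr by (simp add: field_simps flip: of_nat_add of_nat_mult)
    have cU: "card (P1 \<union> P2) \<le> card P1 + card P2" by (rule card_Un_le)
    have "\<bar>\<Psi> ((P1 \<union> P2) \<union> Q) - \<Psi> Q\<bar> \<le> 1 * real (card (P1 \<union> P2))"
      using fin sub Q by (intro lip_add_set[OF \<Psi>_lip]) (auto simp: valid_def)
    then have 1: "\<Psi> (P1 \<union> P2 \<union> Q) \<le> \<Psi> Q + card (fr Q) / K" using cU cP by linarith
    have "real (card (fr Q)) + real K * n = card (S1 \<union> S2)" using Q unfolding valid_def by (metis of_nat_add of_nat_mult)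
    then have "card (fr Q) / K + n = BB" using Kr by (simp add: BB_def field_simps)
    moreover have "\<Psi> Q \<le> n" using \<Psi>_le_card[of Q] Q by (simp add: valid_def)
    ultimately show ?thesis using 1 by linarith
  qed
  have gen: "Full Q \<le> c" if c: "0 \<le> c" "\<And>P1 P2. P1 \<in> MPart (fr Q \<inter> S1) \<Longrightarrow> P2 \<in> MPart (fr Q \<inter> S2) \<Longrightarrow> \<Psi> (P1 \<union> P2 \<union> Q) \<le> c" for c
  proof -
    have le: "avg X f \<le> c" if "\<And>x. x \<in> X \<Longrightarrow> f x \<le> c" "finite X" for X :: "('p set \<times> 'm) set set" and f
      using that c(1) avg_le[of X f c] by (cases "X = {}") (auto simp: avg_def)
    show ?thesis unfolding Full_def EP_def using c(2) by (intro le) auto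
  qed
  have "0 \<le> \<Psi> Q" using Q by (intro \<Psi>_nonneg) (simp add: valid_def)
  then show "Full Q \<le> \<Psi> Q + card (fr Q) / K" using * by (intro gen) auto
  show "Full Q \<le> BB" using * BB_nonneg by (intro gen) auto
qed

lemma Full_martingale1:
  assumes "card (fr Q \<inter> S1) = K * Suc k"
  shows "avg (Bl (fr Q \<inter> S1)) (\<lambda>b. Full (insert b Q)) = Full Q"
proof -
  have "Full Q = avg (Bl (fr Q \<inter> S1)) (\<lambda>b. EP ((fr Q \<inter> S1) - fst b) (\<lambda>P1. EP (fr Q \<inter> S2) (\<lambda>P2. \<Psi> (insert b P1 \<union> P2 \<union> Q))))"
    unfolding Full_def by (rule EP_rec[OF finite_frS(1) assms])
  also have "\<dots> = avg (Bl (fr Q \<inter> S1)) (\<lambda>b. Full (insert b Q))"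
  proof (rule avg_cong)
    fix b assume "b \<in> Bl (fr Q \<inter> S1)"
    then have "fst b \<subseteq> S1" using BlD(1) by blast
    then have "fr (insert b Q) \<inter> S1 = fr Q \<inter> S1 - fst b" "fr (insert b Q) \<inter> S2 = fr Q \<inter> S2"
      using disjoint_S by (auto simp: fr_insert)
    then show "EP (fr Q \<inter> S1 - fst b) (\<lambda>P1. EP (fr Q \<inter> S2) (\<lambda>P2. \<Psi> (insert b P1 \<union> P2 \<union> Q))) = Full (insert b Q)"
      by (simp add: Full_def)
  qed
  finally show ?thesis by simp
qed

lemma Full_martingale2:
  assumes "card (fr Q \<inter> S2) = K * Suc k"
  shows "avg (Bl (fr Q \<inter> S2)) (\<lambda>b. Full (insert b Q)) = Full Q"
proof -
  have "Full Q = EP (fr Q \<inter> S1) (\<lambda>P1. avg (Bl (fr Q \<inter> S2)) (\<lambda>b. EP ((fr Q \<inter> S2) - fst b) (\<lambda>P2. \<Psi> (P1 \<union> insert b P2 \<union> Q))))"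
    unfolding Full_def by (subst EP_rec[OF finite_frS(2) assms]) (rule refl)
  also have "\<dots> = avg (Bl (fr Q \<inter> S2)) (\<lambda>b. EP (fr Q \<inter> S1) (\<lambda>P1. EP ((fr Q \<inter> S2) - fst b) (\<lambda>P2. \<Psi> (P1 \<union> insert b P2 \<union> Q))))"
    unfolding EP_def[of "fr Q \<inter> S1"] by (rule avg_swap)
  also have "\<dots> = avg (Bl (fr Q \<inter> S2)) (\<lambda>b. Full (insert b Q))"
  proof (rule avg_cong)
    fix b assume "b \<in> Bl (fr Q \<inter> S2)"
    then have "fst b \<subseteq> S2" using BlD(1) by blast
    then have "fr (insert b Q) \<inter> S2 = fr Q \<inter> S2 - fst b" "fr (insert b Q) \<inter> S1 = fr Q \<inter> S1"
      using disjoint_S by (auto simp: fr_insert)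
    then show "EP (fr Q \<inter> S1) (\<lambda>P1. EP (fr Q \<inter> S2 - fst b) (\<lambda>P2. \<Psi> (P1 \<union> insert b P2 \<union> Q))) = Full (insert b Q)"
      by (simp add: Full_def)
  qed
  finally show ?thesis by simp
qed

lemma Sp_Full:
  assumes Q: "valid n Q" and z: "1 \<le> z"
  shows "Full Q \<le> Sp Full Q + BB * ovf z m 0 Q"
proof -
  have fQ: "finite Q" using Q by (simp add: valid_def)
  have Snn: "0 \<le> Sp Full Q" unfolding Sp_avg using p_pos q_pos fQ
    by (intro add_nonneg_nonneg mult_nonneg_nonneg avg_nonneg Full_nonneg) auto
  have onn: "0 \<le> BB * ovf z m 0 Q" using BB_nonneg ovf_nonneg[OF z] by simp
  show ?thesis
  proof (cases "m \<le> card (fr Q \<inter> S1) \<and> m \<le> card (fr Q \<inter> S2)")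
    case False
    then have "BB * 1 \<le> BB * ovf z m 0 Q" using BB_nonneg by (intro mult_left_mono ovf_ge_1[OF z]) auto
    then show ?thesis using Full_le(2)[OF Q] Snn by linarith
  next
    case True
    show ?thesis
    proof (cases "Full Q = 0")
      case True
      then show ?thesis using Snn onn by simp
    next
      case False
      \<comment> \<open>A nonzero value shows that both sides can be partitioned, so their free
        sizes are multiples of K; they are positive because at least m points are free.\<close>
      then have "MPart (fr Q \<inter> S1) \<noteq> {}" by (auto simp: Full_def EP_def avg_def)
      moreover have "MPart (fr Q \<inter> S2) \<noteq> {}" using False by (auto simp: Full_def EP_def avg_def)
      ultimately obtain P1 P2 where "P1 \<in> MPart (fr Q \<inter> S1)" "P2 \<in> MPart (fr Q \<inter> S2)" by blast
      then have c: "card (fr Q \<inter> S1) = K * card P1" "card (fr Q \<inter> S2) = K * card P2"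
        by (auto intro: card_MPart_element)
      then have "card P1 \<noteq> 0" "card P2 \<noteq> 0" using True K_le_m K_pos by (metis mult_0_right not_one_le_zero order_trans)+
      then obtain k1 k2 where "card P1 = Suc k1" "card P2 = Suc k2" using not0_implies_Suc by blast
      then have "Sp Full Q = p * Full Q + q * Full Q"
        unfolding Sp_avg using Full_martingale1[of Q k1] Full_martingale2[of Q k2] c by simp
      also have "\<dots> = Full Q" using pq by (simp flip: distrib_right)
      finally show ?thesis using onn by simp
    qed
  qed
qed

lemma Sp_pow_Full:
  assumes z: "1 \<le> z"
  shows "valid n Q \<Longrightarrow> Full Q \<le> (Sp ^^ T) Full Q + T * (BB * ovf z m T Q)"
proof (induction T arbitrary: n Q)
  case (Suc T)
  have "Sp Full Q \<le> Sp (\<lambda>Q. 1 * (Sp ^^ T) Full Q + (T * BB) * ovf z m T Q) Q"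
    using Suc.IH by (auto simp: mult.assoc intro!: opr_mono[OF vS_nonneg Suc.prems])
  also have "\<dots> = (Sp ^^ Suc T) Full Q + (T * BB) * Sp (ovf z m T) Q" unfolding opr_linear by simp
  also have "\<dots> \<le> (Sp ^^ Suc T) Full Q + (T * BB) * ovf z m (Suc T) Q"
    using opr_ovf[OF z Sp_ZZ] BB_nonneg by (intro add_left_mono mult_left_mono) auto
  finally have 1: "Sp Full Q \<le> (Sp ^^ Suc T) Full Q + (T * BB) * ovf z m (Suc T) Q" .
  have "ovf z m 0 Q \<le> ovf z m (Suc T) Q"
    by (rule lift_Suc_mono_le[of "\<lambda>T. ovf z m T Q"]) (auto intro: ovf_mono[OF z])
  then have "BB * ovf z m 0 Q \<le> BB * ovf z m (Suc T) Q" using BB_nonneg by (intro mult_left_mono)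
  then show ?case using 1 Sp_Full[OF Suc.prems z] by (simp add: algebra_simps)
qed simp

text \<open>The left side is \<open>Full {}\<close>. Stopping d blocks early costs d when
  \<open>Full\<close> is replaced by \<Psi>, and \<open>3 * K * d\<close> when the used set of the
  global process is replaced by all points. A shortage is paid for twice, in the martingale and in
  the exchange of steps, whence the factor 2.\<close>

theorem interpolation_inequality:
  assumes z: "1 \<le> z" and c: "card (S1 \<union> S2) = K * (T + d)"
  shows "EP S1 (\<lambda>P1. EP S2 (\<lambda>P2. \<Psi> (P1 \<union> P2)))
    \<le> EP (S1 \<union> S2) \<Psi> + (1 + 3 * K) * d + T * ((real K)\<^sup>2 / m + 2 * BB * ovf z m T {})"
proof -
  have frE: "fr {} = S1 \<union> S2" "(S1 \<union> S2) \<inter> S1 = S1" "(S1 \<union> S2) \<inter> S2 = S2" by (auto simp: fr_def)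
  have finS: "finite (S1 \<union> S2)" using finite_S by simp
  have Full0: "Full {} = EP S1 (\<lambda>P1. EP S2 (\<lambda>P2. \<Psi> (P1 \<union> P2)))"
    unfolding Full_def frE by simp
  have 1: "(Sp ^^ T) Full {} \<le> (Sp ^^ T) (\<lambda>Q. 1 * \<Psi> Q + real d * 1) {}"
  proof (rule opr_pow_mono[OF vS_nonneg valid_empty])
    fix Q assume "valid (0 + T) Q"
    then have Q: "valid T Q" by simp
    then have "card (fr Q) = K * d" using c by (simp add: valid_def algebra_simps)
    then have "real (card (fr Q)) / K = d" using Kr by simp
    then show "Full Q \<le> 1 * \<Psi> Q + real d * 1" using Full_le(1)[OF Q] by simp
  qed
  also have "\<dots> = (Sp ^^ T) \<Psi> {} + d * (Sp ^^ T) (\<lambda>_. 1) {}" by (subst opr_pow_linear) simp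
  also have "\<dots> \<le> (Sp ^^ T) \<Psi> {} + d * 1"
    using opr_pow_1[OF vS_nonneg Sp_1 valid_empty, of T] mult_left_mono[of "(Sp ^^ T) (\<lambda>_. 1) {}" 1 "real d"] by simp
  finally have A: "(Sp ^^ T) Full {} \<le> (Sp ^^ T) \<Psi> {} + d" by simp
  have B: "(Gl ^^ T) \<Psi> {} \<le> EP (S1 \<union> S2) \<Psi> + 3 * (1::real) * K * d"
  proof (rule Gl_pow_le[OF valid_empty])
    show "0 \<le> EP (S1 \<union> S2) \<Psi> + 3 * (1::real) * K * d"
      unfolding EP_def using MPart_finite[OF _ finS] by (intro add_nonneg_nonneg avg_nonneg \<Psi>_nonneg) auto
    fix U assume U: "U \<subseteq> fr {}" "card U = K * T"
    then have "EP U \<Psi> \<le> EP (S1 \<union> S2) \<Psi> + 3 * (1::real) * K * d"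
      unfolding frE by (intro EP_subset_le[OF finS _ _ c \<Psi>_lip]) auto
    then show "EP U (\<lambda>P. \<Psi> (P \<union> {})) \<le> EP (S1 \<union> S2) \<Psi> + 3 * (1::real) * K * d" by simp
  qed
  show ?thesis
    using Sp_pow_Full[OF z valid_empty, of T] A B Sp_pow_le_Gl_pow[OF z valid_empty, of T] unfolding Full0
    by (simp add: algebra_simps)
qed

end

section \<open>Spin models\<close>

text \<open>Each \<open>w i\<close> is the integral over t in [0,1] of the indicator of t <
  \<open>w i\<close>. The weights \<alpha> may have either sign, so the estimate has to be made for
  a whole layer at a time and then integrated.\<close>

lemma layer_cake_le:
  fixes \<alpha> w :: "'i \<Rightarrow> real"
  assumes I: "finite I" and w: "\<And>i. i \<in> I \<Longrightarrow> 0 \<le> w i \<and> w i \<le> 1" and E: "0 \<le> E"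
    and t: "\<And>t. 0 \<le> t \<Longrightarrow> t < 1 \<Longrightarrow> (\<Sum>i\<in>I. \<alpha> i * of_bool (t < w i)) \<le> E"
  shows "(\<Sum>i\<in>I. \<alpha> i * w i) \<le> E"
proof -
  have ind: "((\<lambda>t. of_bool (t < c) :: real) has_integral c) {0..1}" if "0 \<le> c" "c \<le> 1" for c :: real
  proof -
    have "((\<lambda>t. 1 :: real) has_integral c) {0..c}"
      using has_integral_const_real[of "1::real" 0 c] that by simp
    then have "((\<lambda>t. if t \<in> {0..c} then 1 else 0 :: real) has_integral c) {0..1}"
      using that by (subst has_integral_restrict) auto
    then show ?thesis
      by (rule has_integral_spike_finite[rotated 2, of _ _ _ "{c}"]) auto
  qed
  have "((\<lambda>t. \<Sum>i\<in>I. \<alpha> i * of_bool (t < w i)) has_integral (\<Sum>i\<in>I. \<alpha> i * w i)) {0..1}"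
    using w by (intro has_integral_sum I has_integral_mult_right ind) auto
  moreover have "((\<lambda>t. E) has_integral E) {0..1::real}"
    using has_integral_const_real[of E 0 1] by simp
  moreover have "(\<Sum>i\<in>I. \<alpha> i * of_bool (t < w i)) \<le> E" if "t \<in> {0..1}" for t
  proof (cases "t < 1")
    case True
    then show ?thesis using assms(4)[of t] that by simp
  next
    case False
    then have "\<not> t < w i" if "i \<in> I" for i using w[OF that] by simp
    then have "(\<Sum>i\<in>I. \<alpha> i * of_bool (t < w i)) = 0" by (intro sum.neutral) auto
    then show ?thesis using E by simp
  qed
  ultimately show ?thesis by (rule has_integral_le)
qed

lemma length_edge_nodes: "finite e \<Longrightarrow> length (edge_nodes r e) = card e"
  by (simp add: edge_nodes_def)

lemma set_edge_nodes: "finite e \<Longrightarrow> set (edge_nodes r e) = (\<lambda>p. p div r) ` e"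
  by (simp add: edge_nodes_def)

abbreviation marks :: "nat \<Rightarrow> bool list set" where
  "marks K \<equiv> {a. length a = K}"

lemma finite_marks: "finite (marks K)" and card_marks: "card (marks K) = 2 ^ K"
  using finite_lists_length_eq[of "UNIV :: bool set" K] card_lists_length_eq[of "UNIV :: bool set" K] by auto

text \<open>A block contributes 1 to the energy unless it is bad. The last assumption is what convexity is applied to: the number
  of marks for which e is bad under all assignments in X is, up to a constant, the indicator of e lying in one class of
  a partial equivalence relation.\<close>

locale spin_model =
  fixes K q r :: nat and \<nu> :: "nat \<Rightarrow> real" and bad :: "bool list \<Rightarrow> nat list \<Rightarrow> bool"
  assumes K_ge_2: "2 \<le> K" and q_pos: "1 \<le> q" and r_pos: "1 \<le> r"
    and per: "(X :: (nat \<Rightarrow> nat) set) \<noteq> {} \<Longrightarrow> X \<subseteq> PiE V (\<lambda>_. {..<q}) \<Longrightarrow>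
      \<exists>(k::nat) R. k \<le> 2 ^ K \<and> symp R \<and> transp R \<and>
        (\<forall>e. length e = K \<longrightarrow> set e \<subseteq> V \<longrightarrow>
          card {a \<in> marks K. \<forall>x\<in>X. bad a (map x e)} = k * of_bool (\<forall>i\<in>set e. \<forall>j\<in>set e. R i j))"

sublocale spin_model \<subseteq> marked_blocks K "marks K"
proof
  show "1 \<le> K" using K_ge_2 by simp
  show "finite (marks K)" by (rule finite_marks)
  show "marks K \<noteq> {}" using card_marks[of K] by (metis card.empty power_not_zero zero_neq_numeral)
qed

context spin_model
begin

section \<open>Energies, optima and the loss caused by a new block\<close>

definition Xs :: "nat set \<Rightarrow> (nat \<Rightarrow> nat) set" where
  "Xs V = PiE V (\<lambda>_. {..<q})"

definition good :: "(nat set \<times> bool list) \<Rightarrow> (nat \<Rightarrow> nat) \<Rightarrow> real" where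
  "good b x = of_bool (\<not> bad (snd b) (map x (edge_nodes r (fst b))))"

definition ev :: "nat set \<Rightarrow> (nat set \<times> bool list) set \<Rightarrow> (nat \<Rightarrow> nat) \<Rightarrow> real" where
  "ev V Q x = (\<Sum>i\<in>V. \<nu> (x i)) + (\<Sum>b\<in>Q. good b x)"

definition mx :: "nat set \<Rightarrow> (nat set \<times> bool list) set \<Rightarrow> real" where
  "mx V Q = Max (ev V Q ` Xs V)"

text \<open>Subtracting the optimum without blocks gives a value between 0 and the number of blocks,
  as the interpolation requires, whatever the node potentials are.\<close>

definition Psi :: "nat set \<Rightarrow> (nat set \<times> bool list) set \<Rightarrow> real" where
  "Psi V Q = mx V Q - mx V {}"

lemma finite_Xs: "finite V \<Longrightarrow> finite (Xs V)"
  unfolding Xs_def by (rule finite_PiE) auto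

lemma Xs_nonempty: "Xs V \<noteq> {}"
  unfolding Xs_def using q_pos by (auto simp: PiE_eq_empty_iff lessThan_empty_iff)

lemma ev_le_mx: "finite V \<Longrightarrow> x \<in> Xs V \<Longrightarrow> ev V Q x \<le> mx V Q"
  unfolding mx_def by (intro Max_ge) (auto simp: finite_Xs)

lemma mx_le: "finite V \<Longrightarrow> (\<And>x. x \<in> Xs V \<Longrightarrow> ev V Q x \<le> c) \<Longrightarrow> mx V Q \<le> c"
  unfolding mx_def using Xs_nonempty[of V] by (intro Max.boundedI) (auto simp: finite_Xs)

lemma mx_attained: "finite V \<Longrightarrow> \<exists>x\<in>Xs V. ev V Q x = mx V Q"
proof -
  assume "finite V"
  then have "mx V Q \<in> ev V Q ` Xs V" unfolding mx_def using Xs_nonempty[of V] by (intro Max_in) (auto simp: finite_Xs)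
  then show ?thesis by force
qed

lemma good_bounds: "0 \<le> good b x" "good b x \<le> 1"
  by (auto simp: good_def)

lemma ev_insert: "finite Q \<Longrightarrow> b \<notin> Q \<Longrightarrow> ev V (insert b Q) x = ev V Q x + good b x"
  by (simp add: ev_def)

lemma mx_insert:
  assumes V: "finite V" and Q: "finite Q"
  shows "mx V Q \<le> mx V (insert b Q)" "mx V (insert b Q) \<le> mx V Q + 1"
proof -
  have "mx V Q \<le> mx V (insert b Q) \<and> mx V (insert b Q) \<le> mx V Q + 1"
  proof (cases "b \<in> Q")
    case True
    then show ?thesis by (simp add: insert_absorb)
  next
    case False
    have "ev V Q x \<le> mx V (insert b Q)" if "x \<in> Xs V" for x
      using ev_le_mx[OF V that, of "insert b Q"] ev_insert[OF Q False, of V x] good_bounds[of b x] by linarith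
    moreover have "ev V (insert b Q) x \<le> mx V Q + 1" if "x \<in> Xs V" for x
      using ev_le_mx[OF V that, of Q] ev_insert[OF Q False, of V x] good_bounds[of b x] by linarith
    ultimately show ?thesis using mx_le[OF V] by blast
  qed
  then show "mx V Q \<le> mx V (insert b Q)" "mx V (insert b Q) \<le> mx V Q + 1" by auto
qed

lemma Psi_lip: "finite V \<Longrightarrow> lip 1 X (Psi V)"
  unfolding lip_def Psi_def
proof (intro allI impI)
  fix Q b assume "finite V" "finite (Q :: (nat set \<times> bool list) set)"
  from mx_insert[OF this, of b] show "\<bar>mx V (insert b Q) - mx V {} - (mx V Q - mx V {})\<bar> \<le> 1" by simp
qed

lemma Psi_nonneg: "finite V \<Longrightarrow> finite Q \<Longrightarrow> 0 \<le> Psi V Q"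
proof (induction Q rule: infinite_finite_induct)
  case (insert b Q)
  then show ?case using mx_insert(1)[of V Q b] by (simp add: Psi_def)
qed (auto simp: Psi_def)

lemma Psi_le_card: "finite V \<Longrightarrow> finite Q \<Longrightarrow> Psi V Q \<le> card Q"
proof (induction Q rule: infinite_finite_induct)
  case (insert b Q)
  then show ?case using mx_insert(2)[of V Q b] by (simp add: Psi_def)
qed (auto simp: Psi_def)

text \<open>An assignment more than t below the optimum stays under the threshold even if it gains
  1; one within t stays under it exactly if it gains 0, since t < 1.\<close>

lemma loss_iff:
  assumes V: "finite V" and Q: "finite Q" and b: "b \<notin> Q" and t: "0 \<le> t" "t < 1"
  shows "t < mx V Q + 1 - mx V (insert b Q) \<longleftrightarrow>
    (\<forall>x\<in>{x \<in> Xs V. mx V Q - t \<le> ev V Q x}. bad (snd b) (map x (edge_nodes r (fst b))))"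
proof -
  have "t < mx V Q + 1 - mx V (insert b Q) \<longleftrightarrow> mx V (insert b Q) < mx V Q + 1 - t" by linarith
  also have "\<dots> \<longleftrightarrow> (\<forall>x\<in>Xs V. ev V (insert b Q) x < mx V Q + 1 - t)"
    unfolding mx_def[of V "insert b Q"] using finite_Xs[OF V] Xs_nonempty[of V] by (subst Max_less_iff) auto
  also have "\<dots> \<longleftrightarrow> (\<forall>x\<in>Xs V. mx V Q - t \<le> ev V Q x \<longrightarrow> bad (snd b) (map x (edge_nodes r (fst b))))"
  proof (intro ball_cong refl)
    fix x assume "x \<in> Xs V"
    then have "ev V Q x \<le> mx V Q" by (rule ev_le_mx[OF V])
    then show "(ev V (insert b Q) x < mx V Q + 1 - t) = (mx V Q - t \<le> ev V Q x \<longrightarrow> bad (snd b) (map x (edge_nodes r (fst b))))"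
      using t unfolding ev_insert[OF Q b] good_def by auto
  qed
  finally show ?thesis by auto
qed

end

locale spin_sides = spin_model K q r \<nu> bad + two_sides K "marks K" S1 S2 p p'
  for K q r :: nat and \<nu> :: "nat \<Rightarrow> real" and bad :: "bool list \<Rightarrow> nat list \<Rightarrow> bool"
    and S1 S2 :: "nat set" and p p' :: real +
  fixes V :: "nat set" and m :: nat
  assumes finite_V: "finite V" and points_V: "x \<in> S1 \<union> S2 \<Longrightarrow> x div r \<in> V" and Km: "K \<le> m"
begin

text \<open>For each threshold t, averaging over the marks turns the event of a large loss into a
  clique indicator by \<open>per\<close>; \<open>Gl_Sp_clique\<close> bounds this layer and
  \<open>layer_cake_le\<close> reassembles the loss.\<close>

lemma Psi_convex_step:
  assumes Q: "valid n Q" and m: "m \<le> card (fr Q \<inter> S1)" "m \<le> card (fr Q \<inter> S2)"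
  shows "Sp (Psi V) Q \<le> Gl (Psi V) Q + (real K)\<^sup>2 / m"
proof -
  let ?F = "fr Q" and ?A = "marks K"
  have fQ: "finite Q" using Q by (simp add: valid_def)
  define loss where "loss b = mx V Q + 1 - mx V (insert b Q)" for b
  define \<alpha> where "\<alpha> b = (cf ?F (fst b) - cf ?F (fst b) * vS (fst b)) / real (card ?A)" for b :: "nat set \<times> bool list"
  have K1: "K \<le> card (?F \<inter> S1)" "K \<le> card (?F \<inter> S2)" using m Km by auto
  have diff: "Gl f Q - Sp f Q = (\<Sum>b\<in>Bl ?F. \<alpha> b * f (insert b Q))" for f
    unfolding opr_def \<alpha>_def by (simp add: sum_subtractf diff_divide_distrib[symmetric] left_diff_distrib sum_divide_distrib[symmetric])
  \<comment> \<open>Both steps have mass 1 here, so the constant \<open>Psi V Q + 1\<close> drops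
    out of the difference and only the losses remain.\<close>
  have "(\<Sum>b\<in>Bl ?F. \<alpha> b) = 0" using diff[of "\<lambda>_. 1"] Gl_1_eq[OF K1] Sp_1_eq[OF K1] by simp
  moreover have "(\<Sum>b\<in>Bl ?F. \<alpha> b * Psi V (insert b Q)) = (\<Sum>b\<in>Bl ?F. (Psi V Q + 1) * \<alpha> b - \<alpha> b * loss b)"
    by (intro sum.cong refl) (simp add: Psi_def loss_def algebra_simps)
  ultimately have eq: "Gl (Psi V) Q - Sp (Psi V) Q = - (\<Sum>b\<in>Bl ?F. \<alpha> b * loss b)"
    unfolding diff by (simp add: sum_subtractf sum_distrib_left[symmetric])
  have "(\<Sum>b\<in>Bl ?F. \<alpha> b * loss b) \<le> (real K)\<^sup>2 / m"
  proof (rule layer_cake_le)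
    show "finite (Bl ?F)" by simp
    show "0 \<le> loss b \<and> loss b \<le> 1" for b using mx_insert[OF finite_V fQ, of b] by (simp add: loss_def)
    show "0 \<le> (real K)\<^sup>2 / m" by simp
    fix t :: real assume t: "0 \<le> t" "t < 1"
    define X where "X = {x \<in> Xs V. mx V Q - t \<le> ev V Q x}"
    have "X \<noteq> {}" using mx_attained[OF finite_V, of Q] t by (auto simp: X_def)
    moreover have "X \<subseteq> PiE V (\<lambda>_. {..<q})" by (auto simp: X_def Xs_def)
    ultimately obtain k R where k: "k \<le> 2 ^ K" and R: "symp R" "transp R"
      and card: "\<And>e. length e = K \<Longrightarrow> set e \<subseteq> V \<Longrightarrow>
          card {a \<in> marks K. \<forall>x\<in>X. bad a (map x e)} = k * of_bool (\<forall>i\<in>set e. \<forall>j\<in>set e. R i j)"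
      using per[of X V] by blast
    \<comment> \<open>The relation lives on nodes, while the steps draw points; it is pulled back
      along ownership.\<close>
    define R' where "R' x y = R (x div r) (y div r)" for x y
    have R': "symp R'" "transp R'" using R unfolding R'_def symp_def transp_def by blast+
    have inner: "(\<Sum>a\<in>?A. of_bool (t < loss (e, a))) = real k * of_bool (clique R' e)" if e: "e \<subseteq> ?F" "card e = K" for e
    proof -
      have fe: "finite e" using e(1) finite_subset finite_fr by blast
      have eb: "(e, a) \<in> Bl ?F" if "a \<in> ?A" for a using that e by (auto simp: Bl_def)
      have "(\<Sum>a\<in>?A. of_bool (t < loss (e, a))) = (\<Sum>a\<in>?A. of_bool (\<forall>x\<in>X. bad a (map x (edge_nodes r e))) :: real)"
      proof (intro sum.cong refl)
        fix a assume "a \<in> ?A"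
        then have "(e, a) \<notin> Q" using valid_insert(2)[OF Q eb] by blast
        from loss_iff[OF finite_V fQ this t]
        show "of_bool (t < loss (e, a)) = (of_bool (\<forall>x\<in>X. bad a (map x (edge_nodes r e))) :: real)"
          by (simp add: loss_def X_def)
      qed
      also have "\<dots> = real (card {a \<in> ?A. \<forall>x\<in>X. bad a (map x (edge_nodes r e))})"
        using finite_marks[of K] by (simp add: sum.inter_filter[symmetric] of_bool_def)
      also have "card {a \<in> ?A. \<forall>x\<in>X. bad a (map x (edge_nodes r e))} = k * of_bool (\<forall>i\<in>set (edge_nodes r e). \<forall>j\<in>set (edge_nodes r e). R i j)"
      proof (rule card)
        show "length (edge_nodes r e) = K" using fe e by (simp add: length_edge_nodes)
        show "set (edge_nodes r e) \<subseteq> V"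
          using fe points_V e(1) fr_subset[of Q] by (auto simp: set_edge_nodes)
      qed
      also have "(\<forall>i\<in>set (edge_nodes r e). \<forall>j\<in>set (edge_nodes r e). R i j) \<longleftrightarrow> clique R' e"
        using fe by (simp add: set_edge_nodes clique_def R'_def)
      finally show ?thesis by simp
    qed
    have "(\<Sum>b\<in>Bl ?F. \<alpha> b * of_bool (t < loss b))
       = (\<Sum>e\<in>{e. e \<subseteq> ?F \<and> card e = K}. \<Sum>a\<in>?A. \<alpha> (e, a) * of_bool (t < loss (e, a)))"
      unfolding Bl_def by (simp only: sum.cartesian_product case_prod_unfold prod.collapse)
    also have "\<dots> = (\<Sum>e\<in>{e. e \<subseteq> ?F \<and> card e = K}. real k / real (card ?A) * ((cf ?F e - cf ?F e * vS e) * of_bool (clique R' e)))"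
    proof (intro sum.cong refl)
      fix e assume "e \<in> {e. e \<subseteq> ?F \<and> card e = K}"
      then have "(\<Sum>a\<in>?A. \<alpha> (e, a) * of_bool (t < loss (e, a))) = (cf ?F e - cf ?F e * vS e) / real (card ?A) * (real k * of_bool (clique R' e))"
        using inner[of e] by (simp only: \<alpha>_def fst_conv sum_distrib_left[symmetric]) simp
      then show "(\<Sum>a\<in>?A. \<alpha> (e, a) * of_bool (t < loss (e, a))) = real k / real (card ?A) * ((cf ?F e - cf ?F e * vS e) * of_bool (clique R' e))"
        by simp
    qed
    also have "\<dots> = real k / real (card ?A) * (\<Sum>e\<in>{e. e \<subseteq> ?F \<and> card e = K}. (cf ?F e - cf ?F e * vS e) * of_bool (clique R' e))"
      by (simp only: sum_distrib_left)
    also have "\<dots> \<le> real k / real (card ?A) * ((real K)\<^sup>2 / m)"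
      using Gl_Sp_clique[OF fr_subset m Km R'] by (intro mult_left_mono) auto
    also have "\<dots> \<le> 1 * ((real K)\<^sup>2 / m)"
    proof (rule mult_right_mono)
      have "real k \<le> real (card ?A)" using k by (simp add: card_marks)
      then show "real k / real (card ?A) \<le> 1" using cardA_pos by simp
    qed simp
    finally show "(\<Sum>b\<in>Bl ?F. \<alpha> b * of_bool (t < loss b)) \<le> (real K)\<^sup>2 / m" by simp
  qed
  then show ?thesis using eq by simp
qed

sublocale interpolation K "marks K" S1 S2 p p' "Psi V" m
  using Psi_nonneg[OF finite_V] Psi_le_card[OF finite_V] Psi_lip[OF finite_V] Km Psi_convex_step
  by unfold_locales

end

section \<open>Almost superadditive sequences\<close>

text \<open>Let l be a subsequential limit. One late term of the subsequence bounds all later terms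
  from below by nearly l, and a term well above l would force the subsequence to stay above
  l.\<close>

lemma convergent_if_almost_lower_stable:
  fixes h :: "nat \<Rightarrow> real"
  assumes bd: "\<And>n. \<bar>h n\<bar> \<le> B"
    and st: "\<And>\<epsilon>. 0 < \<epsilon> \<Longrightarrow> \<exists>n0. \<forall>n\<ge>n0. \<exists>M0. \<forall>M\<ge>M0. h n - \<epsilon> \<le> h M"
  shows "convergent h"
proof -
  have "bounded (range h)" using bd by (auto simp: bounded_iff)
  then obtain l \<phi> where \<phi>: "strict_mono (\<phi> :: nat \<Rightarrow> nat)" "(h \<circ> \<phi>) \<longlonglongrightarrow> l"
    using bounded_imp_convergent_subsequence by blast
  have "h \<longlonglongrightarrow> l"
  proof (rule LIMSEQ_I)
    fix e :: real assume e: "0 < e"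
    define d where "d = e / 4"
    have d: "0 < d" using e by (simp add: d_def)
    obtain n0 where n0: "\<And>n. n \<ge> n0 \<Longrightarrow> \<exists>M0. \<forall>M\<ge>M0. h n - d \<le> h M" using st[OF d] by blast
    obtain j0 where j0: "\<And>j. j \<ge> j0 \<Longrightarrow> \<bar>h (\<phi> j) - l\<bar> < d"
      using LIMSEQ_D[OF \<phi>(2) d] by auto
    have "n0 \<le> \<phi> (max j0 n0)" using seq_suble[OF \<phi>(1), of "max j0 n0"] by linarith
    then obtain M0 where M0: "\<And>M. M \<ge> M0 \<Longrightarrow> h (\<phi> (max j0 n0)) - d \<le> h M" using n0 by blast
    have low: "l - 2 * d < h M" if "M \<ge> M0" for M using M0[OF that] j0[of "max j0 n0"] by simp
    have up: "h n < l + 3 * d" if "n \<ge> n0" for n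
    proof -
      obtain M1 where M1: "\<And>M. M \<ge> M1 \<Longrightarrow> h n - d \<le> h M" using n0 \<open>n \<ge> n0\<close> by blast
      have "M1 \<le> \<phi> (max j0 M1)" using seq_suble[OF \<phi>(1), of "max j0 M1"] by linarith
      then have "h n - d \<le> h (\<phi> (max j0 M1))" using M1 by blast
      then show ?thesis using j0[of "max j0 M1"] by simp
    qed
    show "\<exists>no. \<forall>n\<ge>no. norm (h n - l) < e"
    proof (intro exI[of _ "max M0 n0"] allI impI)
      fix n assume "max M0 n0 \<le> n"
      then show "norm (h n - l) < e" using low[of n] up[of n] d by (simp add: d_def abs_less_iff)
    qed
  qed
  then show ?thesis by (rule convergentI)
qed

text \<open>The constant and the threshold may depend on k, since later only k up to a fixed bound
  are used.\<close>

lemma almost_superadditive_multiples: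
  fixes g :: "nat \<Rightarrow> real"
  assumes sup: "\<And>k. 1 \<le> k \<Longrightarrow> \<exists>C n0. \<forall>n\<ge>n0. g (k * n) + g n - C * real n powr (3/4) \<le> g (Suc k * n)"
  shows "1 \<le> k \<Longrightarrow> \<exists>C n0. \<forall>n\<ge>n0. real k * g n - C * real n powr (3/4) \<le> g (k * n)"
proof (induction k rule: nat_induct_at_least)
  case base
  then show ?case by (intro exI[of _ 0]) simp
next
  case (Suc k)
  obtain C1 n1 where 1: "\<forall>n\<ge>n1. real k * g n - C1 * real n powr (3/4) \<le> g (k * n)" using Suc by blast
  obtain C2 n2 where 2: "\<forall>n\<ge>n2. g (k * n) + g n - C2 * real n powr (3/4) \<le> g (Suc k * n)" using sup[OF Suc.hyps] by blast
  show ?case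
  proof (intro exI[of _ "C1 + C2"] exI[of _ "max n1 n2"] allI impI)
    fix n assume "max n1 n2 \<le> n"
    then show "real (Suc k) * g n - (C1 + C2) * real n powr (3/4) \<le> g (Suc k * n)"
      using 1[rule_format, of n] 2[rule_format, of n] by (simp add: algebra_simps)
  qed
qed

text \<open>The additional term on the left is the invariant that absorbs the errors of all doublings.\<close>

lemma doubling_lower_bound:
  fixes g :: "nat \<Rightarrow> real"
  assumes C: "0 \<le> C" and dbl: "\<And>n. n0 \<le> n \<Longrightarrow> 2 * g n - C * real n powr (3/4) \<le> g (2 * n)"
    and n: "n0 \<le> n"
  defines "D \<equiv> C / (2 - 2 powr (3/4))"
  shows "2 ^ a * (g n - D * real n powr (3/4)) + D * real (2 ^ a * n) powr (3/4) \<le> g (2 ^ a * n)"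
proof (induction a)
  case (Suc a)
  \<comment> \<open>\<open>D\<close> solves \<open>2 * D - C = 2 powr (3/4) * D\<close>: the doubled
    invariant term pays for the new error and still leaves the term required at the next scale. An
    exponent below 1 makes \<open>D\<close> nonnegative.\<close>
  have lt: "(2::real) powr (3/4) < 2 powr 1" by (intro powr_less_mono) auto
  then have D: "2 * D - C = 2 powr (3/4) * D" by (simp add: D_def field_simps)
  have pw: "real (2 * (2 ^ a * n)) powr (3/4) = 2 powr (3/4) * real (2 ^ a * n) powr (3/4)"
    using powr_mult[of 2 "real (2 ^ a * n)" "3/4"] by simp
  have "n \<le> 2 ^ a * n" by simp
  then have "n0 \<le> 2 ^ a * n" using n by linarith
  from dbl[OF this] have fin: "2 * g (2 ^ a * n) - C * real (2 ^ a * n) powr (3/4) \<le> g (2 ^ Suc a * n)"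
    by (simp add: mult.assoc)
  have "2 ^ Suc a * (g n - D * real n powr (3/4)) + D * real (2 ^ Suc a * n) powr (3/4)
     = 2 * (2 ^ a * (g n - D * real n powr (3/4)) + D * real (2 ^ a * n) powr (3/4)) - C * real (2 ^ a * n) powr (3/4)"
  proof -
    have "D * real (2 ^ Suc a * n) powr (3/4) = (2 powr (3/4) * D) * real (2 ^ a * n) powr (3/4)"
      using pw by (simp add: mult_ac)
    also have "\<dots> = (2 * D - C) * real (2 ^ a * n) powr (3/4)" by (simp only: D)
    finally show ?thesis by (simp only: power_Suc) (simp add: algebra_simps)
  qed
  also have "\<dots> \<le> 2 * g (2 ^ a * n) - C * real (2 ^ a * n) powr (3/4)" using Suc by simp
  finally show ?case using fin by (rule order_trans)
qed simp

text \<open>Every large M is k 2^a n plus a remainder, with k between k0 and 2 k0. Passing from n to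
  k n involves finitely many constants, the doublings cost a fixed multiple of (k n)^(3/4) per copy,
  and the remainder is at most M / k0, which the Lipschitz bound handles.\<close>

lemma almost_superadditive_limit:
  fixes g :: "nat \<Rightarrow> real"
  assumes lip: "\<And>m n. m \<le> n \<Longrightarrow> \<bar>g n - g m\<bar> \<le> c * real (n - m)" and g0: "g 0 = 0"
    and sup: "\<And>k. 1 \<le> k \<Longrightarrow> \<exists>C n0. \<forall>n\<ge>n0. g (k * n) + g n - C * real n powr (3/4) \<le> g (Suc k * n)"
  shows "convergent (\<lambda>n. g n / real n)"
proof (rule convergent_if_almost_lower_stable)
  have c: "0 \<le> c" using lip[of 0 1] by simp
  have gb: "\<bar>g n\<bar> \<le> c * real n" for n using lip[of 0 n] g0 by simp
  show hb: "\<bar>g n / real n\<bar> \<le> c" for n using gb[of n] c by (cases "n = 0") (auto simp: abs_divide divide_le_eq)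
  fix \<epsilon> :: real assume \<epsilon>: "0 < \<epsilon>"
  define h where "h n = g n / real n" for n
  \<comment> \<open>Large enough that the Lipschitz cost of a remainder of relative size 1 / k0
    stays below half of \<epsilon>.\<close>
  obtain k0 :: nat where k0: "1 \<le> k0" "2 * c + \<epsilon> < real k0 * (\<epsilon> / 2)"
  proof -
    obtain j :: nat where "(2 * c + \<epsilon>) / (\<epsilon> / 2) < real j" using reals_Archimedean2 by blast
    then have "2 * c + \<epsilon> < real j * (\<epsilon> / 2)" using \<epsilon> by (simp add: field_simps)
    then show ?thesis using that[of "max 1 j"] \<epsilon> by (smt (verit) max.cobounded1 max.cobounded2 mult_right_mono of_nat_le_iff divide_pos_pos)
  qed
  obtain Cf nf where Cf: "\<And>k n. 1 \<le> k \<Longrightarrow> nf k \<le> n \<Longrightarrow> real k * g n - Cf k * real n powr (3/4) \<le> g (k * n)"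
    using almost_superadditive_multiples[OF sup] by metis
  \<comment> \<open>Only multiples up to \<open>2 * k0\<close> occur, so sums of finitely many
    constants serve uniformly.\<close>
  define C where "C = (\<Sum>k\<le>2 * k0. \<bar>Cf k\<bar>)"
  define N0 where "N0 = (\<Sum>k\<le>2 * k0. nf k)"
  have C0: "0 \<le> C" by (simp add: C_def sum_nonneg)
  have mult: "real k * g n - C * real n powr (3/4) \<le> g (k * n)" if k: "1 \<le> k" "k \<le> 2 * k0" and n: "N0 \<le> n" for k n
  proof -
    have "nf k \<le> N0" unfolding N0_def using k by (intro member_le_sum) auto
    then have 1: "real k * g n - Cf k * real n powr (3/4) \<le> g (k * n)" using Cf[OF k(1)] n by simp
    have "\<bar>Cf k\<bar> \<le> C" unfolding C_def using k by (intro member_le_sum) auto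
    then have "Cf k * real n powr (3/4) \<le> C * real n powr (3/4)" by (intro mult_right_mono) auto
    then show ?thesis using 1 by linarith
  qed
  define D where "D = C / (2 - 2 powr (3/4))"
  have "(2::real) powr (3/4) < 2 powr 1" by (intro powr_less_mono) auto
  then have D0: "0 \<le> D" using C0 by (simp add: D_def)
  have "((\<lambda>n. (C + D) * real n powr (-1/4)) \<longlongrightarrow> 0) sequentially"
    by real_asymp
  then have "eventually (\<lambda>n. (C + D) * real n powr (-1/4) < \<epsilon> / 2) sequentially"
    using \<epsilon> by (intro order_tendstoD) auto
  then obtain n1 where n1: "\<And>n. n1 \<le> n \<Longrightarrow> (C + D) * real n powr (-1/4) < \<epsilon> / 2"
    by (auto simp: eventually_sequentially)
  have "\<exists>n0. \<forall>n\<ge>n0. \<exists>M0. \<forall>M\<ge>M0. h n - \<epsilon> \<le> h M"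
  proof (rule exI[of _ "max 1 (max n1 N0)"], intro allI impI)
    fix n assume "max 1 (max n1 N0) \<le> n"
    then have n: "1 \<le> n" "n1 \<le> n" "N0 \<le> n" by auto
    show "\<exists>M0. \<forall>M\<ge>M0. h n - \<epsilon> \<le> h M"
    proof (intro exI[of _ "k0 * n"] allI impI)
      fix M assume M: "k0 * n \<le> M"
      \<comment> \<open>The scale \<open>2 ^ a\<close> is chosen so that the quotient of M by
        \<open>2 ^ a * n\<close> falls in the window from \<open>k0\<close> to
        \<open>2 * k0\<close>.\<close>
      obtain a where a: "2 ^ a * (k0 * n) \<le> M" "M < 2 ^ Suc a * (k0 * n)"
      proof -
        have pos: "1 \<le> k0 * n" using k0 n by simp
        have "\<exists>a. M < 2 ^ a * (k0 * n)"
        proof -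
          have "M < 2 ^ M" by (rule less_exp)
          also have "\<dots> \<le> 2 ^ M * (k0 * n)" using pos by simp
          finally show ?thesis by blast
        qed
        define j where "j = (LEAST a. M < 2 ^ a * (k0 * n))"
        have j: "M < 2 ^ j * (k0 * n)" unfolding j_def using \<open>\<exists>a. M < 2 ^ a * (k0 * n)\<close> by (rule LeastI_ex)
        have "j \<noteq> 0" using j M by (intro notI) simp
        then obtain i where i: "j = Suc i" using not0_implies_Suc by blast
        have "\<not> M < 2 ^ i * (k0 * n)" using not_less_Least[of i "\<lambda>a. M < 2 ^ a * (k0 * n)"] i unfolding j_def[symmetric] by simp
        then show ?thesis using that[of i] j i by simp
      qed
      define P where "P = 2 ^ a * n"
      have P: "1 \<le> P" using n by (simp add: P_def)
      define k where "k = M div P"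
      have k: "k0 \<le> k" "k < 2 * k0"
      proof -
        have "k0 * P \<le> M" using a(1) by (simp add: P_def mult_ac)
        then show "k0 \<le> k" unfolding k_def using P by (simp add: less_eq_div_iff_mult_less_eq)
        have "M < (2 * k0) * P" using a(2) by (simp add: P_def mult_ac)
        then show "k < 2 * k0" unfolding k_def using P by (simp add: div_less_iff_less_mult)
      qed
      have MP: "k * P \<le> M" "M - k * P < P" unfolding k_def using P
        by (auto simp: minus_div_mult_eq_mod)
      have Mpos: "0 < real M" using M k0 n by (metis le_trans mult_le_mono nat_mult_1 of_nat_0_less_iff less_le_trans zero_less_one)
      define s where "s = real n powr (-1/4)"
      have s: "real n powr (3/4) = real n * s"
        unfolding s_def using n powr_add[of "real n" 1 "-1/4"] by simp
      have kn: "real k * real n * (h n - C * s) \<le> g (k * n)"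
      proof -
        have "real k * g n - C * real n powr (3/4) \<le> g (k * n)" using k k0 n by (intro mult) auto
        moreover have "real k * real n * (h n - C * s) = real k * g n - real k * (C * (real n * s))"
          using n by (simp add: h_def field_simps)
        moreover have "1 * (C * (real n * s)) \<le> real k * (C * (real n * s))"
          using k k0 C0 by (intro mult_right_mono) (auto simp: s_def)
        ultimately show ?thesis using s by simp
      qed
      have "2 ^ a * (g (k * n) - D * real (k * n) powr (3/4)) + D * real (2 ^ a * (k * n)) powr (3/4) \<le> g (2 ^ a * (k * n))"
        unfolding D_def
      proof (rule doubling_lower_bound[OF C0])
        show "2 * g n - C * real n powr (3/4) \<le> g (2 * n)" if "N0 \<le> n" for n
          using mult[of 2 n] k0 that by simp
        show "N0 \<le> k * n" using n(3) k k0 by (metis le_trans mult_le_mono1 nat_mult_1)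
      qed
      moreover have "0 \<le> D * real (2 ^ a * (k * n)) powr (3/4)" using D0 by simp
      moreover have "2 ^ a * (k * n) = k * P" by (simp add: P_def)
      ultimately have dl: "2 ^ a * (g (k * n) - D * real (k * n) powr (3/4)) \<le> g (k * P)" by simp
      have kn2: "real (k * n) powr (3/4) \<le> real k * real n * s"
      proof -
        have "real (k * n) powr (3/4) = real k powr (3/4) * real n powr (3/4)" by (simp add: powr_mult)
        also have "\<dots> \<le> real k powr 1 * real n powr (3/4)" using k k0 by (intro mult_right_mono powr_mono) auto
        finally show ?thesis using s by (simp add: mult.assoc)
      qed
      have gP: "real (k * P) * (h n - (C + D) * s) \<le> g (k * P)"
      proof -
        have "D * real (k * n) powr (3/4) \<le> D * (real k * real n * s)" using kn2 D0 by (rule mult_left_mono)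
        then have "real k * real n * (h n - C * s) - D * (real k * real n * s) \<le> g (k * n) - D * real (k * n) powr (3/4)"
          using kn by linarith
        then have "2 ^ a * (real k * real n * (h n - C * s) - D * (real k * real n * s)) \<le> 2 ^ a * (g (k * n) - D * real (k * n) powr (3/4))"
          by (intro mult_left_mono) auto
        then show ?thesis using dl by (simp add: P_def algebra_simps)
      qed
      have sm: "(C + D) * s < \<epsilon> / 2" unfolding s_def by (rule n1[OF n(2)])
      have hn: "\<bar>h n\<bar> \<le> c" unfolding h_def by (rule hb)
      \<comment> \<open>The remainder is less than \<open>P\<close>, while M contains at least
        \<open>k0\<close> copies of \<open>P\<close>.\<close>
      have gap: "real (M - k * P) * real k0 \<le> real M"
      proof -
        have "(M - k * P) * k0 \<le> P * k0" using MP(2) by (intro mult_le_mono1) simp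
        also have "\<dots> \<le> P * k" using k by simp
        also have "\<dots> \<le> M" using MP(1) by (simp add: mult.commute)
        finally show ?thesis by (metis of_nat_le_iff of_nat_mult)
      qed
      define G where "G = real (M - k * P)"
      have MG: "real M = real (k * P) + G" unfolding G_def using MP(1) by (simp add: of_nat_diff)
      have G0: "0 \<le> G" by (simp add: G_def)
      have "\<bar>g M - g (k * P)\<bar> \<le> c * G" unfolding G_def by (rule lip[OF MP(1)])
      moreover have "real (k * P) * (h n - \<epsilon> / 2) \<le> real (k * P) * (h n - (C + D) * s)"
        using sm by (intro mult_left_mono) auto
      ultimately have "real (k * P) * (h n - \<epsilon> / 2) - c * G \<le> g M" using gP by linarith
      moreover have "real (k * P) * (h n - \<epsilon> / 2) = real M * (h n - \<epsilon> / 2) - G * (h n - \<epsilon> / 2)"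
        using MG by (simp add: algebra_simps)
      moreover have "G * (h n - \<epsilon> / 2) \<le> G * c" using hn \<epsilon> G0 by (intro mult_left_mono) auto
      ultimately have 1: "real M * (h n - \<epsilon> / 2) - G * (2 * c) \<le> g M" by (simp add: algebra_simps)
      have "G * (2 * c) \<le> G * (real k0 * (\<epsilon> / 2))" using k0(2) \<epsilon> G0 by (intro mult_left_mono) auto
      also have "\<dots> = (G * real k0) * (\<epsilon> / 2)" by simp
      also have "\<dots> \<le> real M * (\<epsilon> / 2)" using gap \<epsilon> unfolding G_def by (intro mult_right_mono) auto
      finally have "real M * (h n - \<epsilon>) \<le> g M" using 1 by (simp add: algebra_simps)
      then show "h n - \<epsilon> \<le> h M" unfolding h_def[of M] using Mpos by (simp add: field_simps)
    qed
  qed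
  then show "\<exists>n0. \<forall>n\<ge>n0. \<exists>M0. \<forall>M\<ge>M0. g n / real n - \<epsilon> \<le> g M / real M" unfolding h_def .
qed

section \<open>Convergence of the mean and concentration\<close>

lemma sorted_list_of_set_shift:
  fixes e :: "nat set"
  assumes "finite e"
  shows "sorted_list_of_set ((+) c ` e) = map ((+) c) (sorted_list_of_set e)"
proof (rule sorted_distinct_set_unique)
  show "sorted (map ((+) c) (sorted_list_of_set e))"
    by (simp add: sorted_wrt_map)
  show "distinct (map ((+) c) (sorted_list_of_set e))" by (simp add: distinct_map)
qed (use assms in auto)

text \<open>The node list of a block follows the order of its points. A translation by whole nodes
  preserves this order, so positions in the list, and with them the signs, are unaffected.\<close>

lemma edge_nodes_shift:
  assumes "finite e" "1 \<le> r"
  shows "edge_nodes r ((+) (N * r) ` e) = map ((+) N) (edge_nodes r e)"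
  using assms by (simp add: edge_nodes_def sorted_list_of_set_shift)

context spin_model
begin

definition on_nodes :: "nat set \<Rightarrow> (nat set \<times> bool list) set \<Rightarrow> bool" where
  "on_nodes V Q \<longleftrightarrow> (\<forall>b\<in>Q. set (edge_nodes r (fst b)) \<subseteq> V)"

lemma ev_cong:
  assumes "\<And>i. i \<in> V \<Longrightarrow> x i = y i" "on_nodes V Q"
  shows "ev V Q x = ev V Q y"
proof -
  have "map x (edge_nodes r (fst b)) = map y (edge_nodes r (fst b))" if "b \<in> Q" for b
    using assms that by (auto simp: on_nodes_def)
  then have "good b x = good b y" if "b \<in> Q" for b using that unfolding good_def by presburger
  then show ?thesis using assms(1) unfolding ev_def by simp
qed

lemma mx_disjoint_union:
  assumes V: "finite V1" "finite V2" "V1 \<inter> V2 = {}"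
    and Q: "finite Q1" "finite Q2" "Q1 \<inter> Q2 = {}" "on_nodes V1 Q1" "on_nodes V2 Q2"
  shows "mx (V1 \<union> V2) (Q1 \<union> Q2) = mx V1 Q1 + mx V2 Q2"
proof (rule antisym)
  have ev: "ev (V1 \<union> V2) (Q1 \<union> Q2) x = ev V1 Q1 x + ev V2 Q2 x" for x
    using V Q by (simp add: ev_def sum.union_disjoint)
  have fin: "finite (V1 \<union> V2)" using V by simp
  show "mx (V1 \<union> V2) (Q1 \<union> Q2) \<le> mx V1 Q1 + mx V2 Q2"
  proof (rule mx_le[OF fin])
    fix x assume x: "x \<in> Xs (V1 \<union> V2)"
    have "ev V1 Q1 x = ev V1 Q1 (restrict x V1)" "ev V2 Q2 x = ev V2 Q2 (restrict x V2)"
      using Q by (auto intro!: ev_cong)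
    moreover have "restrict x V1 \<in> Xs V1" "restrict x V2 \<in> Xs V2" using x by (auto simp: Xs_def)
    ultimately show "ev (V1 \<union> V2) (Q1 \<union> Q2) x \<le> mx V1 Q1 + mx V2 Q2"
      unfolding ev using ev_le_mx[OF V(1)] ev_le_mx[OF V(2)] by (simp add: add_mono)
  qed
  obtain x1 where x1: "x1 \<in> Xs V1" "ev V1 Q1 x1 = mx V1 Q1" using mx_attained[OF V(1)] by blast
  obtain x2 where x2: "x2 \<in> Xs V2" "ev V2 Q2 x2 = mx V2 Q2" using mx_attained[OF V(2)] by blast
  define x where "x i = (if i \<in> V1 then x1 i else x2 i)" for i
  have "x \<in> Xs (V1 \<union> V2)" using x1 x2 unfolding Xs_def PiE_def extensional_def Pi_def x_def by auto
  then have "ev (V1 \<union> V2) (Q1 \<union> Q2) x \<le> mx (V1 \<union> V2) (Q1 \<union> Q2)" by (rule ev_le_mx[OF fin])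
  moreover have "ev V1 Q1 x = ev V1 Q1 x1" using Q by (intro ev_cong) (auto simp: x_def)
  moreover have "ev V2 Q2 x = ev V2 Q2 x2" using Q V by (intro ev_cong) (auto simp: x_def)
  ultimately show "mx V1 Q1 + mx V2 Q2 \<le> mx (V1 \<union> V2) (Q1 \<union> Q2)" using ev x1 x2 by simp
qed

lemma on_nodes_empty [simp]: "on_nodes V {}"
  by (simp add: on_nodes_def)

lemma Psi_disjoint_union:
  assumes "finite V1" "finite V2" "V1 \<inter> V2 = {}"
    and "finite Q1" "finite Q2" "Q1 \<inter> Q2 = {}" "on_nodes V1 Q1" "on_nodes V2 Q2"
  shows "Psi (V1 \<union> V2) (Q1 \<union> Q2) = Psi V1 Q1 + Psi V2 Q2"
  using mx_disjoint_union[OF assms] mx_disjoint_union[OF assms(1-3), of "{}" "{}"] by (simp add: Psi_def)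

lemma mx_shift:
  assumes Q: "finite Q" "\<And>b. b \<in> Q \<Longrightarrow> finite (fst b)" "on_nodes {..<N} Q"
  shows "mx {M..<M + N} (relabel ((+) (M * r)) Q) = mx {..<N} Q"
proof -
  let ?V = "{M..<M + N}" and ?R = "relabel ((+) (M * r)) Q"
  have inj: "inj_on (\<lambda>b :: nat set \<times> bool list. ((+) (M * r) ` fst b, snd b)) Q"
    by (auto simp: inj_on_def inj_image_eq_iff)
  have ev: "ev ?V ?R x = ev {..<N} Q (\<lambda>i. x (M + i))" for x
  proof -
    have "(\<Sum>i\<in>?V. \<nu> (x i)) = (\<Sum>i\<in>{..<N}. \<nu> (x (M + i)))"
      by (rule sum.reindex_bij_witness[of _ "\<lambda>i. M + i" "\<lambda>i. i - M"]) auto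
    moreover have "(\<Sum>b\<in>?R. good b x) = (\<Sum>b\<in>Q. good b (\<lambda>i. x (M + i)))"
      unfolding relabel_def sum.reindex[OF inj] o_def
    proof (intro sum.cong refl)
      fix b assume "b \<in> Q"
      then show "good ((+) (M * r) ` fst b, snd b) x = good b (\<lambda>i. x (M + i))"
        using Q(2) r_pos by (simp add: good_def edge_nodes_shift o_def)
    qed
    ultimately show ?thesis by (simp add: ev_def)
  qed
  show ?thesis
  proof (rule antisym)
    show "mx ?V ?R \<le> mx {..<N} Q"
    proof (rule mx_le)
      fix x assume x: "x \<in> Xs ?V"
      have "ev ?V ?R x = ev {..<N} Q (restrict (\<lambda>i. x (M + i)) {..<N})"
        unfolding ev using Q by (intro ev_cong) auto
      moreover have "restrict (\<lambda>i. x (M + i)) {..<N} \<in> Xs {..<N}" using x by (auto simp: Xs_def)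
      ultimately show "ev ?V ?R x \<le> mx {..<N} Q" using ev_le_mx[of "{..<N}"] by simp
    qed simp
    show "mx {..<N} Q \<le> mx ?V ?R"
    proof (rule mx_le)
      fix y assume y: "y \<in> Xs {..<N}"
      have "ev ?V ?R (restrict (\<lambda>i. y (i - M)) ?V) = ev {..<N} Q y"
        unfolding ev using Q by (intro ev_cong) auto
      moreover have "restrict (\<lambda>i. y (i - M)) ?V \<in> Xs ?V"
        unfolding Xs_def restrict_PiE_iff
      proof
        fix i assume "i \<in> ?V"
        then have "i - M \<in> {..<N}" by auto
        then show "y (i - M) \<in> {..<q}" using y unfolding Xs_def by (rule PiE_mem[rotated])
      qed
      then have "ev ?V ?R (restrict (\<lambda>i. y (i - M)) ?V) \<le> mx ?V ?R" by (intro ev_le_mx) auto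
      ultimately show "ev {..<N} Q y \<le> mx ?V ?R" by simp
    qed simp
  qed
qed

lemma relabel_empty [simp]: "relabel \<pi> {} = {}"
  by (simp add: relabel_def)

lemma Psi_shift:
  assumes "finite Q" "\<And>b. b \<in> Q \<Longrightarrow> finite (fst b)" "on_nodes {..<N} Q"
  shows "Psi {M..<M + N} (relabel ((+) (M * r)) Q) = Psi {..<N} Q"
  using mx_shift[OF assms, of M] mx_shift[of "{}" N M] by (simp add: Psi_def)

text \<open>Without blocks the nodes decouple; hence limits for \<open>Psi\<close> and for
  \<open>mx\<close> differ by a constant per node.\<close>

lemma mx_empty_linear: "mx {..<N} {} = real N * mx {..<1} {}"
proof (induction N)
  case 0
  show ?case using mx_attained[of "{}" "{}"] by (auto simp: ev_def)
next
  case (Suc N)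
  have "mx ({..<N} \<union> {N..<N + 1}) ({} \<union> {}) = mx {..<N} {} + mx {N..<N + 1} {}"
    by (rule mx_disjoint_union) auto
  moreover have "{..<N} \<union> {N..<N + 1} = {..<Suc N}" by auto
  moreover have "mx {N..<N + 1} {} = mx {..<1} {}" using mx_shift[of "{}" 1 N] by simp
  ultimately show ?case using Suc by (simp add: algebra_simps)
qed

lemma Bl_finite_fst: "b \<in> Bl F \<Longrightarrow> finite (fst b)"
  using BlD(2)[of b F] K_pos by (metis card.infinite not_one_le_zero)

lemma on_nodes_Bl:
  assumes "Q \<subseteq> Bl F" "\<And>p. p \<in> F \<Longrightarrow> p div r \<in> V"
  shows "on_nodes V Q"
  unfolding on_nodes_def
proof
  fix b assume "b \<in> Q"
  then have b: "b \<in> Bl F" using assms(1) by blast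
  show "set (edge_nodes r (fst b)) \<subseteq> V"
    using assms(2) BlD(1)[OF b] by (auto simp: set_edge_nodes[OF Bl_finite_fst[OF b]])
qed

section \<open>The mean gain: superadditivity and limit\<close>

definition mean_gain :: "nat \<Rightarrow> real" where
  "mean_gain N = EP {..<N * r} (Psi {..<N})"

lemma div_r_less: "p < N * r \<Longrightarrow> p div r < N"
  by (simp add: less_mult_imp_div_less)

text \<open>Identifies the left side of the interpolation inequality: two independent partitions on
  separate nodes give additive optima, and the second side is a translate of a graph on
  \<open>N2\<close> nodes.\<close>

lemma mean_gain_union:
  assumes "K dvd N1 * r" "K dvd N2 * r"
  shows "EP {..<N1 * r} (\<lambda>P1. EP {N1 * r..<(N1 + N2) * r} (\<lambda>P2. Psi {..<N1 + N2} (P1 \<union> P2))) = mean_gain N1 + mean_gain N2"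
proof -
  let ?S1 = "{..<N1 * r}" and ?S2 = "{N1 * r..<(N1 + N2) * r}" and ?V2 = "{N1..<N1 + N2}"
  obtain k1 where k1: "card ?S1 = K * k1" using assms(1) by (auto elim: dvdE)
  obtain k2 where k2: "card {..<N2 * r} = K * k2" using assms(2) by (auto elim: dvdE)
  have S2: "(+) (N1 * r) ` {..<N2 * r} = ?S2" by (simp add: lessThan_atLeast0 image_add_atLeastLessThan algebra_simps)
  have c2: "card ?S2 = K * k2" using k2 by (simp add: algebra_simps)
  have E2: "EP ?S2 (Psi ?V2) = mean_gain N2"
  proof -
    have "EP ?S2 (Psi ?V2) = EP {..<N2 * r} (\<lambda>Q. Psi ?V2 (relabel ((+) (N1 * r)) Q))"
      unfolding S2[symmetric] by (rule EP_relabel[OF _ k2]) auto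
    also have "\<dots> = mean_gain N2"
      unfolding mean_gain_def EP_def
    proof (rule avg_cong)
      fix Q :: "(nat set \<times> bool list) set" assume Q: "Q \<in> MPart {..<N2 * r}"
      show "Psi ?V2 (relabel ((+) (N1 * r)) Q) = Psi {..<N2} Q"
        using MPart_finite[OF Q] MPart_subset[OF Q] Bl_finite_fst on_nodes_Bl[OF MPart_subset[OF Q], of "{..<N2}"] div_r_less
        by (intro Psi_shift) auto
    qed
    finally show ?thesis .
  qed
  have split: "Psi {..<N1 + N2} (P1 \<union> P2) = Psi {..<N1} P1 + Psi ?V2 P2" if P: "P1 \<in> MPart ?S1" "P2 \<in> MPart ?S2" for P1 P2
  proof -
    have V: "{..<N1 + N2} = {..<N1} \<union> ?V2" by auto
    have "P1 \<inter> P2 = {}"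
    proof (rule equals0I)
      fix b assume "b \<in> P1 \<inter> P2"
      then have b: "b \<in> Bl ?S1" "b \<in> Bl ?S2" using MPart_subset[OF P(1)] MPart_subset[OF P(2)] by auto
      then have "fst b \<subseteq> {}" using BlD(1)[OF b(1)] BlD(1)[OF b(2)] by force
      then show False using Bl_fst_nonempty[OF b(1)] by simp
    qed
    moreover have "on_nodes {..<N1} P1" using div_r_less by (intro on_nodes_Bl[OF MPart_subset[OF P(1)]]) auto
    moreover have "on_nodes ?V2 P2"
    proof (rule on_nodes_Bl[OF MPart_subset[OF P(2)]])
      fix p assume "p \<in> ?S2"
      then show "p div r \<in> ?V2" using div_r_less[of p "N1 + N2"] r_pos by (auto simp: less_eq_div_iff_mult_less_eq)
    qed
    ultimately show ?thesis unfolding V using MPart_finite[OF P(1)] MPart_finite[OF P(2)]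
      by (intro Psi_disjoint_union) auto
  qed
  have "EP ?S1 (\<lambda>P1. EP ?S2 (\<lambda>P2. Psi {..<N1 + N2} (P1 \<union> P2))) = EP ?S1 (\<lambda>P1. Psi {..<N1} P1 + mean_gain N2)"
    unfolding EP_def[of ?S1]
  proof (rule avg_cong)
    fix P1 :: "(nat set \<times> bool list) set" assume P1: "P1 \<in> MPart ?S1"
    have "EP ?S2 (\<lambda>P2. Psi {..<N1 + N2} (P1 \<union> P2)) = EP ?S2 (\<lambda>P2. Psi {..<N1} P1 + Psi ?V2 P2)"
      unfolding EP_def using split[OF P1] by (intro avg_cong)
    also have "\<dots> = Psi {..<N1} P1 + mean_gain N2"
      using EP_const[OF _ c2] E2 unfolding EP_def avg_add by simp
    finally show "EP ?S2 (\<lambda>P2. Psi {..<N1 + N2} (P1 \<union> P2)) = Psi {..<N1} P1 + mean_gain N2" .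
  qed
  also have "\<dots> = mean_gain N1 + mean_gain N2"
    using EP_const[OF _ k1] unfolding mean_gain_def EP_def avg_add by simp
  finally show ?thesis .
qed

lemma mean_gain_0: "mean_gain 0 = 0"
  by (simp add: mean_gain_def Psi_def)

text \<open>Nodes without blocks do not change \<open>Psi\<close>, so both means concern one
  function on nested point sets. The number of extra blocks times K is r times the number of extra
  nodes.\<close>

lemma mean_gain_lipschitz:
  assumes "K dvd N * r" "K dvd N' * r" "N \<le> N'"
  shows "\<bar>mean_gain N' - mean_gain N\<bar> \<le> 3 * real r * real (N' - N)"
proof -
  let ?S = "{..<N' * r}" and ?U = "{..<N * r}"
  obtain k where k: "N * r = K * k" using assms(1) by (auto elim: dvdE)
  obtain k' where k': "N' * r = K * k'" using assms(2) by (auto elim: dvdE)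
  have "K * k \<le> K * k'" using assms(3) unfolding k[symmetric] k'[symmetric] by simp
  then have kk: "k \<le> k'" using K_pos by simp
  have sub: "?U \<subseteq> ?S" using assms(3) by auto
  have eq: "mean_gain N = EP ?U (Psi {..<N'})"
    unfolding mean_gain_def EP_def
  proof (rule avg_cong)
    fix P :: "(nat set \<times> bool list) set" assume P: "P \<in> MPart ?U"
    have V: "{..<N'} = {..<N} \<union> {N..<N'}" using assms(3) by auto
    have "on_nodes {..<N} P" using div_r_less by (intro on_nodes_Bl[OF MPart_subset[OF P]]) auto
    then have "Psi {..<N'} (P \<union> {}) = Psi {..<N} P + Psi {N..<N'} {}"
      unfolding V using MPart_finite[OF P] by (intro Psi_disjoint_union) auto
    then show "Psi {..<N} P = Psi {..<N'} P" by (simp add: Psi_def)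
  qed
  have "\<bar>EP ?U (Psi {..<N'}) - EP ?S (Psi {..<N'})\<bar> \<le> 3 * 1 * real K * real (k' - k)"
    using sub k k' kk Psi_lip[of "{..<N'}"] by (intro EP_subset[of ?S ?U k]) auto
  also have "3 * 1 * real K * real (k' - k) = 3 * real r * real (N' - N)"
  proof -
    have "K * (k' - k) = r * (N' - N)" using k k' by (simp add: diff_mult_distrib2 mult.commute)
    then have "real K * real (k' - k) = real r * real (N' - N)" by (metis of_nat_mult)
    then show ?thesis by simp
  qed
  finally show ?thesis unfolding eq by (simp add: mean_gain_def abs_minus_commute)
qed

text \<open>With probabilities proportional to the sizes, both sides are used up at the same
  relative rate, so neither is expected to run short before the other.\<close>

lemma mean_gain_superadditive_step:
  assumes N: "1 \<le> N1" "1 \<le> N2" and k: "K dvd N1 * r" "K dvd N2 * r" and T: "(N1 + N2) * r = K * (T + d)"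
    and m: "K \<le> m" and z: "1 \<le> z"
  defines "p1 \<equiv> real N1 / real (N1 + N2)" and "p2 \<equiv> real N2 / real (N1 + N2)"
  shows "mean_gain N1 + mean_gain N2 \<le> mean_gain (N1 + N2) + (1 + 3 * real K) * d + T * ((real K)\<^sup>2 / m
    + 2 * real (T + d) * (z ^ m * (p1 * z ^ K + p2) ^ T / z ^ (N1 * r) + z ^ m * (p1 + p2 * z ^ K) ^ T / z ^ (N2 * r)))"
proof -
  let ?S1 = "{..<N1 * r}" and ?S2 = "{N1 * r..<(N1 + N2) * r}"
  have un: "?S1 \<union> ?S2 = {..<(N1 + N2) * r}" by (auto simp: algebra_simps)
  interpret spin_sides K q r \<nu> bad ?S1 ?S2 p1 p2 "{..<N1 + N2}" m
  proof unfold_locales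
    show "?S1 \<inter> ?S2 = {}" by auto
    show "0 < p1" "0 < p2" using N by (auto simp: p1_def p2_def)
    show "p1 + p2 = 1" using N by (simp add: p1_def p2_def add_divide_distrib[symmetric])
    show "x div r \<in> {..<N1 + N2}" if "x \<in> ?S1 \<union> ?S2" for x
      using that div_r_less[of x "N1 + N2"] unfolding un by simp
  qed (use m in auto)
  have c: "card (?S1 \<union> ?S2) = K * (T + d)" unfolding un using T by simp
  have BB: "BB = real (T + d)" unfolding BB_def c using K_pos by simp
  have fr0: "fr {} \<inter> ?S1 = ?S1" "fr {} \<inter> ?S2 = ?S2" by (auto simp: fr_def)
  have c2: "card ?S2 = N2 * r" by (simp add: algebra_simps)
  have ov: "ovf z m T {} = z ^ m * (p1 * z ^ K + p2) ^ T / z ^ (N1 * r) + z ^ m * (p1 + p2 * z ^ K) ^ T / z ^ (N2 * r)"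
    unfolding ovf_def ZZ_def fr0 bb_def c2 by simp
  show ?thesis
    using interpolation_inequality[OF z c] unfolding mean_gain_union[OF k] un BB ov mean_gain_def[of "N1 + N2"] by (simp add: distrib_right)
qed

end

text \<open>The Chernoff computation. The expected use leaves 2m of the s points, so the linear
  terms in \<eta> sum to at most - \<eta> m; the quadratic term comes from exp y \<le> 1 + y + y^2
  for y at most 1.\<close>

lemma overflow_estimate:
  fixes \<eta> p1 p2 :: real and K m s T :: nat
  assumes p: "0 \<le> p1" "p1 + p2 = 1" and \<eta>: "0 \<le> \<eta>" "\<eta> * K \<le> 1" and T: "real T * K * p1 + 2 * real m \<le> real s"
  shows "exp \<eta> ^ m * (p1 * exp \<eta> ^ K + p2) ^ T / exp \<eta> ^ s \<le> exp (- \<eta> * m + K * \<eta>\<^sup>2 * s)"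
proof -
  have pw: "exp \<eta> ^ j = exp (\<eta> * real j)" for j by (simp add: exp_of_nat_mult[symmetric] mult.commute)
  define y where "y = \<eta> * K + (\<eta> * K)\<^sup>2"
  have "exp (\<eta> * K) \<le> 1 + y" using exp_bound[of "\<eta> * K"] \<eta> by (simp add: y_def)
  then have "p1 * exp (\<eta> * K) \<le> p1 * (1 + y)" using p by (intro mult_left_mono)
  then have "p1 * exp \<eta> ^ K + p2 \<le> 1 + p1 * y" using p by (simp add: pw algebra_simps)
  also have "\<dots> \<le> exp (p1 * y)" by (rule exp_ge_add_one_self)
  finally have b: "p1 * exp \<eta> ^ K + p2 \<le> exp (p1 * y)" .
  have "1 \<le> exp (\<eta> * K)" using \<eta> by simp
  then have "p1 * 1 \<le> p1 * exp (\<eta> * K)" using p by (intro mult_left_mono)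
  then have nn: "0 \<le> p1 * exp \<eta> ^ K + p2" using p by (simp add: pw)
  have "(p1 * exp \<eta> ^ K + p2) ^ T \<le> exp (p1 * y) ^ T" using b nn by (rule power_mono)
  also have "\<dots> = exp (T * (p1 * y))" by (simp add: exp_of_nat_mult[symmetric])
  finally have bT: "(p1 * exp \<eta> ^ K + p2) ^ T \<le> exp (T * (p1 * y))" .
  have "exp \<eta> ^ m * (p1 * exp \<eta> ^ K + p2) ^ T / exp \<eta> ^ s \<le> exp (\<eta> * m) * exp (T * (p1 * y)) / exp (\<eta> * s)"
    unfolding pw[of m] pw[of s] using bT by (intro divide_right_mono mult_left_mono) auto
  also have "\<dots> = exp (\<eta> * m + T * (p1 * y) - \<eta> * s)" by (simp add: exp_add exp_diff)
  also have "\<dots> \<le> exp (- \<eta> * m + K * \<eta>\<^sup>2 * s)"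
  proof -
    have "real T * K * p1 \<le> real s - 2 * real m" using T by simp
    then have "\<eta> * (real T * K * p1) \<le> \<eta> * (real s - 2 * real m)" using \<eta>(1) by (rule mult_left_mono)
    moreover have "K * \<eta>\<^sup>2 * (real T * K * p1) \<le> K * \<eta>\<^sup>2 * s" using T by (intro mult_left_mono) auto
    moreover have "T * (p1 * y) = \<eta> * (real T * K * p1) + K * \<eta>\<^sup>2 * (real T * K * p1)"
      by (simp add: y_def power2_eq_square algebra_simps)
    ultimately have "\<eta> * m + T * (p1 * y) - \<eta> * s \<le> - \<eta> * m + K * \<eta>\<^sup>2 * s" by (simp add: algebra_simps)
    then show ?thesis by simp
  qed
  finally show ?thesis .
qed

context spin_model
begin

text \<open>With \<eta> = n^(-1/2) the quadratic Chernoff term stays bounded, while \<eta> m is at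
  least n^(1/4) for m about n^(3/4). The shortage bound is therefore O(exp (- n^(1/4))), which
  absorbs the factor of order n^2 from the number of steps and the number of blocks.\<close>

lemma mean_gain_almost_superadditive:
  assumes k: "1 \<le> k"
  shows "\<exists>C n0. \<forall>n\<ge>n0. mean_gain (K * (k * n)) + mean_gain (K * n) - C * real n powr (3/4) \<le> mean_gain (K * (Suc k * n))"
proof -
  define L where "L = Suc k"
  \<comment> \<open>\<open>C0\<close> bounds the total cost of shortages, up to fixed
    factors.\<close>
  have "(\<lambda>n. real n ^ 2 * exp (- (real n powr (1/4)))) \<longlonglongrightarrow> 0" by real_asymp
  then have "Bseq (\<lambda>n. real n ^ 2 * exp (- (real n powr (1/4))))" by (intro convergent_imp_Bseq convergentI)
  then obtain C0 where C0: "0 < C0" "\<And>n. real n ^ 2 * exp (- (real n powr (1/4))) \<le> C0"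
    unfolding Bseq_def by (auto simp: abs_le_iff)
  have "filterlim (\<lambda>n. real n powr (3/4)) at_top sequentially" by real_asymp
  then have e1: "eventually (\<lambda>n. real K \<le> real n powr (3/4)) sequentially" by (simp add: filterlim_at_top)
  have "filterlim (\<lambda>n. real n powr (1/2)) at_top sequentially" by real_asymp
  then have e2: "eventually (\<lambda>n. real K \<le> real n powr (1/2)) sequentially" by (simp add: filterlim_at_top)
  have e3: "eventually (\<lambda>n. 4 * real n powr (3/4) \<le> real n) sequentially" by real_asymp
  have "eventually (\<lambda>n. real K \<le> real n powr (3/4) \<and> real K \<le> real n powr (1/2) \<and> 4 * real n powr (3/4) \<le> real n) sequentially"
    using e1 e2 e3 by (intro eventually_conj)
  then obtain n0 where n0: "\<And>n. n0 \<le> n \<Longrightarrow> real K \<le> real n powr (3/4) \<and> real K \<le> real n powr (1/2) \<and> 4 * real n powr (3/4) \<le> real n"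
    by (auto simp: eventually_sequentially)
  define X where "X = exp (real (K * K * k * r))"
  define C where "C = (1 + 3 * real K) * (4 * real L) + real L * real r * (real K)\<^sup>2 + 4 * (real L * real r)\<^sup>2 * X * C0"
  have "mean_gain (K * (k * n)) + mean_gain (K * n) - C * real n powr (3/4) \<le> mean_gain (K * (Suc k * n))" if n: "max 1 n0 \<le> n" for n
  proof -
    define w where "w = real n powr (3/4)"
    have n1: "1 \<le> real n" using n by simp
    have w: "real K \<le> w" "real K \<le> real n powr (1/2)" "4 * w \<le> real n" using n0[of n] n by (auto simp: w_def)
    have w1: "1 \<le> w" using K_ge_2 w(1) by linarith
    define m where "m = nat \<lceil>w\<rceil>"
    have m: "w \<le> real m" "real m \<le> 2 * w" using w1 unfolding m_def by linarith+
    have Km: "K \<le> m" using w(1) m(1) by linarith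
    \<comment> \<open>The smaller side has share 1 / L of the \<open>K * d\<close> leftover points,
      so this choice leaves at least 2m points on either side in expectation.\<close>
    define d where "d = 2 * m * L"
    have "2 * real m \<le> real n" using m w(3) by linarith
    also have "\<dots> \<le> real n * real r" using r_pos n1 by simp
    finally have mn: "2 * m \<le> n * r" by (metis of_nat_le_iff of_nat_mult of_nat_numeral)
    have dle: "d \<le> L * n * r" using mult_le_mono2[OF mn, of L] by (simp add: d_def mult_ac)
    define T where "T = L * n * r - d"
    have Td: "T + d = L * n * r" using dle by (simp add: T_def)
    define N1 N2 where "N1 = K * (k * n)" and "N2 = K * n"
    have N12: "N1 + N2 = K * (L * n)" by (simp add: N1_def N2_def L_def algebra_simps)
    have pos: "1 \<le> N1" "1 \<le> N2" using n k K_pos by (auto simp: N1_def N2_def)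
    \<comment> \<open>The reciprocal of the fluctuation scale: \<eta>^2 n = 1 keeps the quadratic
      term constant.\<close>
    define \<eta> where "\<eta> = real n powr (-1/2)"
    have \<eta>n: "\<eta> * real n powr (1/2) = 1" "\<eta>\<^sup>2 * real n = 1"
    proof -
      show "\<eta> * real n powr (1/2) = 1" unfolding \<eta>_def using n1 by (simp add: powr_add[symmetric])
      have "\<eta>\<^sup>2 = real n powr (-1)" unfolding \<eta>_def using n1 by (simp add: power2_eq_square powr_add[symmetric])
      then show "\<eta>\<^sup>2 * real n = 1" using n1 by (simp add: powr_minus)
    qed
    have \<eta>0: "0 \<le> \<eta>" by (simp add: \<eta>_def)
    have \<eta>K: "\<eta> * K \<le> 1" using mult_left_mono[OF w(2) \<eta>0] \<eta>n(1) by simp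
    have \<eta>m: "real n powr (1/4) \<le> \<eta> * m"
    proof -
      have "real n powr (1/4) = \<eta> * w" unfolding \<eta>_def w_def using n1 by (simp add: powr_add[symmetric])
      then show ?thesis using mult_left_mono[OF m(1) \<eta>0] by simp
    qed
    define p1 p2 where "p1 = real N1 / real (N1 + N2)" and "p2 = real N2 / real (N1 + N2)"
    have Lr: "0 < real L" by (simp add: L_def)
    have p1: "p1 * real L = real k" and p2: "p2 * real L = 1"
      unfolding p1_def p2_def N12 using n1 K_pos Lr by (simp_all add: N1_def N2_def)
    have pp: "0 \<le> p1" "0 \<le> p2" "p1 + p2 = 1"
      using pos by (auto simp: p1_def p2_def add_divide_distrib[symmetric])
    have TL: "real T = real L * (real n * real r - 2 * real m)"
      using Td by (simp add: d_def algebra_simps flip: of_nat_add of_nat_mult) (metis of_nat_add of_nat_mult of_nat_numeral mult.assoc mult.commute)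
    have tail: "exp \<eta> ^ m * (pa * exp \<eta> ^ K + pb) ^ T / exp \<eta> ^ s \<le> X * exp (- (real n powr (1/4)))"
      if pa: "0 \<le> pa" "pa + pb = 1" "pa * real L = real j" and j: "1 \<le> j" "j \<le> k" and s: "s = K * (j * n) * r" for pa pb j s
    proof -
      have "real T * K * pa = real K * (pa * real L) * (real n * real r - 2 * real m)" by (simp add: TL algebra_simps)
      also have "\<dots> = real s - 2 * real (K * j) * real m" by (simp add: pa(3) s algebra_simps)
      also have "\<dots> \<le> real s - 2 * 1 * real m"
      proof -
        have "1 \<le> K * j" using j K_pos by simp
        then have "1 * real m \<le> real (K * j) * real m" by (intro mult_right_mono) (simp_all flip: of_nat_mult)
        then show ?thesis by simp
      qed
      finally have "exp \<eta> ^ m * (pa * exp \<eta> ^ K + pb) ^ T / exp \<eta> ^ s \<le> exp (- \<eta> * m + K * \<eta>\<^sup>2 * s)"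
        using pa \<eta>0 \<eta>K by (intro overflow_estimate) auto
      also have "K * \<eta>\<^sup>2 * s = (\<eta>\<^sup>2 * real n) * real (K * K * j * r)" by (simp add: s algebra_simps)
      also have "\<dots> = real (K * K * j * r)" unfolding \<eta>n(2) by simp
      also have "exp (- \<eta> * m + real (K * K * j * r)) \<le> exp (- (real n powr (1/4)) + real (K * K * k * r))"
      proof -
        have "K * K * j * r \<le> K * K * k * r" using j by simp
        then have "real (K * K * j * r) \<le> real (K * K * k * r)" by (rule of_nat_mono)
        then show ?thesis using \<eta>m by simp
      qed
      also have "\<dots> = X * exp (- (real n powr (1/4)))" by (simp only: exp_add X_def mult.commute)
      finally show ?thesis .
    qed
    define E where "E = X * exp (- (real n powr (1/4)))"
    define E1 where "E1 = exp \<eta> ^ m * (p1 * exp \<eta> ^ K + p2) ^ T / exp \<eta> ^ (N1 * r)"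
    define E2 where "E2 = exp \<eta> ^ m * (p1 + p2 * exp \<eta> ^ K) ^ T / exp \<eta> ^ (N2 * r)"
    have t1: "E1 \<le> E"
      unfolding E_def E1_def by (rule tail[of p1 p2 k]) (use pp p1 k in \<open>auto simp: N1_def\<close>)
    have t2: "E2 \<le> E"
      unfolding E_def E2_def add.commute[of p1] by (rule tail[of p2 p1 1]) (use pp p2 k in \<open>auto simp: N2_def\<close>)
    have step: "mean_gain N1 + mean_gain N2 \<le> mean_gain (N1 + N2) + (1 + 3 * real K) * d + T * ((real K)\<^sup>2 / m
      + 2 * real (T + d) * (E1 + E2))"
      unfolding E1_def E2_def p1_def p2_def
    proof (rule mean_gain_superadditive_step[OF pos _ _ _ Km])
      show "K dvd N1 * r" "K dvd N2 * r" by (simp_all add: N1_def N2_def)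
      show "(N1 + N2) * r = K * (T + d)" unfolding N12 Td by (simp add: mult_ac)
      show "1 \<le> exp \<eta>" using \<eta>0 by simp
    qed
    have nnE: "0 \<le> E1" "0 \<le> E2" unfolding E1_def E2_def
      using pp by (auto intro!: add_nonneg_nonneg mult_nonneg_nonneg divide_nonneg_nonneg zero_le_power)
    have "T * ((real K)\<^sup>2 / m + 2 * real (T + d) * (E1 + E2))
       \<le> real (T + d) * ((real K)\<^sup>2 / w + 2 * real (T + d) * (E + E))"
    proof (intro mult_mono add_mono mult_left_mono divide_left_mono t1 t2)
      show "0 \<le> (real K)\<^sup>2 / m + 2 * real (T + d) * (E1 + E2)" using nnE by simp
    qed (use m w1 nnE in auto)
    also have "\<dots> = real L * real r * (real K)\<^sup>2 * (real n / w) + 4 * (real L * real r)\<^sup>2 * X * (real n ^ 2 * exp (- (real n powr (1/4))))"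
      unfolding Td E_def by (simp add: power2_eq_square field_simps)
    also have "\<dots> \<le> real L * real r * (real K)\<^sup>2 * w + 4 * (real L * real r)\<^sup>2 * X * (C0 * w)"
    proof (intro add_mono mult_left_mono)
      have "real n \<le> w * w"
      proof -
        have "real n powr 1 \<le> real n powr (3/2)" using n1 by (intro powr_mono) auto
        then show ?thesis using n1 by (simp add: w_def powr_add[symmetric])
      qed
      then show "real n / w \<le> w" using w1 by (simp add: divide_le_eq)
      have "C0 * 1 \<le> C0 * w" using C0 w1 by (intro mult_left_mono) auto
      then show "real n ^ 2 * exp (- (real n powr (1/4))) \<le> C0 * w" using C0(2)[of n] by linarith
    qed (auto simp: X_def)
    finally have err1: "T * ((real K)\<^sup>2 / m + 2 * real (T + d) * (E1 + E2))
       \<le> real L * real r * (real K)\<^sup>2 * w + 4 * (real L * real r)\<^sup>2 * X * (C0 * w)" .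
    have "real d = 2 * (real L * real m)" by (simp add: d_def)
    also have "\<dots> \<le> 2 * (real L * (2 * w))" using m(2) by (intro mult_left_mono) auto
    also have "\<dots> = 4 * real L * w" by simp
    finally have "real d \<le> 4 * real L * w" .
    then have err2: "(1 + 3 * real K) * d \<le> (1 + 3 * real K) * (4 * real L * w)" by (intro mult_left_mono) auto
    have "mean_gain N1 + mean_gain N2 \<le> mean_gain (N1 + N2) + C * w"
    proof -
      have Cw: "C * w = (1 + 3 * real K) * (4 * real L * w) + (real L * real r * (real K)\<^sup>2 * w + 4 * (real L * real r)\<^sup>2 * X * (C0 * w))"
        by (simp add: C_def algebra_simps)
      have comb: "a + b \<le> c + x + y \<Longrightarrow> y \<le> y' \<Longrightarrow> x \<le> x' \<Longrightarrow> t = x' + y' \<Longrightarrow> a + b \<le> c + t" for a b c x y x' y' t :: real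
        by linarith
      show ?thesis by (rule comb[OF step err1 err2 Cw])
    qed
    then show ?thesis unfolding N12 by (simp add: N1_def N2_def L_def w_def)
  qed
  then show ?thesis by blast
qed

text \<open>K may divide N r without dividing N. Such an N is compared with the largest multiple of
  K below it, at bounded cost by the Lipschitz property; rescaling from n to K n divides the limit
  by K.\<close>

lemma mean_gain_limit:
  "\<exists>l. \<forall>\<epsilon>>0. \<exists>N0. \<forall>N\<ge>N0. K dvd N * r \<longrightarrow> \<bar>mean_gain N - real N * l\<bar> \<le> \<epsilon> * real N"
proof -
  have "convergent (\<lambda>n. mean_gain (K * n) / real n)"
  proof (rule almost_superadditive_limit[where c = "3 * real r * real K"])
    fix m n :: nat assume "m \<le> n"
    then have "\<bar>mean_gain (K * n) - mean_gain (K * m)\<bar> \<le> 3 * real r * real (K * n - K * m)" by (intro mean_gain_lipschitz) auto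
    then show "\<bar>mean_gain (K * n) - mean_gain (K * m)\<bar> \<le> 3 * real r * real K * real (n - m)" by (simp add: diff_mult_distrib2[symmetric] mult.assoc)
  qed (use mean_gain_0 mean_gain_almost_superadditive in auto)
  then obtain l where l: "(\<lambda>n. mean_gain (K * n) / real n) \<longlonglongrightarrow> l" by (auto simp: convergent_def)
  show ?thesis
  proof (rule exI[of _ "l / K"], intro allI impI)
    fix \<epsilon> :: real assume \<epsilon>: "0 < \<epsilon>"
    obtain n0 where n0: "\<And>n. n0 \<le> n \<Longrightarrow> \<bar>mean_gain (K * n) / real n - l\<bar> < \<epsilon> / 2"
      using LIMSEQ_D[OF l, of "\<epsilon> / 2"] \<epsilon> by auto
    obtain N1 :: nat where N1: "(3 * real r * K + \<bar>l\<bar>) / (\<epsilon> / 2) < real N1" using reals_Archimedean2 by blast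
    show "\<exists>N0. \<forall>N\<ge>N0. K dvd N * r \<longrightarrow> \<bar>mean_gain N - real N * (l / K)\<bar> \<le> \<epsilon> * real N"
    proof (rule exI[of _ "max (K * Suc n0) N1"], intro allI impI)
      fix N assume N: "max (K * Suc n0) N1 \<le> N" and dv: "K dvd N * r"
      define n where "n = N div K"
      have "Suc n0 \<le> n" unfolding n_def using N K_pos by (simp add: less_eq_div_iff_mult_less_eq mult.commute)
      then have n: "n0 \<le> n" "0 < real n" by auto
      have nK: "K * n \<le> N" "N < K * n + K"
      proof -
        have "N = K * n + N mod K" by (simp add: n_def)
        moreover have "N mod K < K" using K_pos by simp
        ultimately show "K * n \<le> N" "N < K * n + K" by linarith+
      qed
      have a: "\<bar>mean_gain N - mean_gain (K * n)\<bar> \<le> 3 * real r * K"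
      proof -
        have "\<bar>mean_gain N - mean_gain (K * n)\<bar> \<le> 3 * real r * real (N - K * n)" using dv nK by (intro mean_gain_lipschitz) auto
        also have "\<dots> \<le> 3 * real r * real K" using nK by (intro mult_left_mono of_nat_mono) auto
        finally show ?thesis .
      qed
      have b: "\<bar>mean_gain (K * n) - real n * l\<bar> \<le> \<epsilon> / 2 * real N"
      proof -
        have "mean_gain (K * n) - real n * l = real n * (mean_gain (K * n) / real n - l)" using n by (simp add: field_simps)
        then have "\<bar>mean_gain (K * n) - real n * l\<bar> = real n * \<bar>mean_gain (K * n) / real n - l\<bar>" using n by (simp add: abs_mult)
        also have "\<dots> \<le> real n * (\<epsilon> / 2)" using n0[OF n(1)] by (intro mult_left_mono) auto
        also have "\<dots> \<le> real N * (\<epsilon> / 2)"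
        proof -
          have "1 * n \<le> K * n" using K_pos by (intro mult_le_mono1)
          then have "n \<le> N" using nK by linarith
          then show ?thesis using \<epsilon> by (intro mult_right_mono) auto
        qed
        finally show ?thesis by (simp add: mult.commute)
      qed
      have c: "\<bar>real n * l - real N * (l / K)\<bar> \<le> \<bar>l\<bar>"
      proof -
        have K0: "0 < real K" using K_pos by simp
        have "real n * l - real N * (l / K) = l * ((real (K * n) - real N) / K)" using K0 by (simp add: field_simps)
        then have "\<bar>real n * l - real N * (l / K)\<bar> = \<bar>l\<bar> * (\<bar>real (K * n) - real N\<bar> / K)" by (simp add: abs_mult)
        also have "\<dots> \<le> \<bar>l\<bar> * 1"
        proof (rule mult_left_mono)
          have "\<bar>real (K * n) - real N\<bar> \<le> real K" using nK by linarith
          then show "\<bar>real (K * n) - real N\<bar> / K \<le> 1" using K0 by simp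
        qed simp
        finally show ?thesis by simp
      qed
      have "3 * real r * K + \<bar>l\<bar> < real N1 * (\<epsilon> / 2)" using N1 \<epsilon> by (simp add: field_simps)
      also have "\<dots> \<le> real N * (\<epsilon> / 2)" using N \<epsilon> by (intro mult_right_mono) auto
      finally have s: "3 * real r * K + \<bar>l\<bar> < real N * (\<epsilon> / 2)" .
      have "\<bar>mean_gain N - real N * (l / K)\<bar> \<le> 3 * real r * K + \<epsilon> / 2 * real N + \<bar>l\<bar>" using a b c by linarith
      also have "\<dots> \<le> real N * (\<epsilon> / 2) + \<epsilon> / 2 * real N" using s by linarith
      finally show "\<bar>mean_gain N - real N * (l / K)\<bar> \<le> \<epsilon> * real N" by (simp add: mult.commute)
    qed
  qed
qed

text \<open>Chebyshev: half of \<epsilon> is spent on the mean and half on the fluctuation. The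
  variance is O(N) against a squared deviation of order N^2.\<close>

theorem mx_concentrates:
  "\<exists>h. \<forall>\<epsilon>>0. \<forall>\<delta>>0. \<exists>N0. \<forall>N\<ge>N0. K dvd N * r \<longrightarrow>
     real (card {Q \<in> MPart {..<N * r}. \<not> \<bar>mx {..<N} Q - real N * h\<bar> \<le> \<epsilon> * real N}) < \<delta> * real (card (MPart {..<N * r} :: (nat set \<times> bool list) set set))"
proof -
  obtain l where l: "\<And>\<epsilon>. 0 < \<epsilon> \<Longrightarrow> \<exists>N0. \<forall>N\<ge>N0. K dvd N * r \<longrightarrow> \<bar>mean_gain N - real N * l\<bar> \<le> \<epsilon> * real N"
    using mean_gain_limit by blast
  define D where "D = (2 * (real K + 1))\<^sup>2 * real r"
  show ?thesis
  proof (rule exI[of _ "l + mx {..<1} {}"], intro allI impI)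
    fix \<epsilon> \<delta> :: real assume \<epsilon>: "0 < \<epsilon>" and \<delta>: "0 < \<delta>"
    define e where "e = \<epsilon> / 2"
    have e: "0 < e" using \<epsilon> by (simp add: e_def)
    obtain N1 where N1: "\<And>N. N1 \<le> N \<Longrightarrow> K dvd N * r \<Longrightarrow> \<bar>mean_gain N - real N * l\<bar> \<le> e * real N" using l[OF e] by blast
    obtain N2 :: nat where N2: "D / (e\<^sup>2 * \<delta>) < real N2" using reals_Archimedean2 by blast
    show "\<exists>N0. \<forall>N\<ge>N0. K dvd N * r \<longrightarrow>
     real (card {Q \<in> MPart {..<N * r}. \<not> \<bar>mx {..<N} Q - real N * (l + mx {..<1} {})\<bar> \<le> \<epsilon> * real N}) < \<delta> * real (card (MPart {..<N * r} :: (nat set \<times> bool list) set set))"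
    proof (rule exI[of _ "max 1 (max N1 N2)"], intro allI impI)
      fix N assume N: "max 1 (max N1 N2) \<le> N" and dv: "K dvd N * r"
      let ?S = "{..<N * r}"
      let ?P = "MPart ?S :: (nat set \<times> bool list) set set"
      let ?B = "{Q \<in> ?P. \<not> \<bar>mx {..<N} Q - real N * (l + mx {..<1} {})\<bar> \<le> \<epsilon> * real N}"
      obtain n where n: "card ?S = K * n" using dv by (auto elim: dvdE)
      have Nr: "real N > 0" using N by simp
      have finP: "finite ?P" by simp
      have c0: "0 < real (card ?P)" using MPart_nonempty[OF _ n] finP by (simp add: card_gt_0_iff)
      have var: "EP ?S (\<lambda>Q. (Psi {..<N} Q - mean_gain N)\<^sup>2) \<le> n * (2 * 1 * (real K + 1))\<^sup>2"
        using EP_variance[OF _ n, of 1 "Psi {..<N}"] Psi_lip[of "{..<N}"] unfolding mean_gain_def by (simp add: add.commute)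
      have "(\<Sum>Q\<in>?B. (e * real N)\<^sup>2) \<le> (\<Sum>Q\<in>?P. (Psi {..<N} Q - mean_gain N)\<^sup>2)"
      proof -
        have "(e * real N)\<^sup>2 \<le> (Psi {..<N} Q - mean_gain N)\<^sup>2" if "Q \<in> ?B" for Q
        proof -
          have "\<epsilon> * real N < \<bar>mx {..<N} Q - real N * (l + mx {..<1} {})\<bar>" using that by auto
          also have "mx {..<N} Q - real N * (l + mx {..<1} {}) = (Psi {..<N} Q - mean_gain N) + (mean_gain N - real N * l)"
            unfolding Psi_def mx_empty_linear[of N] by (simp add: algebra_simps)
          also have "\<bar>\<dots>\<bar> \<le> \<bar>Psi {..<N} Q - mean_gain N\<bar> + e * real N" using N1[of N] N dv by (intro order_trans[OF abs_triangle_ineq]) auto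
          finally have "e * real N \<le> \<bar>Psi {..<N} Q - mean_gain N\<bar>" by (simp add: e_def)
          then show ?thesis using e Nr by (metis abs_le_square_iff abs_of_pos mult_pos_pos)
        qed
        then have "(\<Sum>Q\<in>?B. (e * real N)\<^sup>2) \<le> (\<Sum>Q\<in>?B. (Psi {..<N} Q - mean_gain N)\<^sup>2)" by (rule sum_mono)
        also have "\<dots> \<le> (\<Sum>Q\<in>?P. (Psi {..<N} Q - mean_gain N)\<^sup>2)" using finP by (intro sum_mono2) auto
        finally show ?thesis .
      qed
      also have "\<dots> = EP ?S (\<lambda>Q. (Psi {..<N} Q - mean_gain N)\<^sup>2) * card ?P" using c0 by (simp add: EP_def avg_def)
      also have "\<dots> \<le> (n * (2 * 1 * (real K + 1))\<^sup>2) * card ?P" using var by (intro mult_right_mono) auto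
      also have "\<dots> \<le> (D * N) * card ?P"
      proof (rule mult_right_mono)
        have "1 * n \<le> K * n" using K_pos by (intro mult_le_mono1)
        then have "n \<le> N * r" using n by simp
        then have "real n \<le> real N * real r" by (metis of_nat_le_iff of_nat_mult)
        then have "real n * (2 * (real K + 1))\<^sup>2 \<le> real N * real r * (2 * (real K + 1))\<^sup>2" by (intro mult_right_mono) auto
        then show "n * (2 * 1 * (real K + 1))\<^sup>2 \<le> D * N" by (simp add: D_def mult_ac)
      qed simp
      also have "\<dots> < (\<delta> * (e * real N)\<^sup>2) * card ?P"
      proof (rule mult_strict_right_mono)
        have "D < real N2 * (e\<^sup>2 * \<delta>)" using N2 e \<delta> by (simp add: pos_divide_less_eq)
        also have "\<dots> \<le> real N * (e\<^sup>2 * \<delta>)" using N e \<delta> by (intro mult_right_mono) auto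
        finally have "D * N < real N * (e\<^sup>2 * \<delta>) * N" using Nr by (rule mult_strict_right_mono)
        then show "D * real N < \<delta> * (e * real N)\<^sup>2" by (simp add: power2_eq_square mult_ac)
      qed (rule c0)
      finally have "real (card ?B) * (e * real N)\<^sup>2 < (\<delta> * card ?P) * (e * real N)\<^sup>2" by (simp add: mult_ac)
      then show "real (card ?B) < \<delta> * card ?P" by (rule mult_right_less_imp_less) simp
    qed
  qed
qed

end

section \<open>The configuration model\<close>

text \<open>The graph of the sign function turns a sampled pair into the single set of marked blocks
  used so far.\<close>

definition mark_graph :: "nat set set \<Rightarrow> (nat set \<Rightarrow> bool list) \<Rightarrow> (nat set \<times> bool list) set" where
  "mark_graph P a = (\<lambda>B. (B, a B)) ` P"

lemma fst_mark_graph [simp]: "fst ` mark_graph P a = P"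
  unfolding mark_graph_def image_image by simp

lemma mark_graphI: "B \<in> P \<Longrightarrow> (B, a B) \<in> mark_graph P a"
  unfolding mark_graph_def by (rule imageI)

lemma mark_graphE:
  assumes "b \<in> mark_graph P a"
  obtains B where "B \<in> P" "b = (B, a B)"
  using assms unfolding mark_graph_def by blast

lemma mark_graph_inj: "inj_on (mark_graph P) (PiE P X)"
proof (rule inj_onI)
  fix a b assume a: "a \<in> PiE P X" "b \<in> PiE P X" "mark_graph P a = mark_graph P b"
  show "a = b"
  proof (rule PiE_ext[OF a(1,2)])
    fix B assume "B \<in> P"
    then have "(B, a B) \<in> mark_graph P b" unfolding a(3)[symmetric] by (simp add: mark_graph_def)
    then show "a B = b B" by (auto simp: mark_graph_def)
  qed
qed

lemma finite_config_partitions: "finite (config_partitions N r K)"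
  by (rule finite_subset[of _ "Pow (Pow {..<N * r})"]) (auto simp: config_partitions_def)

lemma config_partitions_finite: "P \<in> config_partitions N r K \<Longrightarrow> finite P"
  by (rule finite_subset[of _ "Pow {..<N * r}"]) (auto simp: config_partitions_def)

context spin_model
begin

lemma mark_graph_in_MPart:
  assumes P: "P \<in> config_partitions N r K" and a: "a \<in> PiE P (\<lambda>_. marks K)"
  shows "mark_graph P a \<in> MPart {..<N * r}"
proof -
  have "mark_graph P a \<subseteq> Bl {..<N * r}"
    using P PiE_mem[OF a] by (auto simp: mark_graph_def Bl_def config_partitions_def)
  moreover have "\<exists>!b. b \<in> mark_graph P a \<and> p \<in> fst b" if "p \<in> {..<N * r}" for p
  proof -
    have "\<exists>!B. B \<in> P \<and> p \<in> B" using P that by (simp add: config_partitions_def)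
    then obtain B where B: "B \<in> P" "p \<in> B" "\<And>B'. B' \<in> P \<Longrightarrow> p \<in> B' \<Longrightarrow> B' = B" by blast
    show ?thesis
    proof (rule ex1I[of _ "(B, a B)"])
      show "(B, a B) \<in> mark_graph P a \<and> p \<in> fst (B, a B)" using B(1,2) mark_graphI by simp
      fix b assume "b \<in> mark_graph P a \<and> p \<in> fst b"
      then obtain B' where B': "B' \<in> P" "b = (B', a B')" "p \<in> B'" using mark_graphE[of b P a] by (metis fst_conv)
      then have "B' = B" by (intro B(3))
      then show "b = (B, a B)" using B'(2) by simp
    qed
  qed
  ultimately show ?thesis by (simp add: MPart_def)
qed

lemma MPart_as_mark_graph:
  assumes Q: "Q \<in> MPart {..<N * r}"
  shows "\<exists>P\<in>config_partitions N r K. Q \<in> mark_graph P ` PiE P (\<lambda>_. marks K)"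
proof -
  have inj: "inj_on fst Q"
  proof (rule inj_onI, rule ccontr)
    fix b b' assume b: "b \<in> Q" "b' \<in> Q" "fst b = fst b'" "b \<noteq> b'"
    then have "fst b = {}" using MPart_disjoint[OF Q b(1,2,4)] by simp
    then show False using Bl_fst_nonempty[OF subsetD[OF MPart_subset[OF Q] b(1)]] by simp
  qed
  define P where "P = fst ` Q"
  define a where "a = restrict (\<lambda>B. snd (the_inv_into Q fst B)) P"
  have inv: "the_inv_into Q fst (fst b) = b" if "b \<in> Q" for b by (rule the_inv_into_f_f[OF inj that])
  have ab: "a (fst b) = snd b" if "b \<in> Q" for b using that inv[OF that] by (auto simp: a_def P_def)
  have "mark_graph P a = (\<lambda>b. (fst b, a (fst b))) ` Q" by (simp add: mark_graph_def P_def image_image)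
  also have "\<dots> = id ` Q" using ab by (intro image_cong) auto
  finally have g: "mark_graph P a = Q" by simp
  have "a \<in> PiE P (\<lambda>_. marks K)"
  proof (rule PiE_I)
    fix B assume "B \<in> P"
    then obtain b where "b \<in> Q" "B = fst b" by (auto simp: P_def)
    then show "a B \<in> marks K" using ab BlD(3)[OF subsetD[OF MPart_subset[OF Q]]] by simp
  qed (simp add: a_def)
  moreover have "P \<in> config_partitions N r K"
  proof -
    have "B \<subseteq> {..<N * r} \<and> card B = K" if "B \<in> P" for B
      using that BlD(1,2) MPart_subset[OF Q] unfolding P_def by blast
    moreover have "\<exists>!B. B \<in> P \<and> p \<in> B" if "p < N * r" for p
    proof -
      have e: "\<exists>!b. b \<in> Q \<and> p \<in> fst b" using MPart_ex1[OF Q] that by simp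
      then obtain b where b: "b \<in> Q" "p \<in> fst b" by blast
      show ?thesis
      proof (rule ex1I[of _ "fst b"])
        show "fst b \<in> P \<and> p \<in> fst b" using b by (simp add: P_def)
        fix B assume "B \<in> P \<and> p \<in> B"
        then obtain b' where "b' \<in> Q" "B = fst b'" "p \<in> fst b'" by (auto simp: P_def)
        then show "B = fst b" using e b by blast
      qed
    qed
    ultimately show ?thesis by (simp add: config_partitions_def)
  qed
  ultimately show ?thesis using g by blast
qed

lemma MPart_UN: "MPart {..<N * r} = (\<Union>P\<in>config_partitions N r K. mark_graph P ` PiE P (\<lambda>_. marks K))"
proof
  show "MPart {..<N * r} \<subseteq> (\<Union>P\<in>config_partitions N r K. mark_graph P ` PiE P (\<lambda>_. marks K))"
    using MPart_as_mark_graph by (intro subsetI UN_iff[THEN iffD2])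
  show "(\<Union>P\<in>config_partitions N r K. mark_graph P ` PiE P (\<lambda>_. marks K)) \<subseteq> MPart {..<N * r}"
    by (intro UN_least image_subsetI mark_graph_in_MPart)
qed

lemma PiE_marks: "finite P \<Longrightarrow> finite (PiE P (\<lambda>_. marks K))" "PiE P (\<lambda>_. marks K) \<noteq> {}"
proof -
  show "finite P \<Longrightarrow> finite (PiE P (\<lambda>_. marks K))" by (rule finite_PiE) (simp_all add: finite_marks)
  show "PiE P (\<lambda>_. marks K) \<noteq> {}" unfolding PiE_eq_empty_iff using A_nonempty by simp
qed

lemma card_config_partition:
  assumes "P \<in> config_partitions N r K"
  shows "N * r = K * card P"
proof -
  obtain a where a: "a \<in> PiE P (\<lambda>_. marks K)" using PiE_marks(2)[of P] by (meson ex_in_conv)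
  have "card (mark_graph P a) = card P"
    unfolding mark_graph_def by (intro card_image) (simp add: inj_on_def)
  then show ?thesis using card_MPart_element[OF mark_graph_in_MPart[OF assms a]] by simp
qed

lemma config_partitions_nonempty:
  assumes "K dvd N * r"
  shows "config_partitions N r K \<noteq> {}"
proof -
  obtain n where "card {..<N * r} = K * n" using assms by (auto elim: dvdE)
  then obtain Q :: "(nat set \<times> bool list) set" where "Q \<in> MPart {..<N * r}" using MPart_nonempty[of "{..<N * r}" n] by auto
  then show ?thesis using MPart_as_mark_graph by blast
qed

text \<open>Every partition has the same number of blocks and so admits equally many sign functions;
  hence choosing the partition and then the signs is uniform on marked partitions.\<close>

lemma map_random_hypergraph:
  assumes dv: "K dvd N * r"
  shows "map_pmf (\<lambda>G. mark_graph (fst G) (snd G)) (random_hypergraph K N r) = pmf_of_set (MPart {..<N * r})"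
proof -
  obtain n where n: "N * r = K * n" using dv by (auto elim: dvdE)
  let ?C = "config_partitions N r K"
  let ?f = "\<lambda>P. mark_graph P ` PiE P (\<lambda>_. marks K)"
  have "pmf_of_set (\<Union>(?f ` ?C)) = bind_pmf (pmf_of_set ?C) (\<lambda>P. pmf_of_set (?f P))"
  proof (rule pmf_of_set_UN)
    show "finite (\<Union>(?f ` ?C))" unfolding MPart_UN[symmetric] by simp
    show "?C \<noteq> {}" by (rule config_partitions_nonempty[OF dv])
    show "?f P \<noteq> {}" for P using PiE_marks(2) by simp
    show "card (?f P) = (2 ^ K) ^ n" if "P \<in> ?C" for P
    proof -
      have "K * card P = K * n" using card_config_partition[OF that] n by (rule subst)
      then have "card P = n" using K_pos by simp
      then show ?thesis using config_partitions_finite[OF that]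
        by (simp add: card_image[OF mark_graph_inj] card_PiE card_marks)
    qed
    show "disjoint_family_on ?f ?C"
      unfolding disjoint_family_on_def
    proof (intro ballI impI equals0I)
      fix P P' Q assume "P \<in> ?C" "P' \<in> ?C" "P \<noteq> P'" "Q \<in> ?f P \<inter> ?f P'"
      then obtain a a' where Q: "Q = mark_graph P a" "Q = mark_graph P' a'" by auto
      have "fst ` Q = P" unfolding Q(1) by simp
      moreover have "fst ` Q = P'" unfolding Q(2) by simp
      ultimately show False using \<open>P \<noteq> P'\<close> by simp
    qed
  qed
  also have "\<dots> = bind_pmf (pmf_of_set ?C) (\<lambda>P. map_pmf (mark_graph P) (pmf_of_set (PiE P (\<lambda>_. marks K))))"
  proof (rule bind_pmf_cong[OF refl])
    fix P assume "P \<in> set_pmf (pmf_of_set ?C)"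
    then have "P \<in> ?C" using finite_config_partitions config_partitions_nonempty[OF dv] by simp
    then have "finite P" by (rule config_partitions_finite)
    then show "pmf_of_set (?f P) = map_pmf (mark_graph P) (pmf_of_set (PiE P (\<lambda>_. marks K)))"
      by (intro map_pmf_of_set_inj[symmetric] mark_graph_inj PiE_marks)
  qed
  finally show ?thesis
    unfolding MPart_UN random_hypergraph_def
    by (simp add: map_bind_pmf map_pmf_def bind_assoc_pmf bind_return_pmf)
qed

lemma set_random_hypergraph:
  assumes "K dvd N * r" and G: "G \<in> set_pmf (random_hypergraph K N r)"
  shows "fst G \<in> config_partitions N r K" "snd G \<in> PiE (fst G) (\<lambda>_. marks K)"
proof -
  obtain P a where "P \<in> set_pmf (pmf_of_set (config_partitions N r K))" "a \<in> set_pmf (pmf_of_set (PiE P (\<lambda>_. marks K)))" "G = (P, a)"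
    using G by (auto simp: random_hypergraph_def)
  moreover from this have P: "P \<in> config_partitions N r K"
    using finite_config_partitions config_partitions_nonempty[OF assms(1)] by simp
  moreover have "set_pmf (pmf_of_set (PiE P (\<lambda>_. marks K))) = PiE P (\<lambda>_. marks K)"
    using PiE_marks(1)[OF config_partitions_finite[OF P]] PiE_marks(2) by (intro set_pmf_of_set)
  ultimately show "fst G \<in> config_partitions N r K" "snd G \<in> PiE (fst G) (\<lambda>_. marks K)" by auto
qed

text \<open>The number of blocks is N r / K on every sample, so an affine relation between
  \<open>H_graph\<close> and \<open>mx\<close> shifts the limit by the constant
  \<open>base * r / K\<close> and scales it by \<open>c\<close>.\<close>

lemma in_probability_limit:
  fixes c base :: real
  assumes c: "0 < c"
    and link: "\<And>N P a. P \<in> config_partitions N r K \<Longrightarrow> a \<in> PiE P (\<lambda>_. marks K) \<Longrightarrow>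
      H_graph M N r (P, a) = ereal (c * mx {..<N} (mark_graph P a) + base * real (card P))"
  shows "\<exists>h :: real. \<forall>\<epsilon>>0. \<forall>\<delta>>0. \<exists>N0. \<forall>N\<ge>N0. K dvd N * r \<longrightarrow>
           measure_pmf.prob (random_hypergraph K N r)
             {G. \<not> (ereal (real N * (h - \<epsilon>)) \<le> H_graph M N r G
                    \<and> H_graph M N r G \<le> ereal (real N * (h + \<epsilon>)))} < \<delta>"
proof -
  obtain h where h: "\<And>\<epsilon> \<delta>. 0 < \<epsilon> \<Longrightarrow> 0 < \<delta> \<Longrightarrow> \<exists>N0. \<forall>N\<ge>N0. K dvd N * r \<longrightarrow>
     real (card {Q \<in> MPart {..<N * r}. \<not> \<bar>mx {..<N} Q - real N * h\<bar> \<le> \<epsilon> * real N}) < \<delta> * real (card (MPart {..<N * r} :: (nat set \<times> bool list) set set))"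
    using mx_concentrates by blast
  define h' where "h' = c * h + base * real r / real K"
  show ?thesis
  proof (rule exI[of _ h'], intro allI impI)
    fix \<epsilon> \<delta> :: real assume \<epsilon>: "0 < \<epsilon>" and \<delta>: "0 < \<delta>"
    have "0 < \<epsilon> / c" using \<epsilon> c by simp
    from h[OF this \<delta>] obtain N0 where N0: "\<And>N. N0 \<le> N \<Longrightarrow> K dvd N * r \<Longrightarrow>
     real (card {Q \<in> MPart {..<N * r}. \<not> \<bar>mx {..<N} Q - real N * h\<bar> \<le> \<epsilon> / c * real N}) < \<delta> * real (card (MPart {..<N * r} :: (nat set \<times> bool list) set set))"
      by blast
    show "\<exists>N0. \<forall>N\<ge>N0. K dvd N * r \<longrightarrow>
           measure_pmf.prob (random_hypergraph K N r)
             {G. \<not> (ereal (real N * (h' - \<epsilon>)) \<le> H_graph M N r G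
                    \<and> H_graph M N r G \<le> ereal (real N * (h' + \<epsilon>)))} < \<delta>"
    proof (rule exI[of _ N0], intro allI impI)
      fix N assume N: "N0 \<le> N" and dv: "K dvd N * r"
      let ?p = "random_hypergraph K N r"
      let ?E = "{G. \<not> (ereal (real N * (h' - \<epsilon>)) \<le> H_graph M N r G \<and> H_graph M N r G \<le> ereal (real N * (h' + \<epsilon>)))}"
      let ?B = "{Q. \<not> \<bar>mx {..<N} Q - real N * h\<bar> \<le> \<epsilon> / c * real N}"
      let ?g = "\<lambda>G. mark_graph (fst G) (snd G)"
      let ?P = "MPart {..<N * r} :: (nat set \<times> bool list) set set"
      \<comment> \<open>\<open>link\<close> speaks only of genuine configurations, so the event is
        first cut down to the support.\<close>
      have sub: "?E \<inter> set_pmf ?p \<subseteq> ?g -` ?B"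
      proof
        fix G assume G: "G \<in> ?E \<inter> set_pmf ?p"
        have P: "fst G \<in> config_partitions N r K" "snd G \<in> PiE (fst G) (\<lambda>_. marks K)"
          using set_random_hypergraph[OF dv] G by auto
        define x where "x = mx {..<N} (?g G)"
        have "real N * real r = real K * real (card (fst G))" using card_config_partition[OF P(1)] by (metis of_nat_mult)
        then have cP: "real (card (fst G)) = real N * real r / real K" using K_pos by (simp add: field_simps)
        have H: "H_graph M N r G = ereal (c * x + base * (real N * real r / real K))"
          using link[OF P] cP by (simp add: x_def)
        show "G \<in> ?g -` ?B"
        proof (rule ccontr)
          assume "G \<notin> ?g -` ?B"
          then have "\<bar>x - real N * h\<bar> \<le> \<epsilon> / c * real N" by (simp add: x_def)
          then have "c * \<bar>x - real N * h\<bar> \<le> c * (\<epsilon> / c * real N)" using c by (intro mult_left_mono) auto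
          also have "c * (\<epsilon> / c * real N) = \<epsilon> * real N" using c by simp
          also have "c * \<bar>x - real N * h\<bar> = \<bar>c * x - real N * (c * h)\<bar>"
          proof -
            have "c * x - real N * (c * h) = c * (x - real N * h)" by (simp add: algebra_simps)
            then show ?thesis using c by (simp add: abs_mult)
          qed
          finally have "\<bar>c * x - real N * (c * h)\<bar> \<le> \<epsilon> * real N" .
          moreover have "real N * h' = real N * (c * h) + base * (real N * real r / real K)"
            by (simp add: h'_def distrib_left mult_ac)
          ultimately have "real N * (h' - \<epsilon>) \<le> c * x + base * (real N * real r / real K)"
            "c * x + base * (real N * real r / real K) \<le> real N * (h' + \<epsilon>)"
            unfolding right_diff_distrib distrib_left by (simp_all add: abs_le_iff mult.commute)
          then have "G \<notin> ?E" unfolding H mem_Collect_eq by (simp only: ereal_less_eq(3) simp_thms)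
          then show False using G by blast
        qed
      qed
      have ne: "?P \<noteq> {}" using dv MPart_nonempty[of "{..<N * r}"] by (auto elim: dvdE)
      have c0: "0 < real (card ?P)" using ne by (simp add: card_gt_0_iff)
      have "measure_pmf.prob ?p ?E = measure_pmf.prob ?p (?E \<inter> set_pmf ?p)" by (rule measure_Int_set_pmf[symmetric])
      also have "\<dots> \<le> measure_pmf.prob ?p (?g -` ?B)" using sub by (intro measure_pmf.finite_measure_mono) auto
      also have "\<dots> = measure_pmf.prob (map_pmf ?g ?p) ?B" by simp
      also have "\<dots> = measure_pmf.prob (pmf_of_set ?P) ?B" by (simp only: map_random_hypergraph[OF dv])
      also have "\<dots> = real (card (?P \<inter> ?B)) / real (card ?P)" using ne by (intro measure_pmf_of_set) auto
      also have "?P \<inter> ?B = {Q \<in> ?P. \<not> \<bar>mx {..<N} Q - real N * h\<bar> \<le> \<epsilon> / c * real N}" by blast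
      also have "real (card \<dots>) / real (card ?P) < \<delta>" using N0[OF N dv] c0 by (simp add: pos_divide_less_eq)
      finally show "measure_pmf.prob ?p ?E < \<delta>" .
    qed
  qed
qed

lemma ev_mark_graph:
  "ev V (mark_graph P a) x = (\<Sum>i\<in>V. \<nu> (x i)) + (\<Sum>B\<in>P. of_bool (\<not> bad (a B) (map x (edge_nodes r B))))"
proof -
  have "inj_on (\<lambda>B. (B, a B)) P" by (simp add: inj_on_def)
  then show ?thesis by (simp add: ev_def mark_graph_def sum.reindex good_def)
qed

lemma config_edge_length:
  assumes "P \<in> config_partitions N r K" "B \<in> P"
  shows "length (edge_nodes r B) = K" "set (edge_nodes r B) \<subseteq> {..<N}"
proof -
  have B: "B \<subseteq> {..<N * r}" "card B = K" using assms by (auto simp: config_partitions_def)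
  then have "finite B" using finite_subset by blast
  then show "length (edge_nodes r B) = K" "set (edge_nodes r B) \<subseteq> {..<N}"
    using B div_r_less by (auto simp: length_edge_nodes set_edge_nodes)
qed

text \<open>An edge potential with two values is normalised: the lower value \<open>base\<close> is
  taken out of every edge and the gap \<open>c\<close> is scaled to 1.\<close>

lemma H_graph_finite_potentials:
  fixes c base :: real
  assumes M: "mq M = q" and node: "\<And>s. s < q \<Longrightarrow> node_pot M s = ereal (c * \<nu> s)"
    and edge: "\<And>a xs. length a = K \<Longrightarrow> length xs = K \<Longrightarrow> edge_pot M a xs = ereal (base + c * of_bool (\<not> bad a xs))"
    and c: "0 < c" and P: "P \<in> config_partitions N r K" and a: "a \<in> PiE P (\<lambda>_. marks K)"
  shows "H_graph M N r (P, a) = ereal (c * mx {..<N} (mark_graph P a) + base * real (card P))"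
proof -
  let ?Q = "mark_graph P a"
  have H: "H_config M N r P a x = ereal (c * ev {..<N} ?Q x + base * real (card P))" if x: "x \<in> Xs {..<N}" for x
  proof -
    have "(\<Sum>i<N. node_pot M (x i)) = (\<Sum>i<N. ereal (c * \<nu> (x i)))"
      using PiE_mem[OF x[unfolded Xs_def]] by (intro sum.cong refl node) auto
    moreover have "(\<Sum>B\<in>P. edge_pot M (a B) (map x (edge_nodes r B)))
      = (\<Sum>B\<in>P. ereal (base + c * of_bool (\<not> bad (a B) (map x (edge_nodes r B)))))"
      using PiE_mem[OF a] config_edge_length(1)[OF P] by (intro sum.cong refl edge) auto
    ultimately show ?thesis
      unfolding H_config_def ev_mark_graph by (simp add: sum.distrib sum_distrib_left algebra_simps)
  qed
  have X: "PiE {..<N} (\<lambda>_. {..<mq M}) = Xs {..<N}" by (simp add: Xs_def M)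
  obtain x where x: "x \<in> Xs {..<N}" "ev {..<N} ?Q x = mx {..<N} ?Q" using mx_attained[of "{..<N}"] by blast
  show ?thesis
    unfolding H_graph_def X fst_conv snd_conv
  proof (rule Max_eqI)
    show "finite (H_config M N r P a ` Xs {..<N})" by (simp add: finite_Xs)
    show "ereal (c * mx {..<N} ?Q + base * real (card P)) \<in> H_config M N r P a ` Xs {..<N}"
      using H[OF x(1)] x by (metis image_eqI)
    fix y assume "y \<in> H_config M N r P a ` Xs {..<N}"
    then obtain x' where x': "x' \<in> Xs {..<N}" "y = H_config M N r P a x'" by blast
    have "c * ev {..<N} ?Q x' \<le> c * mx {..<N} ?Q" using ev_le_mx[OF _ x'(1)] c by (intro mult_left_mono) auto
    then show "y \<le> ereal (c * mx {..<N} ?Q + base * real (card P))" using H[OF x'(1)] x'(2) by simp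
  qed
qed

end

section \<open>The six models\<close>

lemma card_marks_const: "card {a \<in> marks K. C} = 2 ^ K * of_bool C"
  using card_marks[of K] by (cases C) auto

lemma length_2_cases: "length e = 2 \<Longrightarrow> \<exists>i j. e = [i, j]"
  by (auto simp: numeral_2_eq_2 length_Suc_conv)

text \<open>Shared by MAX-CUT, Ising and Coloring. An edge is always bad if all near-optimal
  assignments agree at its ends, an equivalence relation. Marks have no influence, so all of them
  count or none.\<close>

lemma spin_model_equal_pair:
  assumes "1 \<le> q" "1 \<le> r"
  shows "spin_model 2 q r (\<lambda>a xs. xs ! 0 = xs ! 1)"
proof
  fix X :: "(nat \<Rightarrow> nat) set" and V :: "nat set"
  define R where "R i j \<longleftrightarrow> (\<forall>x\<in>X. x i = x j)" for i j
  have "symp R" "transp R" unfolding R_def symp_def transp_def by auto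
  moreover have "card {a \<in> marks 2. \<forall>x\<in>X. map x e ! 0 = map x e ! 1} = 2 ^ 2 * of_bool (\<forall>i\<in>set e. \<forall>j\<in>set e. R i j)" if len: "length e = 2" for e
  proof -
    obtain i j where e: "e = [i, j]" using length_2_cases[OF len] by blast
    have "(\<forall>x\<in>X. map x e ! 0 = map x e ! 1) \<longleftrightarrow> (\<forall>i\<in>set e. \<forall>j\<in>set e. R i j)"
      by (auto simp: e R_def)
    then show ?thesis by (simp only: card_marks_const)
  qed
  ultimately show "\<exists>k R. k \<le> 2 ^ 2 \<and> symp R \<and> transp R \<and>
     (\<forall>e. length e = 2 \<longrightarrow> set e \<subseteq> V \<longrightarrow>
        card {a \<in> marks 2. \<forall>x\<in>X. map x e ! 0 = map x e ! 1} = k * of_bool (\<forall>i\<in>set e. \<forall>j\<in>set e. R i j))"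
    by (intro exI[of _ "2 ^ 2"] exI[of _ R]) simp
qed (use assms in auto)

text \<open>The relation has a single class, the nodes with spin 1 in all of \<open>X\<close>; it is
  partial, since other nodes are not even related to themselves.\<close>

lemma spin_model_indep_set:
  assumes "1 \<le> r"
  shows "spin_model 2 2 r (\<lambda>a xs. xs ! 0 = 1 \<and> xs ! 1 = 1)"
proof
  fix X :: "(nat \<Rightarrow> nat) set" and V :: "nat set"
  define R where "R i j \<longleftrightarrow> (\<forall>x\<in>X. x i = 1 \<and> x j = 1)" for i j
  have "symp R" "transp R" unfolding R_def symp_def transp_def by auto
  moreover have "card {a \<in> marks 2. \<forall>x\<in>X. map x e ! 0 = 1 \<and> map x e ! 1 = 1} = 2 ^ 2 * of_bool (\<forall>i\<in>set e. \<forall>j\<in>set e. R i j)" if len: "length e = 2" for e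
  proof -
    obtain i j where e: "e = [i, j]" using length_2_cases[OF len] by blast
    have "(\<forall>x\<in>X. map x e ! 0 = 1 \<and> map x e ! 1 = 1) \<longleftrightarrow> (\<forall>i\<in>set e. \<forall>j\<in>set e. R i j)"
      by (auto simp: e R_def)
    then show ?thesis by (simp only: card_marks_const)
  qed
  ultimately show "\<exists>k R. k \<le> 2 ^ 2 \<and> symp R \<and> transp R \<and>
     (\<forall>e. length e = 2 \<longrightarrow> set e \<subseteq> V \<longrightarrow>
        card {a \<in> marks 2. \<forall>x\<in>X. map x e ! 0 = 1 \<and> map x e ! 1 = 1} = k * of_bool (\<forall>i\<in>set e. \<forall>j\<in>set e. R i j))"
    by (intro exI[of _ "2 ^ 2"] exI[of _ R]) simp
qed (use assms in auto)

lemma bit_inj: "bit a = bit b \<longleftrightarrow> a = b"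
  by (auto simp: bit_def split: if_splits)

lemma spin_model_ksat:
  assumes "2 \<le> K" "1 \<le> r"
  shows "spin_model K 2 r (\<lambda>a xs. xs = map bit a)"
proof
  fix X :: "(nat \<Rightarrow> nat) set" and V :: "nat set"
  assume X: "X \<noteq> {}" "X \<subseteq> PiE V (\<lambda>_. {..<2})"
  define fz where "fz i \<longleftrightarrow> (\<forall>x\<in>X. \<forall>y\<in>X. x i = y i)" for i
  define R where "R i j \<longleftrightarrow> fz i \<and> fz j" for i j
  have "symp R" "transp R" unfolding R_def symp_def transp_def by auto
  moreover have "card {a \<in> marks K. \<forall>x\<in>X. map x e = map bit a} = 1 * of_bool (\<forall>i\<in>set e. \<forall>j\<in>set e. R i j)"
    if e: "length e = K" "set e \<subseteq> V" for e
  proof -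
    have clq: "(\<forall>i\<in>set e. \<forall>j\<in>set e. R i j) \<longleftrightarrow> (\<forall>i\<in>set e. fz i)" unfolding R_def by blast
    show ?thesis
    proof (cases "\<forall>i\<in>set e. fz i")
      case True
      obtain x0 where x0: "x0 \<in> X" using X(1) by blast
      have lt: "x0 i < 2" if "i \<in> set e" for i using X(2) x0 e(2) that by (auto simp: PiE_def Pi_def)
      have b: "map bit (map (\<lambda>i. x0 i = 1) e) = map x0 e" by (auto simp: bit_def dest!: lt)
      have same: "map x e = map x0 e" if "x \<in> X" for x using True x0 that by (simp add: fz_def)
      have "{a \<in> marks K. \<forall>x\<in>X. map x e = map bit a} = {map (\<lambda>i. x0 i = 1) e}"
      proof (intro equalityI subsetI)
        fix a assume "a \<in> {a \<in> marks K. \<forall>x\<in>X. map x e = map bit a}"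
        then have "map bit a = map bit (map (\<lambda>i. x0 i = 1) e)" using x0 b by auto
        moreover have "inj bit" by (simp add: inj_def bit_inj)
        ultimately have "a = map (\<lambda>i. x0 i = 1) e" by (simp only: inj_map_eq_map)
        then show "a \<in> {map (\<lambda>i. x0 i = 1) e}" by simp
      next
        fix a assume "a \<in> {map (\<lambda>i. x0 i = 1) e}"
        then have "a = map (\<lambda>i. x0 i = 1) e" by simp
        then show "a \<in> {a \<in> marks K. \<forall>x\<in>X. map x e = map bit a}" using b same e(1) by (simp del: map_map)
      qed
      then show ?thesis using True clq by simp
    next
      case False
      then obtain i x y where i: "i \<in> set e" "x \<in> X" "y \<in> X" "x i \<noteq> y i" by (auto simp: fz_def)
      have "\<not> (\<forall>x\<in>X. map x e = map bit a)" for a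
      proof
        assume "\<forall>x\<in>X. map x e = map bit a"
        then have "map x e = map y e" using i(2,3) by simp
        then show False using i(1,4) by simp
      qed
      then have S: "{a \<in> marks K. \<forall>x\<in>X. map x e = map bit a} = {}" by blast
      show ?thesis unfolding S clq using False by simp
    qed
  qed
  ultimately show "\<exists>k R. k \<le> 2 ^ K \<and> symp R \<and> transp R \<and>
     (\<forall>e. length e = K \<longrightarrow> set e \<subseteq> V \<longrightarrow>
        card {a \<in> marks K. \<forall>x\<in>X. map x e = map bit a} = k * of_bool (\<forall>i\<in>set e. \<forall>j\<in>set e. R i j))"
    by (intro exI[of _ 1] exI[of _ R]) simp
qed (use assms in auto)

text \<open>Flipping all signs leaves a clause unchanged, so what has to be frozen is whether two
  nodes agree, not their spins. A clique then admits exactly two sign vectors, opposite to each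
  other.\<close>

lemma spin_model_naeksat:
  assumes K: "2 \<le> K" and r: "1 \<le> r"
  shows "spin_model K 2 r (\<lambda>a xs. xs = map bit a \<or> xs = map (\<lambda>b. 1 - bit b) a)"
proof
  fix X :: "(nat \<Rightarrow> nat) set" and V :: "nat set"
  assume X: "X \<noteq> {}" "X \<subseteq> PiE V (\<lambda>_. {..<2})"
  have bin: "x i = 0 \<or> x i = 1" if "x \<in> X" "i \<in> V" for x i
  proof -
    have "x i \<in> {..<2}" using X(2) that by (auto simp: PiE_def Pi_def)
    then show ?thesis by auto
  qed
  define R where "R i j \<longleftrightarrow> i \<in> V \<and> j \<in> V \<and> (\<forall>x\<in>X. \<forall>y\<in>X. (x i = x j) = (y i = y j))" for i j
  have "symp R" unfolding R_def symp_def by metis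
  moreover have "transp R"
  proof (rule transpI)
    fix i j k assume ij: "R i j" and jk: "R j k"
    have V: "i \<in> V" "j \<in> V" "k \<in> V" using ij jk by (auto simp: R_def)
    \<comment> \<open>This is where binary spins matter: agreement of i and k is determined by the
      other two agreements, which makes the relation transitive.\<close>
    have 3: "(x i = x k) = ((x i = x j) = (x j = x k))" if "x \<in> X" for x
      using bin[OF that V(1)] bin[OF that V(2)] bin[OF that V(3)] by auto
    have "(x i = x k) = (y i = y k)" if "x \<in> X" "y \<in> X" for x y
    proof -
      have "(x i = x j) = (y i = y j)" "(x j = x k) = (y j = y k)" using ij jk that unfolding R_def by blast+
      then show ?thesis using 3[OF that(1)] 3[OF that(2)] by argo
    qed
    then show "R i k" unfolding R_def using V by blast
  qed
  moreover have "card {a \<in> marks K. \<forall>x\<in>X. map x e = map bit a \<or> map x e = map (\<lambda>b. 1 - bit b) a} = 2 * of_bool (\<forall>i\<in>set e. \<forall>j\<in>set e. R i j)"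
    (is "card ?S = _") if e: "length e = K" "set e \<subseteq> V" for e
  proof (cases "\<forall>i\<in>set e. \<forall>j\<in>set e. R i j")
    case True
    obtain x0 where x0: "x0 \<in> X" using X(1) by blast
    define a0 where "a0 = map (\<lambda>i. x0 i = 1) e"
    define a1 where "a1 = map (\<lambda>i. x0 i \<noteq> 1) e"
    have len: "length a0 = K" "length a1 = K" using e(1) by (simp_all add: a0_def a1_def)
    have ne: "a0 \<noteq> a1" using e(1) K by (cases e) (auto simp: a0_def a1_def)
    have in_e: "\<And>i. i \<in> set e \<Longrightarrow> i \<in> V" using e(2) by blast
    have m0: "map bit a0 = map x0 e" "map (\<lambda>b. 1 - bit b) a1 = map x0 e"
      by (auto simp: a0_def a1_def bit_def dest!: bin[OF x0 in_e])
    have m1: "map bit a1 = map (\<lambda>i. 1 - x0 i) e" "map (\<lambda>b. 1 - bit b) a0 = map (\<lambda>i. 1 - x0 i) e"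
      by (auto simp: a0_def a1_def bit_def dest!: bin[OF x0 in_e])
    have two: "map x e = map x0 e \<or> map x e = map (\<lambda>i. 1 - x0 i) e" if x: "x \<in> X" for x
    proof -
      obtain i0 where i0: "i0 \<in> set e" using e(1) K by (cases e) auto
      have rel: "(x i = x i0) = (x0 i = x0 i0)" if "i \<in> set e" for i
        using True that i0 x x0 unfolding R_def by blast
      show ?thesis
      proof (cases "x i0 = x0 i0")
        case True
        have "x i = x0 i" if "i \<in> set e" for i
          using rel[OF that] True bin[OF x in_e[OF that]] bin[OF x0 in_e[OF that]] bin[OF x in_e[OF i0]] by auto
        then show ?thesis by simp
      next
        case False
        have "x i = 1 - x0 i" if "i \<in> set e" for i
          using rel[OF that] False bin[OF x in_e[OF that]] bin[OF x0 in_e[OF that]] bin[OF x in_e[OF i0]] bin[OF x0 in_e[OF i0]] by auto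
        then show ?thesis by simp
      qed
    qed
    have inj0: "inj bit" by (auto simp: inj_def bit_inj)
    have inj1: "inj (\<lambda>b. 1 - bit b)" by (auto simp: inj_def bit_def split: if_splits)
    have S: "?S = {a0, a1}"
    proof (intro equalityI subsetI)
      fix a assume "a \<in> ?S"
      then have "map x0 e = map bit a \<or> map x0 e = map (\<lambda>b. 1 - bit b) a" using x0 by blast
      then have "map bit a = map bit a0 \<or> map (\<lambda>b. 1 - bit b) a = map (\<lambda>b. 1 - bit b) a1" unfolding m0 by auto
      then show "a \<in> {a0, a1}" using inj_map_eq_map[OF inj0] inj_map_eq_map[OF inj1] by blast
    next
      fix a assume "a \<in> {a0, a1}"
      then consider "a = a0" | "a = a1" by blast
      then show "a \<in> ?S"
      proof cases
        case 1
        have "map x e = map bit a0 \<or> map x e = map (\<lambda>b. 1 - bit b) a0" if "x \<in> X" for x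
          using two[OF that] unfolding m0 m1 .
        then show ?thesis unfolding 1 using len by blast
      next
        case 2
        have "map x e = map bit a1 \<or> map x e = map (\<lambda>b. 1 - bit b) a1" if "x \<in> X" for x
          using two[OF that] unfolding m0 m1 by blast
        then show ?thesis unfolding 2 using len by blast
      qed
    qed
    show ?thesis unfolding S using ne True by simp
  next
    case False
    then obtain i j where ij: "i \<in> set e" "j \<in> set e" "\<not> R i j" by blast
    then obtain x y where xy: "x \<in> X" "y \<in> X" "(x i = x j) \<noteq> (y i = y j)" using e(2) unfolding R_def by blast
    obtain s t where st: "s < length e" "t < length e" "i = e ! s" "j = e ! t" using ij by (metis in_set_conv_nth)
    have key: "(x i = x j) = (a ! s = a ! t)" if "map x e = map bit a \<or> map x e = map (\<lambda>b. 1 - bit b) a" "length a = length e" for x a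
    proof -
      have "map x e ! s = x i" "map x e ! t = x j" using st by auto
      then show ?thesis using that st by (elim disjE) (auto simp: bit_def split: if_splits)
    qed
    have S: "?S = {}"
    proof (rule equals0I)
      fix a assume "a \<in> ?S"
      then have "(x i = x j) = (a ! s = a ! t)" "(y i = y j) = (a ! s = a ! t)"
        using xy(1,2) e(1) by (auto intro!: key)
      then show False using xy(3) by simp
    qed
    show ?thesis unfolding S using False by simp
  qed
  moreover have "(2::nat) \<le> 2 ^ K" using K self_le_power[of "2::nat" K] by simp
  ultimately show "\<exists>k R. k \<le> 2 ^ K \<and> symp R \<and> transp R \<and>
     (\<forall>e. length e = K \<longrightarrow> set e \<subseteq> V \<longrightarrow>
        card {a \<in> marks K. \<forall>x\<in>X. map x e = map bit a \<or> map x e = map (\<lambda>b. 1 - bit b) a} = k * of_bool (\<forall>i\<in>set e. \<forall>j\<in>set e. R i j))"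
    by (intro exI[of _ 2] exI[of _ R]) simp
qed (use assms in auto)

section \<open>Independent sets: from penalties to the hard constraint\<close>

locale indep_set =
  fixes r :: nat
  assumes r_ge_1: "1 \<le> r"

sublocale indep_set \<subseteq> spin_model 2 2 r "\<lambda>s. if s = 1 then 1 else 0" "\<lambda>a xs. xs ! 0 = 1 \<and> xs ! 1 = 1"
  by (rule spin_model_indep_set[OF r_ge_1])

context indep_set
begin

definition violated :: "(nat \<Rightarrow> nat) \<Rightarrow> nat set \<Rightarrow> bool" where
  "violated x B \<longleftrightarrow> map x (edge_nodes r B) ! 0 = 1 \<and> map x (edge_nodes r B) ! 1 = 1"

lemma ev_violated:
  assumes "finite P"
  shows "ev V (mark_graph P a) x = (\<Sum>i\<in>V. if x i = 1 then 1 else 0) + real (card P) - real (card {B \<in> P. violated x B})"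
proof -
  have "(\<Sum>B\<in>P. of_bool (\<not> violated x B)) = (\<Sum>B\<in>P. 1 - of_bool (violated x B) :: real)" by (intro sum.cong) auto
  also have "\<dots> = real (card P) - real (card {B \<in> P. violated x B})"
    using assms by (simp add: sum_subtractf Int_def)
  finally show ?thesis unfolding ev_mark_graph violated_def[symmetric] by simp
qed

text \<open>Giving an endpoint of a violated edge the spin 0 costs 1 and repairs at least one violated edge, so a
  penalty of 1 per violated edge is as good as a hard constraint.\<close>

lemma repair_violations:
  assumes P: "P \<in> config_partitions N r 2"
  shows "x \<in> Xs {..<N} \<Longrightarrow> \<exists>y\<in>Xs {..<N}. {B \<in> P. violated y B} = {} \<and> ev {..<N} (mark_graph P a) x \<le> ev {..<N} (mark_graph P a) y"
proof (induction "card {B \<in> P. violated x B}" arbitrary: x rule: less_induct)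
  case less
  have fin: "finite P" by (rule config_partitions_finite[OF P])
  show ?case
  proof (cases "{B \<in> P. violated x B} = {}")
    case True
    then show ?thesis using less.prems by (intro bexI[of _ x]) auto
  next
    case False
    then obtain B where B: "B \<in> P" "violated x B" by blast
    define i where "i = edge_nodes r B ! 0"
    have len: "length (edge_nodes r B) = 2" and sub: "set (edge_nodes r B) \<subseteq> {..<N}" using config_edge_length[OF P B(1)] .
    have "i \<in> set (edge_nodes r B)" unfolding i_def using len by (intro nth_mem) simp
    then have i: "i < N" using sub by auto
    have xi: "x i = 1" using B(2) len by (simp add: violated_def i_def)
    define y where "y = x(i := 0)"
    have y: "y \<in> Xs {..<N}" using less.prems i unfolding Xs_def y_def PiE_def extensional_def by auto
    have dec: "violated x B'" if "B' \<in> P" "violated y B'" for B'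
    proof -
      have l: "length (edge_nodes r B') = 2" using config_edge_length[OF P that(1)] by simp
      show ?thesis using that(2) l by (auto simp: violated_def y_def split: if_splits)
    qed
    have "\<not> violated y B" using len by (simp add: violated_def y_def i_def)
    then have "{B \<in> P. violated y B} \<subset> {B \<in> P. violated x B}" using dec B by blast
    then have lt: "card {B \<in> P. violated y B} < card {B \<in> P. violated x B}" using fin by (intro psubset_card_mono) auto
    have "(\<Sum>j<N. if x j = 1 then 1 else 0 :: real) = 1 + (\<Sum>j\<in>{..<N} - {i}. if x j = 1 then 1 else 0)"
      using i xi by (subst sum.remove[of _ i]) auto
    moreover have "(\<Sum>j<N. if y j = 1 then 1 else 0 :: real) = 0 + (\<Sum>j\<in>{..<N} - {i}. if x j = 1 then 1 else 0)"
      using i by (subst sum.remove[of _ i]) (auto simp: y_def intro!: sum.cong)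
    ultimately have "ev {..<N} (mark_graph P a) x \<le> ev {..<N} (mark_graph P a) y"
      unfolding ev_violated[OF fin] using lt by simp
    then show ?thesis using less.hyps[OF lt y] by (meson order_trans)
  qed
qed

text \<open>\<open>ev\<close> rewards each satisfied edge by 1, so after subtracting the number of
  edges it charges 1 per violated edge. This dominates the hard-constrained energy and agrees with
  it on independent sets, where \<open>repair_violations\<close> finds an optimum.\<close>

lemma H_graph_indep_set:
  assumes P: "P \<in> config_partitions N r 2" and a: "a \<in> PiE P (\<lambda>_. marks 2)"
  shows "H_graph indep_set_model N r (P, a) = ereal (1 * mx {..<N} (mark_graph P a) + (- 1) * real (card P))"
proof -
  let ?Q = "mark_graph P a"
  let ?\<nu> = "\<lambda>x. (\<Sum>i<N. if x i = 1 then 1 else 0 :: real)"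
  have fin: "finite P" by (rule config_partitions_finite[OF P])
  have node: "(\<Sum>i<N. node_pot indep_set_model (x i)) = ereal (?\<nu> x)" for x
    unfolding sum_ereal[symmetric] by (intro sum.cong refl) (simp add: indep_set_model_def)
  have edge: "edge_pot indep_set_model (a B) (map x (edge_nodes r B)) = (if violated x B then -\<infinity> else 0)" for x B
    by (simp add: indep_set_model_def violated_def)
  have ok: "H_config indep_set_model N r P a x = ereal (ev {..<N} ?Q x - real (card P))" if "{B \<in> P. violated x B} = {}" for x
  proof -
    have "(\<Sum>B\<in>P. if violated x B then -\<infinity> else 0 :: ereal) = 0" using that by (intro sum.neutral) auto
    then show ?thesis unfolding H_config_def node edge ev_violated[OF fin] that by simp
  qed
  have le: "H_config indep_set_model N r P a x \<le> ereal (ev {..<N} ?Q x - real (card P))" for x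
  proof (cases "{B \<in> P. violated x B} = {}")
    case True
    then show ?thesis using ok by simp
  next
    case False
    then obtain B where B: "B \<in> P" "violated x B" by blast
    \<comment> \<open>One violated edge makes the whole sum -\<infinity>, as the other terms are at
      most 0 and none can be +\<infinity>.\<close>
    have "(\<Sum>B\<in>P. if violated x B then -\<infinity> else 0 :: ereal) = -\<infinity> + (\<Sum>B\<in>P - {B}. if violated x B then -\<infinity> else 0 :: ereal)"
      using B fin by (subst sum.remove[of _ B]) auto
    moreover have "(\<Sum>B\<in>P - {B}. if violated x B then -\<infinity> else 0 :: ereal) \<le> 0" by (intro sum_nonpos) auto
    ultimately have "(\<Sum>B\<in>P. if violated x B then -\<infinity> else 0 :: ereal) = -\<infinity>"
      by (metis ereal_infty_less_eq(1) ereal_plus_1(4) PInfty_neq_ereal(1) ereal_MInfty_eq_plus zero_ereal_def)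
    then show ?thesis unfolding H_config_def node edge by simp
  qed
  have X: "PiE {..<N} (\<lambda>_. {..<mq indep_set_model}) = Xs {..<N}" by (simp add: Xs_def indep_set_model_def)
  obtain x where x: "x \<in> Xs {..<N}" "ev {..<N} ?Q x = mx {..<N} ?Q" using mx_attained[of "{..<N}"] by blast
  obtain y where y: "y \<in> Xs {..<N}" "{B \<in> P. violated y B} = {}" "ev {..<N} ?Q x \<le> ev {..<N} ?Q y"
    using repair_violations[OF P x(1)] by blast
  have ymx: "ev {..<N} ?Q y = mx {..<N} ?Q" using y x ev_le_mx[of "{..<N}" y ?Q] by simp
  show ?thesis
    unfolding H_graph_def X fst_conv snd_conv
  proof (rule Max_eqI)
    show "finite (H_config indep_set_model N r P a ` Xs {..<N})" by (simp add: finite_Xs)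
    show "ereal (1 * mx {..<N} ?Q + (- 1) * real (card P)) \<in> H_config indep_set_model N r P a ` Xs {..<N}"
      using ok[OF y(2)] y(1) ymx by (intro image_eqI[of _ _ y]) auto
    fix v assume "v \<in> H_config indep_set_model N r P a ` Xs {..<N}"
    then obtain x' where x': "x' \<in> Xs {..<N}" "v = H_config indep_set_model N r P a x'" by blast
    have "ev {..<N} ?Q x' \<le> mx {..<N} ?Q" using x'(1) by (intro ev_le_mx) auto
    then have "ereal (ev {..<N} ?Q x' - real (card P)) \<le> ereal (1 * mx {..<N} ?Q + (- 1) * real (card P))" by simp
    then show "v \<le> ereal (1 * mx {..<N} ?Q + (- 1) * real (card P))" unfolding x'(2) by (rule order_trans[OF le])
  qed
qed

end

theorem theorem3:
  fixes r :: nat and M :: model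
  assumes "r \<ge> 1" and "paper_model M"
  shows "\<exists>h :: real. \<forall>\<epsilon>>0. \<forall>\<delta>>0. \<exists>N0. \<forall>N\<ge>N0. mK M dvd N * r \<longrightarrow>
           measure_pmf.prob (random_hypergraph (mK M) N r)
             {G. \<not> (ereal (real N * (h - \<epsilon>)) \<le> H_graph M N r G
                    \<and> H_graph M N r G \<le> ereal (real N * (h + \<epsilon>)))} < \<delta>"
proof -
  consider "M = indep_set_model" | "M = maxcut_model" | \<beta> B where "\<beta> > 0" "M = ising_model \<beta> B"
    | q where "q \<ge> 2" "M = coloring_model q" | K where "K \<ge> 2" "M = ksat_model K" | K where "K \<ge> 2" "M = naeksat_model K"
    using assms(2) unfolding paper_model_def by blast
  then show ?thesis
  proof cases
    case 1
    interpret indep_set r by unfold_locales (rule assms(1))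
    have K: "mK indep_set_model = 2" by (simp add: indep_set_model_def)
    show ?thesis unfolding 1 K by (rule in_probability_limit[OF zero_less_one H_graph_indep_set])
  next
    case 2
    interpret spin_model 2 2 r "\<lambda>_. 0" "\<lambda>a xs. xs ! 0 = xs ! 1"
      by (rule spin_model_equal_pair) (use assms(1) in auto)
    have K: "mK M = 2" by (simp add: 2 maxcut_model_def)
    show ?thesis unfolding K
      by (rule in_probability_limit[OF zero_less_one H_graph_finite_potentials[where base = 0]])
        (auto simp: 2 maxcut_model_def)
  next
    case (3 \<beta> B)
    \<comment> \<open>The two edge values differ by 2 \<beta>, so the field is measured in this unit
      and the base value is - \<beta>.\<close>
    interpret spin_model 2 2 r "\<lambda>s. (if s = 0 then - B else B) / (2 * \<beta>)" "\<lambda>a xs. xs ! 0 = xs ! 1"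
      by (rule spin_model_equal_pair) (use assms(1) in auto)
    have K: "mK M = 2" by (simp add: 3 ising_model_def)
    have c: "0 < 2 * \<beta>" using 3 by simp
    show ?thesis unfolding K
      by (rule in_probability_limit[OF c H_graph_finite_potentials[where base = "- \<beta>"]])
        (use 3(1) in \<open>auto simp: 3(2) ising_model_def\<close>)
  next
    case (4 q)
    interpret spin_model 2 q r "\<lambda>_. 0" "\<lambda>a xs. xs ! 0 = xs ! 1"
      by (rule spin_model_equal_pair) (use assms(1) 4 in auto)
    have K: "mK M = 2" by (simp add: 4 coloring_model_def)
    show ?thesis unfolding K
      by (rule in_probability_limit[OF zero_less_one H_graph_finite_potentials[where base = 0]])
        (auto simp: 4 coloring_model_def)
  next
    case (5 K)
    interpret spin_model K 2 r "\<lambda>_. 0" "\<lambda>a xs. xs = map bit a"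
      by (rule spin_model_ksat) (use assms(1) 5 in auto)
    have K: "mK M = K" by (simp add: 5 ksat_model_def)
    show ?thesis unfolding K
      by (rule in_probability_limit[OF zero_less_one H_graph_finite_potentials[where base = 0]])
        (auto simp: 5 ksat_model_def)
  next
    case (6 K)
    interpret spin_model K 2 r "\<lambda>_. 0" "\<lambda>a xs. xs = map bit a \<or> xs = map (\<lambda>b. 1 - bit b) a"
      by (rule spin_model_naeksat) (use assms(1) 6 in auto)
    have K: "mK M = K" by (simp add: 6 naeksat_model_def)
    show ?thesis unfolding K
      by (rule in_probability_limit[OF zero_less_one H_graph_finite_potentials[where base = 0]])
        (auto simp: 6 naeksat_model_def)
  qed
qed

end
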